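(* Let $\mathbb M=\{M_j\}$ be a good $\mathfrak q$-filtration of a module $M$ of dimension $r\ge1$, let $J$ be an ideal generated by a maximal $\mathbb M$-superficial sequence for $\mathfrak q$, and let $\mathbb N=\{J^jM\}_{j\ge0}$ be the $J$-adic filtration on $M$. Then $$e_1(\mathbb M)-e_1(\mathbb N)\le\sum_{j\ge0}\lambda(M_{j+1}/JM_j).$$
   Context: $(A,\mathfrak m)$ is a commutative Noetherian local ring, $\mathfrak q$ is a (proper) $\mathfrak m$-primary ideal of $A$, $M$ is a nonzero finitely generated $A$-module, and $\lambda(\cdot)$ denotes length. A good $\mathfrak q$-filtration $\mathbb M=\{M_n\}_{n\ge 0}$ of $M$ is a chain of submodules $M=M_0\supseteq M_1\supseteq\cdots$ with $\mathfrak qM_n\subseteq M_{n+1}$ for all $n$ and $M_{n+1}=\mathfrak qM_n$ for all large $n$. The Hilbert series is $P_{\mathbb M}(z)=\sum_{n\ge0}\lambda(M_n/M_{n+1})z^n=h_{\mathbb M}(z)/(1-z)^r$ with $h_{\mathbb M}(z)\in\mathbb Z[z]$, $h_{\mathbb M}(1)\ne0$, $r=\dim M$. The Hilbert coefficients are $e_i(\mathbb M)=h_{\mathbb M}^{(i)}(1)/i!$. The same definitions apply to the filtration $\mathbb N=\{J^jM\}$, which is a good $J$-filtration with $\lambda(M/JM)<\infty$. For a submodule $N$ of $M$, $\mathbb M/N$ is the good $\mathfrak q$-filtration $\{(M_n+N)/N\}$ of $M/N$. An element $a\in\mathfrak q$ is $\mathbb M$-superficial for $\mathfrak q$ if there is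 $c\ge0$ such that $(M_{n+1}:_Ma)\cap M_c=M_n$ for all $n\ge c$. A sequence $a_1,\dots,a_t\in\mathfrak q$ is an $\mathbb M$-superficial sequence for $\mathfrak q$ if each $a_i$ is $\mathbb M/(a_1,\dots,a_{i-1})M$-superficial for $\mathfrak q$. It is maximal if $\mathbb M/(a_1,\dots,a_t)M$ is nilpotent (its $n$-th term is $0$ for $n\gg0$) but $\mathbb M/(a_1,\dots,a_{t-1})M$ is not; when $\dim M=r\ge1$ a maximal superficial sequence has length $t=r$. (Then $M_{n+1}=JM_n$ for $n\gg0$, so the sum is finite.) *)

theory Defs
  imports
    "HOL-Library.Extended_Real"
    "HOL-Computational_Algebra.Polynomial_FPS"
    "HOL-Algebra.Module"
    "HOL-Algebra.Ring_Divisibility"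
    "HOL-Algebra.Ideal_Product"
begin

section \<open>Local rings, primary ideals and Krull dimension\<close>

definition noetherian_local_ring :: "('a, 'c) ring_scheme \<Rightarrow> 'a set \<Rightarrow> bool" where
  "noetherian_local_ring R m \<longleftrightarrow>
     cring R \<and> noetherian_ring R \<and> maximalideal m R \<and> (\<forall>m'. maximalideal m' R \<longrightarrow> m' = m)"

definition ideal_radical :: "('a, 'c) ring_scheme \<Rightarrow> 'a set \<Rightarrow> 'a set" where
  "ideal_radical R I = {a \<in> carrier R. \<exists>n::nat. a [^]\<^bsub>R\<^esub> n \<in> I}"

definition primary_ideal :: "('a, 'c) ring_scheme \<Rightarrow> 'a set \<Rightarrow> bool" where
  "primary_ideal R q \<longleftrightarrow> ideal q R \<and> q \<noteq> carrier R \<and>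
     (\<forall>a\<in>carrier R. \<forall>b\<in>carrier R. a \<otimes>\<^bsub>R\<^esub> b \<in> q \<longrightarrow> a \<in> q \<or> (\<exists>n::nat. b [^]\<^bsub>R\<^esub> n \<in> q))"

definition primary_to :: "('a, 'c) ring_scheme \<Rightarrow> 'a set \<Rightarrow> 'a set \<Rightarrow> bool" where
  "primary_to R m q \<longleftrightarrow> primary_ideal R q \<and> ideal_radical R q = m"

definition krull_dim :: "('a, 'c) ring_scheme \<Rightarrow> enat" where
  "krull_dim R = Sup {enat n | n. \<exists>P :: nat \<Rightarrow> 'a set.
     (\<forall>i\<le>n. primeideal (P i) R) \<and> (\<forall>i<n. P i \<subset> P (Suc i))}"

section \<open>Modules\<close>

definition submodule_span ::
    "('a, 'c) ring_scheme \<Rightarrow> ('a, 'b, 'd) module_scheme \<Rightarrow> 'b set \<Rightarrow> 'b set" where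
  "submodule_span R M S = \<Inter>{N. submodule N R M \<and> S \<subseteq> N}"

definition fin_gen_module ::
    "('a, 'c) ring_scheme \<Rightarrow> ('a, 'b, 'd) module_scheme \<Rightarrow> bool" where
  "fin_gen_module R M \<longleftrightarrow> (\<exists>S. finite S \<and> S \<subseteq> carrier M \<and> carrier M = submodule_span R M S)"

definition ideal_mult ::
    "('a, 'c) ring_scheme \<Rightarrow> ('a, 'b, 'd) module_scheme \<Rightarrow> 'a set \<Rightarrow> 'b set \<Rightarrow> 'b set" where
  "ideal_mult R M I N = submodule_span R M {a \<odot>\<^bsub>M\<^esub> x | a x. a \<in> I \<and> x \<in> N}"

definition annihilator ::
    "('a, 'c) ring_scheme \<Rightarrow> ('a, 'b, 'd) module_scheme \<Rightarrow> 'a set" where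
  "annihilator R M = {a \<in> carrier R. \<forall>x\<in>carrier M. a \<odot>\<^bsub>M\<^esub> x = \<zero>\<^bsub>M\<^esub>}"

definition module_dim ::
    "('a, 'c) ring_scheme \<Rightarrow> ('a, 'b, 'd) module_scheme \<Rightarrow> enat" where
  "module_dim R M = krull_dim (R Quot annihilator R M)"

definition module_length ::
    "('a, 'c) ring_scheme \<Rightarrow> ('a, 'b, 'd) module_scheme \<Rightarrow> enat" where
  "module_length R M = Sup {enat n | n. \<exists>C :: nat \<Rightarrow> 'b set.
     (\<forall>i\<le>n. submodule (C i) R M) \<and> (\<forall>i<n. C i \<subset> C (Suc i))}"

text \<open>Module records inherit the ring fields \<^const>\<open>mult\<close> and \<^const>\<open>one\<close>, which play no role for
  modules; in the quotient they are filled in as in \<^const>\<open>FactRing\<close>.\<close>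

definition quot_module ::
    "('a, 'b, 'd) module_scheme \<Rightarrow> 'b set \<Rightarrow> ('a, 'b set) module" where
  "quot_module M N =
     \<lparr>carrier = a_rcosets\<^bsub>M\<^esub> N, mult = rcoset_mult M N, one = N +>\<^bsub>M\<^esub> \<one>\<^bsub>M\<^esub>,
      zero = N, add = set_add M, smult = (\<lambda>a Y. \<Union>x\<in>Y. N +>\<^bsub>M\<^esub> (a \<odot>\<^bsub>M\<^esub> x))\<rparr>"

definition length_quot ::
    "('a, 'c) ring_scheme \<Rightarrow> ('a, 'b, 'd) module_scheme \<Rightarrow> 'b set \<Rightarrow> 'b set \<Rightarrow> enat" where
  "length_quot R M N L = module_length R (quot_module (M\<lparr>carrier := N\<rparr>) L)"

section \<open>Filtrations and Hilbert coefficients\<close>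

definition good_filtration ::
    "('a, 'c) ring_scheme \<Rightarrow> ('a, 'b, 'd) module_scheme \<Rightarrow> 'a set \<Rightarrow> (nat \<Rightarrow> 'b set) \<Rightarrow> bool" where
  "good_filtration R M q F \<longleftrightarrow>
     F 0 = carrier M \<and> (\<forall>n. submodule (F n) R M) \<and> (\<forall>n. F (Suc n) \<subseteq> F n) \<and>
     (\<forall>n. ideal_mult R M q (F n) \<subseteq> F (Suc n)) \<and>
     (\<exists>n0. \<forall>n\<ge>n0. F (Suc n) = ideal_mult R M q (F n))"

definition adic_filtration ::
    "('a, 'c) ring_scheme \<Rightarrow> ('a, 'b, 'd) module_scheme \<Rightarrow> 'a set \<Rightarrow> nat \<Rightarrow> 'b set" where
  "adic_filtration R M J n = ideal_mult R M (J [^]\<^bsub>ideals_set R\<^esub> n) (carrier M)"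

text \<open>For the filtrations considered all the lengths occurring here are finite.\<close>

definition hilbert_series ::
    "('a, 'c) ring_scheme \<Rightarrow> ('a, 'b, 'd) module_scheme \<Rightarrow> (nat \<Rightarrow> 'b set) \<Rightarrow> int fps" where
  "hilbert_series R M F = Abs_fps (\<lambda>n. int (the_enat (length_quot R M (F n) (F (Suc n)))))"

text \<open>The polynomial \<open>h\<close> with \<open>P(z) = h(z) / (1 - z)^r\<close>, where \<open>r = dim M\<close>. Since the exponent is
  prescribed, \<open>h\<close> is unique; that \<open>h(1) \<noteq> 0\<close> is a property of \<open>h\<close> and not needed to single it out.\<close>

definition h_poly ::
    "('a, 'c) ring_scheme \<Rightarrow> ('a, 'b, 'd) module_scheme \<Rightarrow> (nat \<Rightarrow> 'b set) \<Rightarrow> int poly" where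
  "h_poly R M F = (THE h. fps_of_poly h =
     hilbert_series R M F * (1 - fps_X) ^ the_enat (module_dim R M))"

definition hilbert_coeff ::
    "('a, 'c) ring_scheme \<Rightarrow> ('a, 'b, 'd) module_scheme \<Rightarrow> (nat \<Rightarrow> 'b set) \<Rightarrow> nat \<Rightarrow> real" where
  "hilbert_coeff R M F i = of_int (poly ((pderiv ^^ i) (h_poly R M F)) 1) / fact i"

section \<open>Superficial sequences\<close>

definition colon ::
    "('a, 'b, 'd) module_scheme \<Rightarrow> 'b set \<Rightarrow> 'a \<Rightarrow> 'b set" where
  "colon M N a = {x \<in> carrier M. a \<odot>\<^bsub>M\<^esub> x \<in> N}"

definition superficial ::
    "('a, 'b, 'd) module_scheme \<Rightarrow> 'a set \<Rightarrow> (nat \<Rightarrow> 'b set) \<Rightarrow> 'a \<Rightarrow> bool" where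
  "superficial M q F a \<longleftrightarrow> a \<in> q \<and> (\<exists>c. \<forall>n\<ge>c. colon M (F (Suc n)) a \<inter> F c = F n)"

definition quot_filtration ::
    "('a, 'b, 'd) module_scheme \<Rightarrow> (nat \<Rightarrow> 'b set) \<Rightarrow> 'b set \<Rightarrow> nat \<Rightarrow> 'b set set" where
  "quot_filtration M F N n = (\<lambda>x. N +>\<^bsub>M\<^esub> x) ` (F n <+>\<^bsub>M\<^esub> N)"

definition nilpotent_filtration ::
    "('a, 'b, 'd) module_scheme \<Rightarrow> (nat \<Rightarrow> 'b set) \<Rightarrow> bool" where
  "nilpotent_filtration M F \<longleftrightarrow> (\<exists>n0. \<forall>n\<ge>n0. F n = {\<zero>\<^bsub>M\<^esub>})"

abbreviation gen_mult ::
    "('a, 'c) ring_scheme \<Rightarrow> ('a, 'b, 'd) module_scheme \<Rightarrow> 'a list \<Rightarrow> 'b set" where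
  "gen_mult R M as \<equiv> ideal_mult R M (Idl\<^bsub>R\<^esub> (set as)) (carrier M)"

definition superficial_sequence ::
    "('a, 'c) ring_scheme \<Rightarrow> ('a, 'b, 'd) module_scheme \<Rightarrow> 'a set \<Rightarrow> (nat \<Rightarrow> 'b set) \<Rightarrow> 'a list \<Rightarrow> bool"
  where
  "superficial_sequence R M q F as \<longleftrightarrow>
     (\<forall>i<length as. let N = gen_mult R M (take i as) in
        superficial (quot_module M N) q (quot_filtration M F N) (as ! i))"

definition maximal_superficial_sequence ::
    "('a, 'c) ring_scheme \<Rightarrow> ('a, 'b, 'd) module_scheme \<Rightarrow> 'a set \<Rightarrow> (nat \<Rightarrow> 'b set) \<Rightarrow> 'a list \<Rightarrow> bool"
  where
  "maximal_superficial_sequence R M q F as \<longleftrightarrow>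
     as \<noteq> [] \<and> superficial_sequence R M q F as \<and>
     (let N = gen_mult R M as in
        nilpotent_filtration (quot_module M N) (quot_filtration M F N)) \<and>
     (let N = gen_mult R M (butlast as) in
        \<not> nilpotent_filtration (quot_module M N) (quot_filtration M F N))"

end

theory Submission
  imports Defs
begin

text \<open>
  Write \<open>t\<close> for the number of generators of \<open>J\<close>, \<open>r\<close> for the dimension of \<open>M\<close> and \<open>v\<^sub>j\<close> for the length
  of \<open>F\<^sub>j\<^sub>+\<^sub>1 / J F\<^sub>j\<close>. The two Hilbert-Samuel functions differ by the length of \<open>F\<^sub>n\<^sub>+\<^sub>1 / J\<^sup>n\<^sup>+\<^sup>1 M\<close>.
  In the chain \<open>F\<^sub>n\<^sub>+\<^sub>1 \<supseteq> J F\<^sub>n \<supseteq> J\<^sup>2 F\<^sub>n\<^sub>-\<^sub>1 \<supseteq> \<dots> \<supseteq> J\<^sup>n\<^sup>+\<^sup>1 F\<^sub>0\<close> the \<open>i\<close>-th factor is a quotient of one copy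
  of \<open>F\<^sub>n\<^sub>-\<^sub>i\<^sub>+\<^sub>1 / J F\<^sub>n\<^sub>-\<^sub>i\<close> for each monomial of degree \<open>i\<close> in the generators of \<open>J\<close>. Since \<open>t \<le> r\<close>, there
  are at most \<open>(n + r - 1) choose (r - 1)\<close> such monomials, and the length in question is at most
  this number times \<open>\<Sum>\<^sub>j v\<^sub>j\<close> (\<open>qlen_F_powers_le\<close>). If the sum is infinite, nothing is claimed; so
  let it be finite.

  On the other hand that length is the \<open>n\<close>-th coefficient of \<open>(h\<^sub>N(z) - h\<^sub>F(z)) / (1 - z)\<^sup>r\<^sup>+\<^sup>1\<close>, with \<open>h\<^sub>N\<close>
  for the \<open>J\<close>-adic filtration and \<open>h\<^sub>F\<close> for \<open>F\<close>. Growth of order at most \<open>n\<^sup>r\<^sup>-\<^sup>1\<close> forces \<open>h\<^sub>N(1) = h\<^sub>F(1)\<close>, and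
  comparing the coefficients of \<open>n\<^sup>r\<^sup>-\<^sup>1\<close> on both sides gives the theorem (\<open>derivative_bound\<close>).

  What remains is that both Hilbert series become polynomials after multiplication by \<open>(1 - z)\<^sup>r\<close>.

  For \<open>F\<close>, let \<open>L\<^sub>i(n)\<close> be the length of \<open>M / (F\<^sub>n + (a\<^sub>1, \<dots>, a\<^sub>i) M)\<close>. Superficiality gives
  \<open>L\<^sub>i(n + 1) - L\<^sub>i(n) = L\<^sub>i\<^sub>+\<^sub>1(n + 1) - \<kappa>(n)\<close>, where \<open>\<kappa>\<close> is eventually a decreasing sequence of natural
  numbers and therefore eventually constant (\<open>superficial_step\<close>). As \<open>L\<^sub>t\<close> is eventually constant,
  \<open>L\<^sub>0\<close> has a generating function with a pole of order at most \<open>t + 1\<close>.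

  For the \<open>J\<close>-adic filtration, the lexicographic order on monomials breaks \<open>J\<^sup>n M / J\<^sup>n\<^sup>+\<^sup>1 M\<close> up into
  pieces \<open>M / K\<^sub>\<alpha>\<close>, one for each exponent \<open>\<alpha>\<close> of degree \<open>n\<close>, and \<open>K\<^sub>\<alpha>\<close> grows with \<open>\<alpha>\<close>. An antitone
  function on \<open>\<nat>\<^sup>t\<close> stabilises in each direction, so its sums over the degrees have a generating
  function with a pole of order at most \<open>t\<close> (\<open>pole_le_antitone_idx\<close>).

  Finally \<open>t \<le> r\<close>. The same recurrence, started at the unbounded function \<open>L\<^sub>t\<^sub>-\<^sub>1\<close>, shows that
  \<open>L\<^sub>0\<close> is not \<open>O(n\<^sup>t\<^sup>-\<^sup>1)\<close>. Such growth produces a chain of \<open>t + 1\<close> primes that contain the annihilator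
  of \<open>M\<close>: an ideal \<open>P\<close> that is maximal among those for which the lengths of \<open>M / (F\<^sub>n + P M)\<close> are not
  \<open>O(n\<^sup>d)\<close> is prime, and adding to \<open>P\<close> an element of \<open>q\<close> outside \<open>P\<close> costs at most one degree of
  growth (\<open>growth_imp_prime_chain\<close>).
\<close>

section \<open>Submodules\<close>

context module
begin

abbreviation sub where "sub X \<equiv> submodule X R M"

abbreviation zero_M ("\<zero>\<^sub>M") where "\<zero>\<^sub>M \<equiv> \<zero>\<^bsub>M\<^esub>"
abbreviation add_M (infixl "\<oplus>\<^sub>M" 65) where "x \<oplus>\<^sub>M y \<equiv> x \<oplus>\<^bsub>M\<^esub> y"
abbreviation smult_M (infixl "\<odot>\<^sub>M" 70) where "a \<odot>\<^sub>M x \<equiv> a \<odot>\<^bsub>M\<^esub> x"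
abbreviation coset_M (infixl "+>\<^sub>M" 60) where "X +>\<^sub>M x \<equiv> X +>\<^bsub>M\<^esub> x"
abbreviation sum_M (infixl "<+>\<^sub>M" 60) where "X <+>\<^sub>M Y \<equiv> X <+>\<^bsub>M\<^esub> Y"
abbreviation mult_M (infix "\<star>" 70) where "B \<star> X \<equiv> ideal_mult R M B X"

lemma sub_carrier: "sub X \<Longrightarrow> x \<in> X \<Longrightarrow> x \<in> carrier M"
  using submoduleE(1) by blast

lemma sub_zero: "sub X \<Longrightarrow> \<zero>\<^sub>M \<in> X"
  using submodule.axioms(1) subgroup.one_closed by fastforce

lemma sub_add: "sub X \<Longrightarrow> x \<in> X \<Longrightarrow> y \<in> X \<Longrightarrow> x \<oplus>\<^sub>M y \<in> X"
  using submoduleE(5) by blast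

lemma sub_minus: "sub X \<Longrightarrow> x \<in> X \<Longrightarrow> y \<in> X \<Longrightarrow> x \<ominus>\<^bsub>M\<^esub> y \<in> X"
  by (simp add: a_minus_def submoduleE(3,5))

lemma sub_smult: "sub X \<Longrightarrow> a \<in> carrier R \<Longrightarrow> x \<in> X \<Longrightarrow> a \<odot>\<^sub>M x \<in> X"
  using submoduleE(4) by blast

lemma sub_carrierM: "sub (carrier M)"
  by (rule carrier_is_submodule)

lemma sub_zeroM: "sub {\<zero>\<^sub>M}"
  by (rule submoduleI) auto

lemma sub_inter: "sub X \<Longrightarrow> sub Y \<Longrightarrow> sub (X \<inter> Y)"
  by (rule submoduleI) (auto simp: sub_carrier sub_zero sub_add submoduleE(3) sub_smult)

lemma sub_Inter: "(\<And>X. X \<in> \<X> \<Longrightarrow> sub X) \<Longrightarrow> \<X> \<noteq> {} \<Longrightarrow> sub (\<Inter>\<X>)"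
  by (rule submoduleI) (auto simp: sub_zero sub_add submoduleE(3) sub_smult dest: sub_carrier)

lemma sub_colon:
  assumes X: "sub X" and a: "a \<in> carrier R" shows "sub (colon M X a)"
proof (rule submoduleI)
  fix x assume "x \<in> colon M X a"
  then show "\<ominus>\<^bsub>M\<^esub> x \<in> colon M X a"
    using a by (auto simp: colon_def smult_r_minus submoduleE(3)[OF X])
next
  fix b x assume b: "b \<in> carrier R" and "x \<in> colon M X a"
  then have x: "x \<in> carrier M" "a \<odot>\<^sub>M x \<in> X" by (auto simp: colon_def)
  have "a \<odot>\<^sub>M (b \<odot>\<^sub>M x) = b \<odot>\<^sub>M (a \<odot>\<^sub>M x)"
    using a b x by (metis R.m_comm smult_assoc1)
  then show "b \<odot>\<^sub>M x \<in> colon M X a"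
    using x b sub_smult[OF X b] by (auto simp: colon_def)
qed (use a sub_zero[OF X] sub_add[OF X] in \<open>auto simp: colon_def smult_r_distr\<close>)

lemma add_minus_cancel: "x \<in> carrier M \<Longrightarrow> y \<in> carrier M \<Longrightarrow> x \<oplus>\<^sub>M y \<ominus>\<^bsub>M\<^esub> x = y"
  by (simp add: a_minus_def M.a_comm[of x y] M.a_assoc M.r_neg)

lemma add_minus_cancel2: "x \<in> carrier M \<Longrightarrow> y \<in> carrier M \<Longrightarrow> x \<oplus>\<^sub>M y \<ominus>\<^bsub>M\<^esub> y = x"
  by (simp add: a_minus_def M.a_assoc M.r_neg)

lemma minus_add_cancel: "x \<in> carrier M \<Longrightarrow> y \<in> carrier M \<Longrightarrow> x \<ominus>\<^bsub>M\<^esub> y \<oplus>\<^sub>M y = x"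
  by (simp add: a_minus_def M.a_assoc M.l_neg)

lemma smult_minus: "a \<in> carrier R \<Longrightarrow> x \<in> carrier M \<Longrightarrow> y \<in> carrier M \<Longrightarrow>
    a \<odot>\<^sub>M (x \<ominus>\<^bsub>M\<^esub> y) = a \<odot>\<^sub>M x \<ominus>\<^bsub>M\<^esub> a \<odot>\<^sub>M y"
  by (simp add: a_minus_def smult_r_distr smult_r_minus)

lemma mem_sum: "z \<in> X <+>\<^sub>M Y \<longleftrightarrow> (\<exists>x\<in>X. \<exists>y\<in>Y. z = x \<oplus>\<^sub>M y)"
  by (auto simp: set_add_def')

lemma sub_sum:
  assumes X: "sub X" and Y: "sub Y" shows "sub (X <+>\<^sub>M Y)"
proof (rule submoduleI)
  show "X <+>\<^sub>M Y \<subseteq> carrier M"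
    using X Y by (auto simp: mem_sum sub_carrier)
  show "\<zero>\<^sub>M \<in> X <+>\<^sub>M Y"
    using sub_zero[OF X] sub_zero[OF Y] by (force simp: mem_sum)
next
  fix z assume "z \<in> X <+>\<^sub>M Y"
  then obtain x y where "x \<in> X" "y \<in> Y" "z = x \<oplus>\<^sub>M y" by (auto simp: mem_sum)
  then show "\<ominus>\<^bsub>M\<^esub> z \<in> X <+>\<^sub>M Y"
    unfolding mem_sum using X Y
    by (metis M.minus_add sub_carrier submoduleE(3))
next
  fix z w assume "z \<in> X <+>\<^sub>M Y" "w \<in> X <+>\<^sub>M Y"
  then obtain x y x' y' where *: "x \<in> X" "y \<in> Y" "z = x \<oplus>\<^sub>M y" "x' \<in> X" "y' \<in> Y" "w = x' \<oplus>\<^sub>M y'"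
    by (auto simp: mem_sum)
  then have "z \<oplus>\<^sub>M w = (x \<oplus>\<^sub>M x') \<oplus>\<^sub>M (y \<oplus>\<^sub>M y')"
    using sub_carrier[OF X] sub_carrier[OF Y] by (simp add: M.a_ac)
  then show "z \<oplus>\<^sub>M w \<in> X <+>\<^sub>M Y"
    unfolding mem_sum using * sub_add[OF X] sub_add[OF Y] by metis
next
  fix a z assume a: "a \<in> carrier R" and "z \<in> X <+>\<^sub>M Y"
  then obtain x y where "x \<in> X" "y \<in> Y" "z = x \<oplus>\<^sub>M y" by (auto simp: mem_sum)
  then show "a \<odot>\<^sub>M z \<in> X <+>\<^sub>M Y"
    unfolding mem_sum using X Y a smult_r_distr sub_carrier sub_smult by metis
qed

lemma sum_upper1: "sub X \<Longrightarrow> sub Y \<Longrightarrow> X \<subseteq> X <+>\<^sub>M Y"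
  using sub_zero[of Y] by (force simp: mem_sum sub_carrier)

lemma sum_upper2: "sub X \<Longrightarrow> sub Y \<Longrightarrow> Y \<subseteq> X <+>\<^sub>M Y"
  using sub_zero[of X] by (force simp: mem_sum sub_carrier)

lemma sum_least: "sub Z \<Longrightarrow> X \<subseteq> Z \<Longrightarrow> Y \<subseteq> Z \<Longrightarrow> X <+>\<^sub>M Y \<subseteq> Z"
  by (auto simp: mem_sum sub_add subset_iff)

lemma sum_mono: "X \<subseteq> X' \<Longrightarrow> Y \<subseteq> Y' \<Longrightarrow> X <+>\<^sub>M Y \<subseteq> X' <+>\<^sub>M Y'"
  by (auto simp: mem_sum subset_iff)

lemma sum_absorb1: "sub X \<Longrightarrow> sub Y \<Longrightarrow> Y \<subseteq> X \<Longrightarrow> X <+>\<^sub>M Y = X"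
  by (intro equalityI sum_least sum_upper1) auto

lemma sum_absorb2: "sub X \<Longrightarrow> sub Y \<Longrightarrow> X \<subseteq> Y \<Longrightarrow> X <+>\<^sub>M Y = Y"
  by (intro equalityI sum_least sum_upper2) auto

lemma sum_commute: "sub X \<Longrightarrow> sub Y \<Longrightarrow> X <+>\<^sub>M Y = Y <+>\<^sub>M X"
  by (intro equalityI sum_least sub_sum sum_upper1 sum_upper2)

lemma sum_assoc:
  assumes X: "sub X" and Y: "sub Y" and Z: "sub Z"
  shows "(X <+>\<^sub>M Y) <+>\<^sub>M Z = X <+>\<^sub>M (Y <+>\<^sub>M Z)"
proof
  note XY = sub_sum[OF X Y] and YZ = sub_sum[OF Y Z]
  note L = sub_sum[OF XY Z] and R = sub_sum[OF X YZ]
  show "(X <+>\<^sub>M Y) <+>\<^sub>M Z \<subseteq> X <+>\<^sub>M (Y <+>\<^sub>M Z)"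
    using sum_upper1[OF X YZ] sum_upper2[OF X YZ] sum_upper1[OF Y Z] sum_upper2[OF Y Z]
    by (intro sum_least[OF R]) auto
  show "X <+>\<^sub>M (Y <+>\<^sub>M Z) \<subseteq> (X <+>\<^sub>M Y) <+>\<^sub>M Z"
    using sum_upper1[OF XY Z] sum_upper2[OF XY Z] sum_upper1[OF X Y] sum_upper2[OF X Y]
    by (intro sum_least[OF L]) auto
qed

lemma sub_span: "S \<subseteq> carrier M \<Longrightarrow> sub (submodule_span R M S)"
  unfolding submodule_span_def by (rule sub_Inter) (use sub_carrierM in auto)

lemma span_upper: "S \<subseteq> submodule_span R M S"
  unfolding submodule_span_def by auto

lemma span_least: "sub N \<Longrightarrow> S \<subseteq> N \<Longrightarrow> submodule_span R M S \<subseteq> N"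
  unfolding submodule_span_def by auto

lemma sub_mult: "B \<subseteq> carrier R \<Longrightarrow> X \<subseteq> carrier M \<Longrightarrow> sub (B \<star> X)"
  unfolding ideal_mult_def by (rule sub_span) auto

lemma mult_upper: "b \<in> B \<Longrightarrow> x \<in> X \<Longrightarrow> b \<odot>\<^sub>M x \<in> B \<star> X"
  unfolding ideal_mult_def by (rule subsetD[OF span_upper]) auto

lemma mult_least:
  "sub N \<Longrightarrow> (\<And>b x. b \<in> B \<Longrightarrow> x \<in> X \<Longrightarrow> b \<odot>\<^sub>M x \<in> N) \<Longrightarrow> B \<star> X \<subseteq> N"
  unfolding ideal_mult_def by (rule span_least) auto

lemma mult_mono: "B \<subseteq> B' \<Longrightarrow> X \<subseteq> X' \<Longrightarrow> B' \<subseteq> carrier R \<Longrightarrow> X' \<subseteq> carrier M \<Longrightarrow>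
   B \<star> X \<subseteq> B' \<star> X'"
  by (intro mult_least sub_mult mult_upper) auto

lemma mult_subset: "sub X \<Longrightarrow> B \<subseteq> carrier R \<Longrightarrow> B \<star> X \<subseteq> X"
  by (intro mult_least) (auto simp: sub_smult)

lemma scalar_ideal:
  assumes W: "sub W" and x: "x \<in> carrier M"
  shows "ideal {a \<in> carrier R. a \<odot>\<^sub>M x \<in> W} R"
proof (rule idealI)
  show "subgroup {a \<in> carrier R. a \<odot>\<^sub>M x \<in> W} (add_monoid R)"
    by (unfold_locales)
       (use x in \<open>auto simp: smult_l_distr sub_add[OF W] sub_zero[OF W] smult_l_minus submoduleE(3)[OF W] simp flip: a_inv_def\<close>)
  fix a y assume "a \<in> {a \<in> carrier R. a \<odot>\<^sub>M x \<in> W}" and y: "y \<in> carrier R"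
  then have a: "a \<in> carrier R" "a \<odot>\<^sub>M x \<in> W" by auto
  then show "y \<otimes> a \<in> {a \<in> carrier R. a \<odot>\<^sub>M x \<in> W}" using y x sub_smult[OF W y] by (simp add: smult_assoc1)
  then show "a \<otimes> y \<in> {a \<in> carrier R. a \<odot>\<^sub>M x \<in> W}" using a y by (simp add: R.m_comm)
qed (rule R.ring_axioms)

text \<open>
  Stated for multiples by an ideal \<open>I\<close>, because both \<open>R x\<close> and \<open>q x\<close> are needed below.
\<close>

lemma sub_cyclic:
  assumes I: "ideal I R" and x: "x \<in> carrier M" shows "sub ((\<lambda>a. a \<odot>\<^sub>M x) ` I)"
proof (rule submoduleI)
  interpret I: ideal I R by (rule I)
  show "(\<lambda>a. a \<odot>\<^sub>M x) ` I \<subseteq> carrier M" using x by auto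
  show "\<zero>\<^sub>M \<in> (\<lambda>a. a \<odot>\<^sub>M x) ` I" using x by (intro image_eqI[of _ _ \<zero>]) auto
  fix y assume "y \<in> (\<lambda>a. a \<odot>\<^sub>M x) ` I"
  then obtain a where a: "a \<in> I" "y = a \<odot>\<^sub>M x" by blast
  then have aR: "a \<in> carrier R" by simp
  then show "\<ominus>\<^bsub>M\<^esub> y \<in> (\<lambda>a. a \<odot>\<^sub>M x) ` I"
    using x a by (intro image_eqI[of _ _ "\<ominus> a"]) (simp_all add: smult_l_minus)
  show "c \<odot>\<^sub>M y \<in> (\<lambda>a. a \<odot>\<^sub>M x) ` I" if "c \<in> carrier R" for c
    using that x a aR by (intro image_eqI[of _ _ "c \<otimes> a"]) (simp_all add: smult_assoc1 I.I_l_closed)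
  fix z assume "z \<in> (\<lambda>a. a \<odot>\<^sub>M x) ` I"
  then obtain c where c: "c \<in> I" "z = c \<odot>\<^sub>M x" by blast
  then have "c \<in> carrier R" by simp
  then show "y \<oplus>\<^sub>M z \<in> (\<lambda>a. a \<odot>\<^sub>M x) ` I"
    using x a aR c by (intro image_eqI[of _ _ "a \<oplus> c"]) (simp_all add: smult_l_distr)
qed

text \<open>
  The product by an ideal only depends on a set of generators. Hence powers of an ideal can be
  handled through finite sets of ring elements, the monomials in the generators.
\<close>

lemma mult_Idl:
  assumes B: "B \<subseteq> carrier R" and X: "sub X"
  shows "(Idl B) \<star> X = B \<star> X"
proof
  have XM: "X \<subseteq> carrier M" using submoduleE(1)[OF X] .
  let ?N = "B \<star> X"
  have N: "sub ?N" using B XM by (rule sub_mult)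
  show "(Idl B) \<star> X \<subseteq> ?N"
  proof (rule mult_least[OF N])
    fix b x assume b: "b \<in> Idl B" and x: "x \<in> X"
    have "B \<subseteq> {b \<in> carrier R. b \<odot>\<^sub>M x \<in> ?N}" using B x mult_upper by blast
    then show "b \<odot>\<^sub>M x \<in> ?N"
      using R.genideal_minimal[OF scalar_ideal[OF N sub_carrier[OF X x]]] b by blast
  qed
  show "?N \<subseteq> (Idl B) \<star> X"
    using R.genideal_self[OF B] R.genideal_ideal[OF B] XM
    by (intro mult_mono) (auto dest: ideal.Icarr)
qed

lemma mult_carrier: "carrier R \<star> carrier M = carrier M"
proof
  show "carrier M \<subseteq> carrier R \<star> carrier M"
    using mult_upper[OF R.one_closed] smult_one by force
qed (rule mult_subset[OF sub_carrierM order_refl])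

lemma sub_scal:
  assumes a: "a \<in> carrier R" and X: "sub X" shows "sub ((\<lambda>x. a \<odot>\<^sub>M x) ` X)"
proof (rule submoduleI)
  show "(\<lambda>x. a \<odot>\<^sub>M x) ` X \<subseteq> carrier M" using a sub_carrier[OF X] by auto
  show "\<zero>\<^sub>M \<in> (\<lambda>x. a \<odot>\<^sub>M x) ` X" using a sub_zero[OF X] by (metis image_eqI smult_r_null)
next
  fix y assume "y \<in> (\<lambda>x. a \<odot>\<^sub>M x) ` X"
  then obtain x where x: "x \<in> X" "y = a \<odot>\<^sub>M x" by auto
  then have "\<ominus>\<^bsub>M\<^esub> y = a \<odot>\<^sub>M (\<ominus>\<^bsub>M\<^esub> x)" using a smult_r_minus sub_carrier[OF X] by simp
  then show "\<ominus>\<^bsub>M\<^esub> y \<in> (\<lambda>x. a \<odot>\<^sub>M x) ` X" using x submoduleE(3)[OF X] by auto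
next
  fix y z assume "y \<in> (\<lambda>x. a \<odot>\<^sub>M x) ` X" "z \<in> (\<lambda>x. a \<odot>\<^sub>M x) ` X"
  then obtain x x' where x: "x \<in> X" "y = a \<odot>\<^sub>M x" "x' \<in> X" "z = a \<odot>\<^sub>M x'" by auto
  then have "y \<oplus>\<^sub>M z = a \<odot>\<^sub>M (x \<oplus>\<^sub>M x')" using a smult_r_distr sub_carrier[OF X] by simp
  then show "y \<oplus>\<^sub>M z \<in> (\<lambda>x. a \<odot>\<^sub>M x) ` X" using x sub_add[OF X] by auto
next
  fix b y assume b: "b \<in> carrier R" and "y \<in> (\<lambda>x. a \<odot>\<^sub>M x) ` X"
  then obtain x where x: "x \<in> X" "y = a \<odot>\<^sub>M x" by auto
  then have "b \<odot>\<^sub>M y = a \<odot>\<^sub>M (b \<odot>\<^sub>M x)"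
    using a b sub_carrier[OF X] by (metis R.m_comm smult_assoc1)
  then show "b \<odot>\<^sub>M y \<in> (\<lambda>x. a \<odot>\<^sub>M x) ` X" using x b sub_smult[OF X] by auto
qed

lemma mult_insert:
  assumes b: "b \<in> carrier R" and B: "B \<subseteq> carrier R" and X: "sub X"
  shows "(insert b B) \<star> X = (\<lambda>x. b \<odot>\<^sub>M x) ` X <+>\<^sub>M B \<star> X"
    (is "?L = ?S <+>\<^sub>M ?N")
proof
  have XM: "X \<subseteq> carrier M" using submoduleE(1)[OF X] .
  have S: "sub ?S" and N: "sub ?N" and L: "sub ?L"
    using b X sub_scal B XM sub_mult by auto
  show "?L \<subseteq> ?S <+>\<^sub>M ?N"
    using subsetD[OF sum_upper1[OF S N]] subsetD[OF sum_upper2[OF S N]]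
    by (intro mult_least sub_sum S N) (auto simp: mult_upper)
  show "?S <+>\<^sub>M ?N \<subseteq> ?L"
    using b B XM by (intro sum_least L mult_mono) (auto simp: mult_upper)
qed

lemma mult_empty: "{} \<star> X = {\<zero>\<^sub>M}"
proof
  show "{} \<star> X \<subseteq> {\<zero>\<^sub>M}" by (intro mult_least sub_zeroM) auto
  show "{\<zero>\<^sub>M} \<subseteq> {} \<star> X"
    using sub_zero[OF sub_span[of "{}"]] by (auto simp: ideal_mult_def)
qed

section \<open>Length of a quotient of two submodules\<close>

text \<open>
  Lengths of quotients \<open>N / L\<close> are measured by chains of submodules between \<open>L\<close> and \<open>N\<close>; no quotient
  module is formed. The inductive definition makes induction along a chain available.
\<close>

inductive strict_chain :: "nat \<Rightarrow> 'c set \<Rightarrow> 'c set \<Rightarrow> bool" where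
  chain_0: "sub L \<Longrightarrow> sub N \<Longrightarrow> L \<subseteq> N \<Longrightarrow> strict_chain 0 N L"
| chain_Suc: "strict_chain n K L \<Longrightarrow> sub N \<Longrightarrow> K \<subset> N \<Longrightarrow> strict_chain (Suc n) N L"

definition qlen :: "'c set \<Rightarrow> 'c set \<Rightarrow> enat" where
  "qlen N L = Sup {enat n | n. strict_chain n N L}"

lemma strict_chain_sub: "strict_chain n N L \<Longrightarrow> sub N \<and> sub L \<and> L \<subseteq> N"
  by (induction rule: strict_chain.induct) auto

lemma strict_chain_mono: "strict_chain n N L \<Longrightarrow> sub N' \<Longrightarrow> N \<subseteq> N' \<Longrightarrow> strict_chain n N' L"
proof (induction rule: strict_chain.induct)
  case (chain_Suc n K L N)
  then show ?case by (blast intro: strict_chain.chain_Suc)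
qed (blast intro: strict_chain.chain_0)

lemma strict_chain_down: "strict_chain (Suc n) N L \<Longrightarrow> strict_chain n N L"
  by (erule strict_chain.cases) (auto intro: strict_chain_mono)

lemma strict_chain_le: "strict_chain n N L \<Longrightarrow> m \<le> n \<Longrightarrow> strict_chain m N L"
  by (induction n) (auto simp: le_Suc_eq dest: strict_chain_down)

lemma strict_chain_append:
  "strict_chain n N K \<Longrightarrow> strict_chain m K L \<Longrightarrow> strict_chain (n + m) N L"
proof (induction rule: strict_chain.induct)
  case (chain_0 K N)
  then show ?case by (auto intro: strict_chain_mono)
qed (auto intro: strict_chain.intros)

lemma enat_le_Sup_iff:
  fixes P :: "nat \<Rightarrow> bool"
  assumes "\<And>m n. P n \<Longrightarrow> m \<le> n \<Longrightarrow> P m" "P 0"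
  shows "enat n \<le> Sup {enat n | n. P n} \<longleftrightarrow> P n"
proof
  assume *: "enat n \<le> Sup {enat n | n. P n}"
  show "P n"
  proof (rule ccontr)
    assume n: "\<not> P n"
    have "Sup {enat n | n. P n} \<le> enat (n - 1)"
    proof (rule Sup_least, safe)
      fix k assume "P k"
      then have "k < n" using n assms(1) not_less by blast
      then show "enat k \<le> enat (n - 1)" by simp
    qed
    with * have "n \<le> n - 1" by (meson dual_order.trans enat_ord_simps(1))
    then show False using n assms(2) by (cases n) auto
  qed
qed (auto intro: Sup_upper)

lemma le_qlen_iff:
  assumes "sub N" "sub L" "L \<subseteq> N"
  shows "enat n \<le> qlen N L \<longleftrightarrow> strict_chain n N L"
  unfolding qlen_def
  by (rule enat_le_Sup_iff) (use assms in \<open>auto intro: strict_chain_le chain_0\<close>)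

lemma qlen_leI: "(\<And>n. strict_chain n N L \<Longrightarrow> enat n \<le> c) \<Longrightarrow> qlen N L \<le> c"
  unfolding qlen_def by (rule Sup_least) auto

lemma enat_le_below: "x \<le> (y::enat)" if "\<And>n. enat n \<le> x \<Longrightarrow> enat n \<le> y"
proof (cases y)
  case (enat k)
  then have "\<not> enat (Suc k) \<le> x" using that[of "Suc k"] by auto
  then have "x < enat (Suc k)" by simp
  then show ?thesis using enat by (cases x) auto
qed auto

lemma enat_add_le_below:
  fixes x y z :: enat
  assumes "\<And>p q. enat p \<le> x \<Longrightarrow> enat q \<le> y \<Longrightarrow> enat (p + q) \<le> z"
  shows "x + y \<le> z"
proof (rule enat_le_below)
  fix n assume n: "enat n \<le> x + y"
  show "enat n \<le> z"
  proof (cases x)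
    case (enat p)
    show ?thesis
    proof (cases y)
      case (enat q)
      then show ?thesis using \<open>x = enat p\<close> assms[of p q] n
        by (simp, meson enat_ord_simps(1) order_trans)
    qed (use assms[of 0 n] enat zero_enat_def in auto)
  qed (use assms[of n 0] zero_enat_def in \<open>auto simp flip: zero_enat_def\<close>)
qed

text \<open>
  Each strict step of a chain remains strict after adding \<open>K\<close> or after intersecting with \<open>K\<close>: by the
  modular law, nested submodules with the same sum and the same intersection with \<open>K\<close> are equal.
\<close>

lemma chain_split:
  assumes "strict_chain n N L" "sub K" "L \<subseteq> K"
  shows "\<exists>p q. n \<le> p + q \<and> strict_chain p (N <+>\<^sub>M K) K \<and> strict_chain q (N \<inter> K) L"
  using assms
proof (induction rule: strict_chain.induct)
  case (chain_0 L N)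
  then show ?case
    by (intro exI[of _ 0] conjI strict_chain.chain_0 sub_sum sub_inter sum_upper2) auto
next
  case (chain_Suc n N L N')
  from chain_Suc.IH[OF chain_Suc.prems] obtain p q where
    pq: "n \<le> p + q" "strict_chain p (N <+>\<^sub>M K) K" "strict_chain q (N \<inter> K) L"
    by blast
  have N: "sub N" using chain_Suc.hyps(1) strict_chain_sub by blast
  have s: "sub (N' <+>\<^sub>M K)" "sub (N' \<inter> K)"
    using chain_Suc by (auto intro: sub_sum sub_inter)
  have m: "N <+>\<^sub>M K \<subseteq> N' <+>\<^sub>M K" "N \<inter> K \<subseteq> N' \<inter> K"
    using chain_Suc.hyps(3) by (intro sum_mono, auto)
  have "N <+>\<^sub>M K \<noteq> N' <+>\<^sub>M K \<or> N \<inter> K \<noteq> N' \<inter> K"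
  proof (rule ccontr)
    assume *: "\<not> ?thesis"
    have "N' \<subseteq> N"
    proof
      fix x assume x: "x \<in> N'"
      then have "x \<in> N <+>\<^sub>M K" using * sum_upper1[of N' K] chain_Suc by auto
      then obtain y k where yk: "y \<in> N" "k \<in> K" "x = y \<oplus>\<^sub>M k" by (auto simp: mem_sum)
      have c: "y \<in> carrier M" "k \<in> carrier M" using yk N chain_Suc.prems sub_carrier by auto
      have "x \<ominus>\<^bsub>M\<^esub> y \<in> N'" using x yk chain_Suc.hyps sub_minus by blast
      moreover have "x \<ominus>\<^bsub>M\<^esub> y = k" using yk c by (simp add: add_minus_cancel)
      ultimately have "k \<in> N" using * yk by auto
      then show "x \<in> N" using yk sub_add N by auto
    qed
    then show False using chain_Suc by auto
  qed
  then consider "N <+>\<^sub>M K \<subset> N' <+>\<^sub>M K" | "N \<inter> K \<subset> N' \<inter> K" using m by blast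
  then show ?case
  proof cases
    case 1
    then have "strict_chain (Suc p) (N' <+>\<^sub>M K) K" "strict_chain q (N' \<inter> K) L"
      using pq s m by (auto intro: strict_chain.chain_Suc strict_chain_mono)
    then show ?thesis using pq by (intro exI[of _ "Suc p"] exI[of _ q]) auto
  next
    case 2
    then have "strict_chain p (N' <+>\<^sub>M K) K" "strict_chain (Suc q) (N' \<inter> K) L"
      using pq s m by (auto intro: strict_chain.chain_Suc strict_chain_mono)
    then show ?thesis using pq by (intro exI[of _ p] exI[of _ "Suc q"]) auto
  qed
qed

text \<open>
  Additivity of length: one inequality splits a chain along \<open>K\<close>, the other concatenates two chains.
\<close>

lemma qlen_add:
  assumes N: "sub N" and K: "sub K" and L: "sub L" and LK: "L \<subseteq> K" and KN: "K \<subseteq> N"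
  shows "qlen N L = qlen N K + qlen K L"
proof (rule antisym)
  show "qlen N L \<le> qlen N K + qlen K L"
  proof (rule qlen_leI)
    fix n assume "strict_chain n N L"
    from chain_split[OF this K LK] obtain p q where
      pq: "n \<le> p + q" "strict_chain p (N <+>\<^sub>M K) K" "strict_chain q (N \<inter> K) L" by auto
    have "N <+>\<^sub>M K = N" "N \<inter> K = K" using assms by (auto simp: sum_absorb1)
    then have "enat p \<le> qlen N K" "enat q \<le> qlen K L" using pq assms by (auto simp: le_qlen_iff)
    then have "enat p + enat q \<le> qlen N K + qlen K L" by (rule add_mono)
    then show "enat n \<le> qlen N K + qlen K L" using pq(1)
      by (metis enat_ord_simps(1) order_trans plus_enat_simps(1))
  qed
  show "qlen N K + qlen K L \<le> qlen N L"
    by (rule enat_add_le_below)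
       (use assms in \<open>auto simp: le_qlen_iff intro: strict_chain_append\<close>)
qed

text \<open>
  Pushes chains forward along a strictly monotone map between intervals of submodules. The maps in
  question are images and preimages under multiplication by a scalar.
\<close>

lemma qlen_transfer:
  assumes phi: "\<And>C. sub C \<Longrightarrow> L \<subseteq> C \<Longrightarrow> C \<subseteq> N \<Longrightarrow> sub (\<phi> C) \<and> L' \<subseteq> \<phi> C \<and> \<phi> C \<subseteq> N'"
    and strict: "\<And>C D. sub C \<Longrightarrow> sub D \<Longrightarrow> L \<subseteq> C \<Longrightarrow> C \<subset> D \<Longrightarrow> D \<subseteq> N \<Longrightarrow> \<phi> C \<subset> \<phi> D"
    and L': "sub L'" "sub N'" "L' \<subseteq> N'"
  shows "qlen N L \<le> qlen N' L'"
proof (rule qlen_leI)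
  fix n assume *: "strict_chain n N L"
  have "C \<subseteq> N \<Longrightarrow> strict_chain k (\<phi> C) L'" if "strict_chain k C L" for k C
    using that phi strict
  proof (induction k C L rule: strict_chain.induct)
    case (chain_0 L C)
    then have "sub (\<phi> C)" "L' \<subseteq> \<phi> C" using chain_0.prems(2)[of C] by auto
    then show ?case using L' by (intro strict_chain.chain_0)
  next
    case (chain_Suc k C L D)
    have C: "sub C" "L \<subseteq> C" using strict_chain_sub chain_Suc.hyps(1) by auto
    have "strict_chain k (\<phi> C) L'"
    proof (rule chain_Suc.IH)
      show "C \<subseteq> N" using chain_Suc.hyps(3) chain_Suc.prems(1) by auto
    qed (fact chain_Suc.prems)+
    moreover have "sub (\<phi> D)" using chain_Suc.prems(2)[of D] chain_Suc C by auto
    moreover have "\<phi> C \<subset> \<phi> D" using chain_Suc C by (intro chain_Suc.prems(3)) auto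
    ultimately show ?case by (rule strict_chain.chain_Suc)
  qed
  then have "strict_chain n (\<phi> N) L'" using * by auto
  moreover have "\<phi> N \<subseteq> N'" using phi[of N] strict_chain_sub[OF *] by auto
  ultimately show "enat n \<le> qlen N' L'"
    using L' by (auto simp: le_qlen_iff intro: strict_chain_mono)
qed

lemma qlen_self [simp]: "qlen N N = 0"
proof -
  have "n = 0" if "strict_chain n N N" for n
  proof (rule ccontr)
    assume "n \<noteq> 0"
    with that show False
      by (cases rule: strict_chain.cases) (use strict_chain_sub in blast)+
  qed
  then have "qlen N N \<le> 0" by (intro qlen_leI) (auto simp: zero_enat_def)
  then show ?thesis by simp
qed

lemma qlen_eq_0_iff:
  assumes "sub N" "sub L" "L \<subseteq> N" shows "qlen N L = 0 \<longleftrightarrow> N = L"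
proof
  assume *: "qlen N L = 0"
  show "N = L"
  proof (rule ccontr)
    assume "N \<noteq> L"
    then have "strict_chain (Suc 0) N L" using assms
      by (intro chain_Suc[of 0 L L] chain_0) auto
    then have "enat (Suc 0) \<le> qlen N L" using assms by (simp add: le_qlen_iff)
    then show False using * by (simp add: zero_enat_def)
  qed
qed auto

lemma qlen_antimono:
  assumes "sub N" "sub L" "sub L'" "L \<subseteq> L'" "L' \<subseteq> N" shows "qlen N L' \<le> qlen N L"
  using qlen_add[of N L' L] assms by simp

lemma qlen_mono:
  assumes "sub N" "sub N'" "sub L" "N \<subseteq> N'" "L \<subseteq> N" shows "qlen N L \<le> qlen N' L"
  using qlen_add[of N' N L] assms by simp

lemma sub_inter_colon: "sub X \<Longrightarrow> sub Z \<Longrightarrow> a \<in> carrier R \<Longrightarrow> sub (X \<inter> colon M Z a)"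
  by (intro sub_inter sub_colon)

text \<open>Multiplication by \<open>a\<close> induces an isomorphism from \<open>X / (X \<inter> (Z : a))\<close> onto \<open>(a X + Z) / Z\<close>.\<close>

lemma qlen_scal:
  assumes X: "sub X" and Z: "sub Z" and a: "a \<in> carrier R"
  shows "qlen ((\<lambda>x. a \<odot>\<^sub>M x) ` X <+>\<^sub>M Z) Z = qlen X (X \<inter> colon M Z a)"
proof (rule antisym)
  let ?S = "\<lambda>X. (\<lambda>x. a \<odot>\<^sub>M x) ` X"
  note sX = sub_scal[OF a X]
  have sS: "sub (?S D <+>\<^sub>M Z)" if "sub D" for D using that sub_scal[OF a that] sub_sum Z by auto
  show "qlen (?S X <+>\<^sub>M Z) Z \<le> qlen X (X \<inter> colon M Z a)"
  proof (rule qlen_transfer[where \<phi> = "\<lambda>C. X \<inter> colon M C a"])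
    fix C D assume C: "sub C" and D: "sub D" and "Z \<subseteq> C" "C \<subset> D" "D \<subseteq> ?S X <+>\<^sub>M Z"
    then obtain d where d0: "d \<in> D" "d \<notin> C" "d \<in> ?S X <+>\<^sub>M Z" by blast
    then obtain x z where "x \<in> X" "z \<in> Z" "d = a \<odot>\<^sub>M x \<oplus>\<^sub>M z"
      unfolding mem_sum image_iff by blast
    with d0 have d: "d \<in> D" "d \<notin> C" "x \<in> X" "z \<in> Z" "d = a \<odot>\<^sub>M x \<oplus>\<^sub>M z" by auto
    have c: "x \<in> carrier M" "z \<in> carrier M" using d X Z sub_carrier by auto
    have "a \<odot>\<^sub>M x = d \<ominus>\<^bsub>M\<^esub> z" using d c a by (simp add: add_minus_cancel2)
    then have "a \<odot>\<^sub>M x \<in> D" using d \<open>Z \<subseteq> C\<close> \<open>C \<subset> D\<close> sub_minus[OF D] by (metis psubsetD subsetD)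
    moreover have "a \<odot>\<^sub>M x \<notin> C" using d \<open>Z \<subseteq> C\<close> sub_add[OF C] by auto
    ultimately show "X \<inter> colon M C a \<subset> X \<inter> colon M D a"
      using \<open>C \<subset> D\<close> d c by (auto simp: colon_def)
  next
    fix C assume "sub C" "Z \<subseteq> C"
    then show "sub (X \<inter> colon M C a) \<and> X \<inter> colon M Z a \<subseteq> X \<inter> colon M C a \<and> X \<inter> colon M C a \<subseteq> X"
      using sub_inter_colon[OF X _ a] by (auto simp: colon_def)
  qed (use X sub_inter_colon[OF X Z a] in auto)
  show "qlen X (X \<inter> colon M Z a) \<le> qlen (?S X <+>\<^sub>M Z) Z"
  proof (rule qlen_transfer[where \<phi> = "\<lambda>D. ?S D <+>\<^sub>M Z"])
    fix C D assume C: "sub C" and D: "sub D" and zC: "X \<inter> colon M Z a \<subseteq> C" and CD: "C \<subset> D" "D \<subseteq> X"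
    then obtain d where d: "d \<in> D" "d \<notin> C" by auto
    have dM: "d \<in> carrier M" using d D sub_carrier by auto
    have "a \<odot>\<^sub>M d \<in> ?S D <+>\<^sub>M Z" using sum_upper1[OF sub_scal[OF a D] Z] d by auto
    moreover have "a \<odot>\<^sub>M d \<notin> ?S C <+>\<^sub>M Z"
    proof
      assume "a \<odot>\<^sub>M d \<in> ?S C <+>\<^sub>M Z"
      then obtain c z where c: "c \<in> C" "z \<in> Z" "a \<odot>\<^sub>M d = a \<odot>\<^sub>M c \<oplus>\<^sub>M z" by (auto simp: mem_sum)
      have cM: "c \<in> carrier M" "z \<in> carrier M" using c C Z sub_carrier by auto
      have "a \<odot>\<^sub>M (d \<ominus>\<^bsub>M\<^esub> c) = z"
        using a dM cM c(3) by (simp add: smult_minus add_minus_cancel)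
      moreover have "d \<ominus>\<^bsub>M\<^esub> c \<in> X" using d c CD X sub_minus by blast
      ultimately have "d \<ominus>\<^bsub>M\<^esub> c \<in> C" using zC c(2) X by (auto simp: colon_def sub_carrier)
      then have "(d \<ominus>\<^bsub>M\<^esub> c) \<oplus>\<^sub>M c \<in> C" using c C sub_add by blast
      then show False using d dM cM by (simp add: minus_add_cancel)
    qed
    moreover have "?S C <+>\<^sub>M Z \<subseteq> ?S D <+>\<^sub>M Z" using CD by (intro sum_mono image_mono) auto
    ultimately show "?S C <+>\<^sub>M Z \<subset> ?S D <+>\<^sub>M Z" by auto
  next
    fix C assume "sub C" "C \<subseteq> X"
    then show "sub (?S C <+>\<^sub>M Z) \<and> Z \<subseteq> ?S C <+>\<^sub>M Z \<and> ?S C <+>\<^sub>M Z \<subseteq> ?S X <+>\<^sub>M Z"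
      using sS sum_upper2[OF sub_scal[OF a] Z] sum_mono[of "?S C" "?S X" Z Z] by auto
  qed (use sX Z sub_sum sum_upper2 in auto)
qed

lemma scal_one: "sub X \<Longrightarrow> (\<lambda>x. \<one> \<odot>\<^sub>M x) ` X = X"
  by (force simp: sub_carrier)

lemma qlen_diamond:
  assumes "sub X" "sub Z" shows "qlen (X <+>\<^sub>M Z) Z = qlen X (X \<inter> Z)"
proof -
  have "X \<inter> colon M Z \<one> = X \<inter> Z" using assms(1) by (auto simp: colon_def sub_carrier)
  then show ?thesis using qlen_scal[OF assms R.one_closed] scal_one[OF assms(1)] by simp
qed

lemma qlen_scal_le:
  assumes X: "sub X" and Y: "sub Y" "Y \<subseteq> X" and Z: "sub Z" and a: "a \<in> carrier R"
    and aY: "\<And>y. y \<in> Y \<Longrightarrow> a \<odot>\<^sub>M y \<in> Z"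
  shows "qlen ((\<lambda>x. a \<odot>\<^sub>M x) ` X <+>\<^sub>M Z) Z \<le> qlen X Y"
  unfolding qlen_scal[OF X Z a]
  using assms sub_carrier[OF Y(1)] by (intro qlen_antimono sub_inter_colon) (auto simp: colon_def)

lemma qlen_sum_le:
  assumes X: "sub X" and Y: "sub Y" "Y \<subseteq> X" and Z: "sub Z"
  shows "qlen (X <+>\<^sub>M Z) (Y <+>\<^sub>M Z) \<le> qlen X Y"
proof -
  have YZ: "sub (Y <+>\<^sub>M Z)" using Y Z sub_sum by auto
  have "X <+>\<^sub>M Z = X <+>\<^sub>M (Y <+>\<^sub>M Z)"
  proof
    show "X <+>\<^sub>M Z \<subseteq> X <+>\<^sub>M (Y <+>\<^sub>M Z)" using sum_upper2[OF Y(1) Z] by (intro sum_mono) auto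
    show "X <+>\<^sub>M (Y <+>\<^sub>M Z) \<subseteq> X <+>\<^sub>M Z"
      using Y Z X sum_upper1[OF X Z] by (intro sum_least sub_sum sum_mono) auto
  qed
  then have "qlen (X <+>\<^sub>M Z) (Y <+>\<^sub>M Z) = qlen X (X \<inter> (Y <+>\<^sub>M Z))"
    using qlen_diamond[OF X YZ] by simp
  also have "\<dots> \<le> qlen X Y"
    using X Y YZ sum_upper1[OF Y(1) Z] by (intro qlen_antimono sub_inter) auto
  finally show ?thesis .
qed

text \<open>
  \<open>B X / B Y\<close> is a quotient of a direct sum of copies of \<open>X / Y\<close>, one for each element of \<open>B\<close>.
\<close>

lemma qlen_mult_le:
  assumes "finite B" "B \<subseteq> carrier R" and X: "sub X" and Y: "sub Y" "Y \<subseteq> X"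
  shows "qlen (B \<star> X) (B \<star> Y) \<le> of_nat (card B) * qlen X Y"
  using assms(1,2)
proof (induction B rule: finite_induct)
  case empty
  then show ?case by (simp add: mult_empty)
next
  case (insert b B)
  let ?S = "\<lambda>X. (\<lambda>x. b \<odot>\<^sub>M x) ` X" and ?N = "ideal_mult R M B"
  have b: "b \<in> carrier R" and B: "B \<subseteq> carrier R" using insert by auto
  have s: "sub (?S X)" "sub (?S Y)" "sub (?N X)" "sub (?N Y)"
    using b B X Y sub_scal sub_mult submoduleE(1) by auto
  have NXY: "?N Y \<subseteq> ?N X" using B X Y by (intro mult_mono submoduleE(1)) auto
  let ?U = "?S Y <+>\<^sub>M ?N X"
  have U: "sub ?U" using s sub_sum by auto
  have "qlen ((insert b B) \<star> X) ((insert b B) \<star> Y)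
      = qlen (?S X <+>\<^sub>M ?N X) ?U + qlen ?U (?S Y <+>\<^sub>M ?N Y)"
    unfolding mult_insert[OF b B X] mult_insert[OF b B Y(1)]
    using s NXY Y(2) by (intro qlen_add sub_sum sum_mono image_mono) auto
  also have "qlen (?S X <+>\<^sub>M ?N X) ?U = qlen (?S X <+>\<^sub>M ?U) ?U"
  proof -
    have "?S X <+>\<^sub>M ?U = ?S X <+>\<^sub>M ?N X"
    proof
      show "?S X <+>\<^sub>M ?U \<subseteq> ?S X <+>\<^sub>M ?N X"
        using s Y(2) by (intro sum_least sub_sum sum_upper1 sum_mono image_mono) auto
      show "?S X <+>\<^sub>M ?N X \<subseteq> ?S X <+>\<^sub>M ?U"
        using s by (intro sum_mono sum_upper2) auto
    qed
    then show ?thesis by simp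
  qed
  also have "\<dots> \<le> qlen X Y"
    using X Y b U sum_upper1[OF s(2,3)] by (intro qlen_scal_le) auto
  also have "qlen ?U (?S Y <+>\<^sub>M ?N Y) \<le> qlen (?N X) (?N Y)"
  proof -
    show ?thesis
      unfolding sum_commute[OF s(2,3)] sum_commute[OF s(2,4)]
      using s NXY by (intro qlen_sum_le) auto
  qed
  also have "qlen (?N X) (?N Y) \<le> of_nat (card B) * qlen X Y" using insert by auto
  finally show ?case using insert(1,2) by (simp add: distrib_right add_left_mono)
qed

section \<open>Quotient modules\<close>

lemma coset_self: "sub N \<Longrightarrow> x \<in> carrier M \<Longrightarrow> x \<in> N +>\<^sub>M x"
  unfolding a_r_coset_def' using sub_zero[of N] by (auto intro!: bexI[of _ "\<zero>\<^sub>M"])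

lemma mem_coset_iff:
  assumes N: "sub N" and x: "x \<in> carrier M"
  shows "y \<in> N +>\<^sub>M x \<longleftrightarrow> y \<in> carrier M \<and> y \<ominus>\<^bsub>M\<^esub> x \<in> N"
proof
  assume "y \<in> N +>\<^sub>M x"
  then obtain h where "h \<in> N" "y = h \<oplus>\<^sub>M x" by (auto simp: a_r_coset_def')
  then show "y \<in> carrier M \<and> y \<ominus>\<^bsub>M\<^esub> x \<in> N" using x N sub_carrier by (auto simp: add_minus_cancel2)
next
  assume "y \<in> carrier M \<and> y \<ominus>\<^bsub>M\<^esub> x \<in> N"
  then show "y \<in> N +>\<^sub>M x" 
    using minus_add_cancel[of y x] x unfolding a_r_coset_def' by (intro UN_I[of "y \<ominus>\<^bsub>M\<^esub> x"]) auto
qed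

lemma coset_eqI:
  assumes N: "sub N" and x: "x \<in> carrier M" and y: "y \<in> N +>\<^sub>M x"
  shows "N +>\<^sub>M y = N +>\<^sub>M x"
proof -
  have "subgroup N (add_monoid M)" using N submodule.axioms(1) by blast
  then show ?thesis using group.repr_independence[OF M.a_group, of y N x] x y
    by (simp add: a_r_coset_def)
qed

lemma coset_eq_iff:
  assumes N: "sub N" and x: "x \<in> carrier M" and y: "y \<in> carrier M"
  shows "N +>\<^sub>M y = N +>\<^sub>M x \<longleftrightarrow> y \<ominus>\<^bsub>M\<^esub> x \<in> N"
  using coset_eqI[OF N x, of y] coset_self[OF N y] mem_coset_iff[OF N x, of y] y by auto

lemma coset_mem_image_iff:
  assumes N: "sub N" and K: "sub K" "N \<subseteq> K" and x: "x \<in> carrier M"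
  shows "N +>\<^sub>M x \<in> (\<lambda>x. N +>\<^sub>M x) ` K \<longleftrightarrow> x \<in> K"
proof
  assume "N +>\<^sub>M x \<in> (\<lambda>x. N +>\<^sub>M x) ` K"
  then obtain y where y: "y \<in> K" "N +>\<^sub>M x = N +>\<^sub>M y" by auto
  then have yM: "y \<in> carrier M" using K sub_carrier by auto
  then have "x \<ominus>\<^bsub>M\<^esub> y \<in> K" using y coset_eq_iff[OF N yM x] K by auto
  then have "x \<ominus>\<^bsub>M\<^esub> y \<oplus>\<^sub>M y \<in> K" using y sub_add[OF K(1)] by blast
  then show "x \<in> K" using x yM by (simp add: minus_add_cancel)
qed (rule imageI)

lemma coset_zero: "sub N \<Longrightarrow> x \<in> N \<Longrightarrow> N +>\<^sub>M x = N"
proof -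
  assume N: "sub N" and x: "x \<in> N"
  have NM: "N \<subseteq> carrier M" using submoduleE(1)[OF N] .
  then have z: "N +>\<^sub>M \<zero>\<^sub>M = N"
    using group.coset_mult_one[OF M.a_group, of N] by (simp add: a_r_coset_def)
  then have "x \<in> N +>\<^sub>M \<zero>\<^sub>M" using x by (simp only:)
  from coset_eqI[OF N M.zero_closed this] z show ?thesis by (rule trans)
qed

lemma coset_add:
  assumes N: "sub N" and x: "x \<in> carrier M" and y: "y \<in> carrier M"
  shows "(N +>\<^sub>M x) <+>\<^sub>M (N +>\<^sub>M y) = N +>\<^sub>M (x \<oplus>\<^sub>M y)"
proof -
  have "abelian_subgroup N M"
    using N submodule.axioms(1)
    by (intro abelian_subgroupI3 M.abelian_group_axioms) (auto simp: additive_subgroup_def)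
  from abelian_subgroup.a_rcos_sum[OF this x y] show ?thesis .
qed

lemma coset_smult:
  assumes N: "sub N" and x: "x \<in> carrier M" and a: "a \<in> carrier R"
  shows "(\<Union>y\<in>N +>\<^sub>M x. N +>\<^sub>M (a \<odot>\<^sub>M y)) = N +>\<^sub>M (a \<odot>\<^sub>M x)"
proof -
  have "N +>\<^sub>M (a \<odot>\<^sub>M y) = N +>\<^sub>M (a \<odot>\<^sub>M x)" if y: "y \<in> N +>\<^sub>M x" for y
  proof -
    have *: "y \<in> carrier M" "y \<ominus>\<^bsub>M\<^esub> x \<in> N" using y N x by (auto simp: mem_coset_iff)
    then have "a \<odot>\<^sub>M y \<ominus>\<^bsub>M\<^esub> a \<odot>\<^sub>M x \<in> N" using sub_smult[OF N a *(2)] a x by (simp add: smult_minus)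
    then show ?thesis using coset_eq_iff[OF N] a x * by auto
  qed
  then have "(\<Union>y\<in>N +>\<^sub>M x. N +>\<^sub>M (a \<odot>\<^sub>M y)) = (\<Union>y\<in>N +>\<^sub>M x. N +>\<^sub>M (a \<odot>\<^sub>M x))"
    by (intro SUP_cong refl)
  also have "\<dots> = N +>\<^sub>M (a \<odot>\<^sub>M x)" using coset_self[OF N x] by blast
  finally show ?thesis .
qed

lemma quot_module_simps:
  "carrier (quot_module M N) = (\<lambda>x. N +>\<^sub>M x) ` carrier M"
  "zero (quot_module M N) = N" "add (quot_module M N) = set_add M"
  "smult (quot_module M N) = (\<lambda>a Y. \<Union>x\<in>Y. N +>\<^sub>M (a \<odot>\<^sub>M x))"
  by (simp_all add: quot_module_def A_RCOSETS_def' UNION_singleton_eq_range)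

text \<open>
  The next two lemmas are the two halves of the correspondence between submodules of \<open>M / N\<close> and
  submodules of \<open>M\<close> that contain \<open>N\<close>.
\<close>

lemma submodule_quot_preimage:
  assumes N: "sub N" and C: "submodule C R (quot_module M N)"
  shows "sub {x \<in> carrier M. N +>\<^sub>M x \<in> C}" "N \<subseteq> {x \<in> carrier M. N +>\<^sub>M x \<in> C}"
proof -
  have sg: "subgroup C (add_monoid (quot_module M N))" using C submodule.axioms(1) by blast
  have NC: "N \<in> C" using subgroup.one_closed[OF sg] by (simp add: quot_module_simps)
  have smC: "N +>\<^sub>M (a \<odot>\<^sub>M x) \<in> C" if "N +>\<^sub>M x \<in> C" "x \<in> carrier M" "a \<in> carrier R" for a x
    using submodule.smult_closed[OF C that(3,1)] coset_smult[OF N that(2,3)]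
    by (simp add: quot_module_simps)
  show "N \<subseteq> {x \<in> carrier M. N +>\<^sub>M x \<in> C}"
    using NC coset_zero[OF N] N sub_carrier by auto
  then have z: "\<zero>\<^sub>M \<in> {x \<in> carrier M. N +>\<^sub>M x \<in> C}" using sub_zero[OF N] by auto
  show "sub {x \<in> carrier M. N +>\<^sub>M x \<in> C}"
  proof (rule submoduleI)
    fix x assume x: "x \<in> {x \<in> carrier M. N +>\<^sub>M x \<in> C}"
    then have "(\<ominus> \<one>) \<odot>\<^sub>M x = \<ominus>\<^bsub>M\<^esub> x" by (simp add: smult_l_minus)
    then show "\<ominus>\<^bsub>M\<^esub> x \<in> {x \<in> carrier M. N +>\<^sub>M x \<in> C}"
      using x smC[of x "\<ominus> \<one>"] by auto
  next
    fix x y assume "x \<in> {x \<in> carrier M. N +>\<^sub>M x \<in> C}" "y \<in> {x \<in> carrier M. N +>\<^sub>M x \<in> C}"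
    then show "x \<oplus>\<^sub>M y \<in> {x \<in> carrier M. N +>\<^sub>M x \<in> C}"
      using subgroup.m_closed[OF sg, of "N +>\<^sub>M x" "N +>\<^sub>M y"] coset_add[OF N]
      by (auto simp: quot_module_simps)
  next
    show "\<zero>\<^sub>M \<in> {x \<in> carrier M. N +>\<^sub>M x \<in> C}" by (rule z)
    fix a x assume "a \<in> carrier R" "x \<in> {x \<in> carrier M. N +>\<^sub>M x \<in> C}"
    then show "a \<odot>\<^sub>M x \<in> {x \<in> carrier M. N +>\<^sub>M x \<in> C}" using smC by simp
  qed blast
qed

lemma submodule_quot_image:
  assumes N: "sub N" and K: "sub K"
  shows "submodule ((\<lambda>x. N +>\<^sub>M x) ` K) R (quot_module M N)"
proof -
  have KM: "K \<subseteq> carrier M" using submoduleE(1)[OF K] .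
  have Nz: "N +>\<^sub>M \<zero>\<^sub>M = N" using coset_zero[OF N sub_zero[OF N]] by simp
  let ?G = "add_monoid (quot_module M N)"
  have cG: "\<exists>x\<in>carrier M. X = N +>\<^sub>M x" if "X \<in> carrier ?G" for X
    using that by (simp add: quot_module_simps image_iff)
  have G: "comm_group ?G"
  proof (rule comm_groupI)
    show "\<one>\<^bsub>?G\<^esub> \<in> carrier ?G"
      using imageI[OF M.zero_closed, of "\<lambda>x. N +>\<^sub>M x"] Nz by (simp add: quot_module_simps)
  next
    fix X assume "X \<in> carrier ?G"
    then obtain x where x: "x \<in> carrier M" "X = N +>\<^sub>M x" using cG by blast
    then show "\<one>\<^bsub>?G\<^esub> \<otimes>\<^bsub>?G\<^esub> X = X"
      using coset_add[OF N M.zero_closed x(1)] Nz by (simp add: quot_module_simps)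
    show "\<exists>Y\<in>carrier ?G. Y \<otimes>\<^bsub>?G\<^esub> X = \<one>\<^bsub>?G\<^esub>"
      using x coset_add[OF N, of "\<ominus>\<^bsub>M\<^esub> x" x] Nz
      by (intro bexI[of _ "N +>\<^sub>M (\<ominus>\<^bsub>M\<^esub> x)"]) (auto simp: quot_module_simps M.l_neg)
  next
    fix X Y assume X: "X \<in> carrier ?G" and Y: "Y \<in> carrier ?G"
    obtain x where x: "x \<in> carrier M" "X = N +>\<^sub>M x" using cG[OF X] by blast
    moreover obtain y where y: "y \<in> carrier M" "Y = N +>\<^sub>M y" using cG[OF Y] by blast
    ultimately have XY: "X \<otimes>\<^bsub>?G\<^esub> Y = N +>\<^sub>M (x \<oplus>\<^sub>M y)" "Y \<otimes>\<^bsub>?G\<^esub> X = N +>\<^sub>M (y \<oplus>\<^sub>M x)"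
      by (simp_all add: quot_module_simps coset_add[OF N])
    show "X \<otimes>\<^bsub>?G\<^esub> Y = Y \<otimes>\<^bsub>?G\<^esub> X" 
      unfolding XY by (rule arg_cong[OF M.a_comm[OF x(1) y(1)]])
    show "X \<otimes>\<^bsub>?G\<^esub> Y \<in> carrier ?G" unfolding XY using x y by (simp add: quot_module_simps)
    fix Z assume "Z \<in> carrier ?G"
    then obtain z where "z \<in> carrier M" "Z = N +>\<^sub>M z" using cG by blast
    with x y XY show "X \<otimes>\<^bsub>?G\<^esub> Y \<otimes>\<^bsub>?G\<^esub> Z = X \<otimes>\<^bsub>?G\<^esub> (Y \<otimes>\<^bsub>?G\<^esub> Z)"
      by (simp add: quot_module_simps coset_add[OF N] M.a_assoc)
  qed
  interpret G: comm_group ?G by (rule G)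
  show ?thesis
  proof (intro submodule.intro subgroup.intro submodule_axioms.intro)
    fix X assume "X \<in> (\<lambda>x. N +>\<^sub>M x) ` K"
    then obtain x where x: "x \<in> K" "x \<in> carrier M" "X = N +>\<^sub>M x" using KM by auto
    have "inv\<^bsub>?G\<^esub> X = N +>\<^sub>M (\<ominus>\<^bsub>M\<^esub> x)"
      using x coset_add[OF N, of "\<ominus>\<^bsub>M\<^esub> x" x] Nz
      by (intro G.inv_equality) (auto simp: quot_module_simps M.l_neg)
    then show "inv\<^bsub>?G\<^esub> X \<in> (\<lambda>x. N +>\<^sub>M x) ` K" using submoduleE(3)[OF K x(1)] by simp
  next
    fix a X assume a: "a \<in> carrier R" and "X \<in> (\<lambda>x. N +>\<^sub>M x) ` K"
    then obtain x where x: "x \<in> K" "x \<in> carrier M" "X = N +>\<^sub>M x" using KM by auto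
    then show "a \<odot>\<^bsub>quot_module M N\<^esub> X \<in> (\<lambda>x. N +>\<^sub>M x) ` K"
      using coset_smult[OF N x(2) a] sub_smult[OF K a] by (simp add: quot_module_simps)
  next
    fix X Y assume "X \<in> (\<lambda>x. N +>\<^sub>M x) ` K" "Y \<in> (\<lambda>x. N +>\<^sub>M x) ` K"
    then obtain x y where x: "x \<in> K" "X = N +>\<^sub>M x" "y \<in> K" "Y = N +>\<^sub>M y"
      by (elim imageE)
    then have "x \<in> carrier M" "y \<in> carrier M" using KM by auto
    with x show "X \<otimes>\<^bsub>?G\<^esub> Y \<in> (\<lambda>x. N +>\<^sub>M x) ` K"
      using coset_add[OF N] sub_add[OF K] by (simp add: quot_module_simps)
  next
    show "\<one>\<^bsub>?G\<^esub> \<in> (\<lambda>x. N +>\<^sub>M x) ` K"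
      using imageI[OF sub_zero[OF K], of "\<lambda>x. N +>\<^sub>M x"] Nz by (simp add: quot_module_simps)
  next
    show "(\<lambda>x. N +>\<^sub>M x) ` K \<subseteq> carrier ?G" using KM by (simp add: quot_module_simps image_mono)
  qed
qed

lemma strict_chain_imp_family:
  "strict_chain n N L \<Longrightarrow>
   \<exists>D. (\<forall>i\<le>n. sub (D i) \<and> L \<subseteq> D i \<and> D i \<subseteq> N) \<and> (\<forall>i<n. D i \<subset> D (Suc i))"
proof (induction rule: strict_chain.induct)
  case (chain_0 L N)
  then show ?case by (intro exI[of _ "\<lambda>_. N"]) auto
next
  case (chain_Suc n K L N)
  then obtain D where D: "\<forall>i\<le>n. sub (D i) \<and> L \<subseteq> D i \<and> D i \<subseteq> K" "\<forall>i<n. D i \<subset> D (Suc i)" by blast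
  have "L \<subseteq> N" "\<forall>i\<le>n. D i \<subseteq> N" using chain_Suc(2,3) D strict_chain_sub[OF chain_Suc(1)] by blast+
  show ?case
    by (rule exI[of _ "D(Suc n := N)"])
       (use D chain_Suc.hyps(2,3) \<open>L \<subseteq> N\<close> \<open>\<forall>i\<le>n. D i \<subseteq> N\<close> in \<open>auto simp: le_Suc_eq less_Suc_eq\<close>)
qed

lemma module_length_quot:
  assumes L: "sub L"
  shows "module_length R (quot_module M L) = qlen (carrier M) L"
proof -
  let ?Q = "quot_module M L"
  have "(\<exists>C. (\<forall>i\<le>n. submodule (C i) R ?Q) \<and> (\<forall>i<n. C i \<subset> C (Suc i))) \<longleftrightarrow> strict_chain n (carrier M) L"
    (is "?A \<longleftrightarrow> ?B") for n :: nat
  proof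
    assume ?A
    then obtain C where C: "\<And>i. i \<le> n \<Longrightarrow> submodule (C i) R ?Q" "\<And>i. i < n \<Longrightarrow> C i \<subset> C (Suc i)" by blast
    let ?P = "\<lambda>C. {x \<in> carrier M. L +>\<^sub>M x \<in> C}"
    have "i \<le> n \<Longrightarrow> strict_chain i (?P (C i)) L" for i
    proof (induction i)
      case 0
      then show ?case using submodule_quot_preimage[OF L C(1)[of 0]] by (intro strict_chain.chain_0 L) auto
    next
      case (Suc i)
      have "C (Suc i) \<subseteq> carrier ?Q"
        using submodule.axioms(1)[OF C(1)[OF Suc.prems]] subgroup.subset by fastforce
      moreover have "C i \<subset> C (Suc i)" using C(2) Suc.prems by auto
      ultimately obtain x where "x \<in> carrier M" "L +>\<^sub>M x \<in> C (Suc i)" "L +>\<^sub>M x \<notin> C i"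
        by (auto simp: quot_module_simps)
      then have "?P (C i) \<subset> ?P (C (Suc i))" using \<open>C i \<subset> C (Suc i)\<close> by auto
      then show ?case
        using Suc submodule_quot_preimage[OF L C(1)[OF Suc.prems]] by (intro strict_chain.chain_Suc) auto
    qed
    from this[of n] show ?B by (rule strict_chain_mono) (auto simp: sub_carrierM)
  next
    assume ?B
    from strict_chain_imp_family[OF this] obtain D where
      D: "\<And>i. i \<le> n \<Longrightarrow> sub (D i)" "\<And>i. i \<le> n \<Longrightarrow> L \<subseteq> D i" "\<And>i. i < n \<Longrightarrow> D i \<subset> D (Suc i)" by blast
    show ?A
    proof (intro exI[of _ "\<lambda>i. (\<lambda>x. L +>\<^sub>M x) ` D i"] conjI allI impI)
      fix i assume i: "i < n"
      then obtain x where x: "x \<in> D (Suc i)" "x \<notin> D i" using D(3) by blast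
      then have "L +>\<^sub>M x \<notin> (\<lambda>x. L +>\<^sub>M x) ` D i"
        using coset_mem_image_iff[OF L D(1)[of i] D(2)[of i], of x] i sub_carrier[OF D(1)[of "Suc i"]] by auto
      then show "(\<lambda>x. L +>\<^sub>M x) ` D i \<subset> (\<lambda>x. L +>\<^sub>M x) ` D (Suc i)" using x D(3)[OF i] by blast
    next
      fix i assume "i \<le> n"
      then show "submodule ((\<lambda>x. L +>\<^sub>M x) ` D i) R ?Q" by (intro submodule_quot_image L D)
    qed
  qed
  then show ?thesis unfolding module_length_def qlen_def by simp
qed

lemma submodule_restrict_iff:
  assumes N: "sub N"
  shows "submodule X R (M\<lparr>carrier := N\<rparr>) \<longleftrightarrow> sub X \<and> X \<subseteq> N"
proof -
  have mN: "module R (M\<lparr>carrier := N\<rparr>)"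
    using submodule.submodule_is_module[OF N] module_axioms by blast
  interpret N: module R "M\<lparr>carrier := N\<rparr>" by (rule mN)
  have inv: "a_inv (M\<lparr>carrier := N\<rparr>) x = \<ominus>\<^bsub>M\<^esub> x" if "x \<in> N" for x
  proof -
    have "a_inv (M\<lparr>carrier := N\<rparr>) x \<in> N" "a_inv (M\<lparr>carrier := N\<rparr>) x \<oplus>\<^sub>M x = \<zero>\<^sub>M"
      using N.a_inv_closed[of x] N.l_neg[of x] that by simp_all
    then show ?thesis
      using M.minus_equality[of "a_inv (M\<lparr>carrier := N\<rparr>) x" x] sub_carrier[OF N] that by simp
  qed
  show ?thesis
  proof
    assume X: "submodule X R (M\<lparr>carrier := N\<rparr>)"
    have "X \<subseteq> N" using N.submoduleE(1)[OF X] by simp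
    moreover have "sub X"
    proof (rule submoduleI)
      show "X \<subseteq> carrier M" using \<open>X \<subseteq> N\<close> submoduleE(1)[OF N] by blast
      show "\<zero>\<^sub>M \<in> X" using N.sub_zero[OF X] by simp
      show "\<ominus>\<^bsub>M\<^esub> x \<in> X" if "x \<in> X" for x
        using N.submoduleE(3)[OF X that] inv[of x] that \<open>X \<subseteq> N\<close> by auto
      show "x \<oplus>\<^sub>M y \<in> X" if "x \<in> X" "y \<in> X" for x y
        using N.sub_add[OF X that] by simp
      show "a \<odot>\<^sub>M x \<in> X" if "a \<in> carrier R" "x \<in> X" for a x
        using N.sub_smult[OF X that] by simp
    qed
    ultimately show "sub X \<and> X \<subseteq> N" by simp
  next
    assume X: "sub X \<and> X \<subseteq> N"
    then have sX: "sub X" and XN: "X \<subseteq> N" by auto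
    show "submodule X R (M\<lparr>carrier := N\<rparr>)"
    proof (rule N.submoduleI)
      show "a_inv (M\<lparr>carrier := N\<rparr>) x \<in> X" if "x \<in> X" for x
        using submoduleE(3)[OF sX that] inv[of x] that XN by auto
    qed (use XN sub_zero[OF sX] sub_add[OF sX] sub_smult[OF sX] in simp_all)
  qed
qed

lemma length_quot_eq_qlen:
  assumes N: "sub N" and L: "sub L" and LN: "L \<subseteq> N"
  shows "length_quot R M N L = qlen N L"
proof -
  have mN: "module R (M\<lparr>carrier := N\<rparr>)"
    using submodule.submodule_is_module[OF N] module_axioms by blast
  interpret N: module R "M\<lparr>carrier := N\<rparr>" by (rule mN)
  note iff = submodule_restrict_iff[OF N]
  have "N.strict_chain n K L \<longleftrightarrow> strict_chain n K L" if "K \<subseteq> N" for n K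
  proof
    show "N.strict_chain n K L \<Longrightarrow> strict_chain n K L"
      by (induction rule: N.strict_chain.induct) (auto simp: iff intro: strict_chain.intros)
    have "strict_chain n K L \<Longrightarrow> K \<subseteq> N \<Longrightarrow> N.strict_chain n K L"
    proof (induction rule: strict_chain.induct)
      case (chain_0 L K)
      then show ?case by (intro N.strict_chain.chain_0) (auto simp: iff)
    next
      case (chain_Suc n K L K')
      then have "K \<subseteq> N" by blast
      then show ?case using chain_Suc by (intro N.strict_chain.chain_Suc) (auto simp: iff)
    qed
    with that show "strict_chain n K L \<Longrightarrow> N.strict_chain n K L" by blast
  qed
  then have "N.qlen N L = qlen N L" by (simp add: N.qlen_def qlen_def)
  moreover have "N.sub L" using L LN by (simp add: iff)
  ultimately show ?thesis
    unfolding length_quot_def using N.module_length_quot[of L] by simp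
qed

lemma quot_filtration_mem_iff:
  assumes "sub N" "sub (F n)" "x \<in> carrier M"
  shows "N +>\<^sub>M x \<in> quot_filtration M F N n \<longleftrightarrow> x \<in> F n <+>\<^sub>M N"
  unfolding quot_filtration_def
  by (rule coset_mem_image_iff[OF assms(1) sub_sum[OF assms(2,1)] sum_upper2[OF assms(2,1)] assms(3)])

text \<open>
  Pulls the definition back from \<open>M / N\<close> to \<open>M\<close>, so that sums with \<open>N\<close> replace cosets from here on.
\<close>

lemma superficial_quot_iff:
  assumes N: "sub N" and F: "\<And>n. sub (F n)" and q: "q \<subseteq> carrier R"
  shows "superficial (quot_module M N) q (quot_filtration M F N) a \<longleftrightarrow>
    a \<in> q \<and> (\<exists>c. \<forall>n\<ge>c. colon M (F (Suc n) <+>\<^sub>M N) a \<inter> (F c <+>\<^sub>M N) = F n <+>\<^sub>M N)"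
proof -
  let ?Q = "quot_module M N" and ?F = "quot_filtration M F N"
  have "colon ?Q (?F (Suc n)) a \<inter> ?F c = ?F n \<longleftrightarrow>
      colon M (F (Suc n) <+>\<^sub>M N) a \<inter> (F c <+>\<^sub>M N) = F n <+>\<^sub>M N" (is "?A \<longleftrightarrow> ?B")
    if a: "a \<in> carrier R" for n c
  proof -
    have FQ: "?F k \<subseteq> carrier ?Q" for k
      unfolding quot_filtration_def quot_module_simps
      by (intro image_mono submoduleE(1) sub_sum F N)
    have "?A \<longleftrightarrow> (\<forall>x\<in>carrier M. N +>\<^sub>M x \<in> colon ?Q (?F (Suc n)) a \<inter> ?F c \<longleftrightarrow> N +>\<^sub>M x \<in> ?F n)"
    proof (rule iffI)
      assume *: "\<forall>x\<in>carrier M. N +>\<^sub>M x \<in> colon ?Q (?F (Suc n)) a \<inter> ?F c \<longleftrightarrow> N +>\<^sub>M x \<in> ?F n"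
      show ?A
      proof (rule Set.set_eqI)
        fix X
        show "X \<in> colon ?Q (?F (Suc n)) a \<inter> ?F c \<longleftrightarrow> X \<in> ?F n"
        proof (cases "X \<in> carrier ?Q")
          case True
          then obtain x where x: "x \<in> carrier M" "X = N +>\<^sub>M x"
            by (auto simp: quot_module_simps)
          show ?thesis using bspec[OF * x(1)] unfolding x(2) .
        next
          case False
          then show ?thesis using FQ by blast
        qed
      qed
    qed blast
    also have "\<dots> \<longleftrightarrow> (\<forall>x\<in>carrier M. x \<in> colon M (F (Suc n) <+>\<^sub>M N) a \<inter> (F c <+>\<^sub>M N) \<longleftrightarrow> x \<in> F n <+>\<^sub>M N)"
    proof (rule ball_cong[OF refl])
      fix x assume x: "x \<in> carrier M"
      have ax: "a \<odot>\<^bsub>?Q\<^esub> (N +>\<^sub>M x) = N +>\<^sub>M (a \<odot>\<^sub>M x)"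
        using coset_smult[OF N x a] by (simp add: quot_module_simps)
      have "N +>\<^sub>M x \<in> carrier ?Q" using x by (simp add: quot_module_simps)
      then show "(N +>\<^sub>M x \<in> colon ?Q (?F (Suc n)) a \<inter> ?F c \<longleftrightarrow> N +>\<^sub>M x \<in> ?F n) \<longleftrightarrow>
         (x \<in> colon M (F (Suc n) <+>\<^sub>M N) a \<inter> (F c <+>\<^sub>M N) \<longleftrightarrow> x \<in> F n <+>\<^sub>M N)"
        using x a unfolding colon_def Int_iff mem_Collect_eq ax
        by (simp only: quot_filtration_mem_iff[OF N F] smult_closed)
    qed
    also have "\<dots> \<longleftrightarrow> ?B"
    proof (rule iffI)
      assume *: "\<forall>x\<in>carrier M. x \<in> colon M (F (Suc n) <+>\<^sub>M N) a \<inter> (F c <+>\<^sub>M N) \<longleftrightarrow> x \<in> F n <+>\<^sub>M N"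
      show ?B
      proof (rule Set.set_eqI)
        fix x
        show "x \<in> colon M (F (Suc n) <+>\<^sub>M N) a \<inter> (F c <+>\<^sub>M N) \<longleftrightarrow> x \<in> F n <+>\<^sub>M N"
          using * sub_carrier[OF sub_sum[OF F N]] by (cases "x \<in> carrier M") auto
      qed
    qed blast
    finally show ?thesis .
  qed
  then show ?thesis unfolding superficial_def using q by blast
qed

lemma nilpotent_quot_iff:
  assumes N: "sub N" and F: "\<And>n. sub (F n)"
  shows "nilpotent_filtration (quot_module M N) (quot_filtration M F N) \<longleftrightarrow>
    (\<exists>n0. \<forall>n\<ge>n0. F n \<subseteq> N)"
proof -
  have "quot_filtration M F N n = {N} \<longleftrightarrow> F n \<subseteq> N" for n
  proof
    assume *: "quot_filtration M F N n = {N}"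
    show "F n \<subseteq> N"
    proof
      fix x assume x: "x \<in> F n"
      then have xM: "x \<in> carrier M" and "x \<in> F n <+>\<^sub>M N"
        using sub_carrier[OF F] sum_upper1[OF F N] by auto
      then have "N +>\<^sub>M x = N" using * by (auto simp: quot_filtration_def)
      then show "x \<in> N" using coset_self[OF N xM] by simp
    qed
  next
    assume "F n \<subseteq> N"
    then have "F n <+>\<^sub>M N = N" by (intro sum_absorb2 F N)
    then show "quot_filtration M F N n = {N}"
      unfolding quot_filtration_def using coset_zero[OF N] sub_zero[OF N] by auto
  qed
  then show ?thesis by (simp add: nilpotent_filtration_def quot_module_simps)
qed

end

section \<open>Power series with a pole of bounded order at one\<close>

context includes fps_syntax
begin

text \<open>
  \<open>F\<close> is a rational function whose only possible pole is at \<open>1\<close>, of order at most \<open>k\<close>.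
\<close>

definition pole_le :: "nat \<Rightarrow> int fps \<Rightarrow> bool" where
  "pole_le k F \<longleftrightarrow> (\<exists>p. fps_of_poly p = F * (1 - fps_X) ^ k)"

lemma pole_leI: "fps_of_poly p = F * (1 - fps_X) ^ k \<Longrightarrow> pole_le k F"
  by (auto simp: pole_le_def)

lemma pole_le_mono: "pole_le k F \<Longrightarrow> k \<le> l \<Longrightarrow> pole_le l F"
proof -
  assume "pole_le k F" and kl: "k \<le> l"
  then obtain p where p: "fps_of_poly p = F * (1 - fps_X) ^ k" by (auto simp: pole_le_def)
  have "fps_of_poly (p * [:1, -1:] ^ (l - k)) = F * (1 - fps_X) ^ l"
    using kl by (simp add: fps_of_poly_mult fps_of_poly_power p mult.assoc fps_of_poly_pCons flip: power_add)
  then show "pole_le l F" by (rule pole_leI)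
qed

lemma pole_le_add: "pole_le k F \<Longrightarrow> pole_le k G \<Longrightarrow> pole_le k (F + G)"
proof -
  assume "pole_le k F" "pole_le k G"
  then obtain p r where "fps_of_poly p = F * (1 - fps_X) ^ k" "fps_of_poly r = G * (1 - fps_X) ^ k"
    by (auto simp: pole_le_def)
  then show ?thesis by (intro pole_leI[of "p + r"]) (simp add: fps_of_poly_add distrib_right)
qed

lemma pole_le_diff: "pole_le k F \<Longrightarrow> pole_le k G \<Longrightarrow> pole_le k (F - G)"
proof -
  assume "pole_le k F" "pole_le k G"
  then obtain p r where "fps_of_poly p = F * (1 - fps_X) ^ k" "fps_of_poly r = G * (1 - fps_X) ^ k"
    by (auto simp: pole_le_def)
  then show ?thesis by (intro pole_leI[of "p - r"]) (simp add: fps_of_poly_diff left_diff_distrib)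
qed

lemma pole_le_X: "pole_le k F \<Longrightarrow> pole_le k (fps_X * F)"
proof -
  assume "pole_le k F"
  then obtain p where "fps_of_poly p = F * (1 - fps_X) ^ k" by (auto simp: pole_le_def)
  then show ?thesis by (intro pole_leI[of "pCons 0 p"]) (simp add: fps_of_poly_pCons mult_ac)
qed

lemma pole_le_const: "pole_le k (fps_const c)"
  by (rule pole_le_mono[of 0]) (auto intro!: pole_leI[of "[:c:]"] simp: fps_of_poly_const)

lemma pole_le_Suc_iff: "pole_le k ((1 - fps_X) * F) \<longleftrightarrow> pole_le (Suc k) F"
  by (simp add: pole_le_def mult_ac)

lemma fps_mult_one_minus_X_nth:
  fixes F :: "'a::comm_ring_1 fps"
  shows "((1 - fps_X) * F) $ n = F $ n - (if n = 0 then 0 else F $ (n - 1))"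
  by (simp add: left_diff_distrib)

lemma pole_le_eventually_const:
  assumes "\<And>n. n0 \<le> n \<Longrightarrow> f n = f n0"
  shows "pole_le 1 (Abs_fps f)"
  using assms
proof (induction n0 arbitrary: f)
  case 0
  have "(1 - fps_X) * Abs_fps f = fps_const (f 0)"
  proof (rule fps_ext)
    fix n show "((1 - fps_X) * Abs_fps f) $ n = fps_const (f 0) $ n"
      using 0[of n] 0[of "n - 1"] by (simp add: fps_mult_one_minus_X_nth)
  qed
  then have "pole_le 0 ((1 - fps_X) * Abs_fps f)" by (simp add: pole_le_const)
  then show ?case by (simp add: pole_le_Suc_iff)
next
  case (Suc n0)
  have "pole_le 1 (Abs_fps (\<lambda>n. f (Suc n)))"
  proof (rule Suc.IH)
    fix n assume "n0 \<le> n"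
    then show "f (Suc n) = f (Suc n0)" using Suc.prems[of "Suc n"] by simp
  qed
  moreover have "Abs_fps f = fps_const (f 0) + fps_X * Abs_fps (\<lambda>n. f (Suc n))"
    by (rule fps_ext) auto
  ultimately show ?case by (simp add: pole_le_add pole_le_const pole_le_X)
qed

text \<open>
  Summation of coefficients raises the order of the pole by one, and an eventually constant
  perturbation \<open>c\<close> has a pole of order at most one, which is absorbed.
\<close>

lemma pole_le_recurrence:
  assumes rec: "\<And>n. f (Suc n) - f n = g (Suc n) - c n"
    and g: "pole_le (Suc k) (Abs_fps g)" and c: "\<And>n. n0 \<le> n \<Longrightarrow> c n = c n0"
  shows "pole_le (Suc (Suc k)) (Abs_fps f)"
proof -
  have "(1 - fps_X) * Abs_fps f = Abs_fps g + (fps_const (f 0 - g 0) - fps_X * Abs_fps c)"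
  proof (rule fps_ext)
    fix n show "((1 - fps_X) * Abs_fps f) $ n = (Abs_fps g + (fps_const (f 0 - g 0) - fps_X * Abs_fps c)) $ n"
      using rec[of "n - 1"] by (cases n) (simp_all add: fps_mult_one_minus_X_nth)
  qed
  moreover have "pole_le (Suc k) (Abs_fps c)"
    by (rule pole_le_mono[OF pole_le_eventually_const[of n0 c, OF c]]) simp_all
  ultimately have "pole_le (Suc k) ((1 - fps_X) * Abs_fps f)"
    using g by (simp add: pole_le_add pole_le_diff pole_le_X pole_le_const)
  then show ?thesis by (simp add: pole_le_Suc_iff)
qed

section \<open>Antitone functions on multi-indices\<close>

definition multi_idx :: "nat \<Rightarrow> nat \<Rightarrow> nat list set" where
  "multi_idx t n = {\<alpha>. length \<alpha> = t \<and> sum_list \<alpha> = n}"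

lemma multi_idx_0: "multi_idx 0 n = (if n = 0 then {[]} else {})"
  by (auto simp: multi_idx_def)

lemma multi_idx_Suc: "multi_idx (Suc t) n = (\<Union>i\<le>n. (#) i ` multi_idx t (n - i))"
proof (intro Set.set_eqI iffI)
  fix \<alpha> assume "\<alpha> \<in> multi_idx (Suc t) n"
  then obtain i \<beta> where "\<alpha> = i # \<beta>" "length \<beta> = t" "i + sum_list \<beta> = n"
    by (auto simp: multi_idx_def length_Suc_conv)
  then show "\<alpha> \<in> (\<Union>i\<le>n. (#) i ` multi_idx t (n - i))"
    by (intro UN_I[of i]) (auto simp: multi_idx_def)
qed (auto simp: multi_idx_def)

lemma finite_multi_idx [simp]: "finite (multi_idx t n)"
  by (induction t arbitrary: n) (simp_all add: multi_idx_0 multi_idx_Suc)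

lemma sum_multi_idx_Suc:
  "(\<Sum>\<alpha>\<in>multi_idx (Suc t) n. f \<alpha>) = (\<Sum>i\<le>n. \<Sum>\<beta>\<in>multi_idx t (n - i). f (i # \<beta>))"
proof -
  have "(\<Sum>\<alpha>\<in>multi_idx (Suc t) n. f \<alpha>) = (\<Sum>i\<le>n. \<Sum>\<alpha>\<in>(#) i ` multi_idx t (n - i). f \<alpha>)"
    unfolding multi_idx_Suc by (rule sum.UNION_disjoint) auto
  also have "\<dots> = (\<Sum>i\<le>n. \<Sum>\<beta>\<in>multi_idx t (n - i). f (i # \<beta>))"
    by (rule sum.cong[OF refl], subst sum.reindex) (auto simp: inj_on_def)
  finally show ?thesis .
qed

definition antitone_idx :: "nat \<Rightarrow> (nat list \<Rightarrow> nat) \<Rightarrow> bool" where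
  "antitone_idx t f \<longleftrightarrow> (\<forall>\<alpha> \<beta>. length \<alpha> = t \<longrightarrow> list_all2 (\<le>) \<alpha> \<beta> \<longrightarrow> f \<beta> \<le> f \<alpha>)"

lemma antitone_idxD: "antitone_idx t f \<Longrightarrow> length \<alpha> = t \<Longrightarrow> list_all2 (\<le>) \<alpha> \<beta> \<Longrightarrow> f \<beta> \<le> f \<alpha>"
  by (auto simp: antitone_idx_def)

lemma list_all2_le_refl: "list_all2 (\<le>) \<alpha> (\<alpha> :: nat list)"
  by (rule list_all2_refl) simp

lemma list_all2_map_min: "list_all2 (\<le>) (map (min b) \<alpha>) (\<alpha> :: nat list)"
  by (simp add: list_all2_conv_all_nth)

lemma antitone_idx_slice: "antitone_idx (Suc t) f \<Longrightarrow> antitone_idx t (\<lambda>\<beta>. f (i # \<beta>))"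
  by (auto simp: antitone_idx_def)

lemma antitone_idx_slice_mono:
  "antitone_idx (Suc t) f \<Longrightarrow> length \<beta> = t \<Longrightarrow> i \<le> j \<Longrightarrow> f (j # \<beta>) \<le> f (i # \<beta>)"
  by (rule antitone_idxD) (auto intro: list_all2_le_refl)

text \<open>
  The slices decrease to a limit \<open>g\<close>, which is antitone in fewer variables and hence determined by its
  values on a finite box. The slices reach \<open>g\<close> on the box after finitely many steps. From then on
  they agree with \<open>g\<close> everywhere, being squeezed between \<open>g\<close> and their own values on the box.
\<close>

lemma slices_stabilise:
  assumes f: "antitone_idx (Suc t) f"
    and bound: "\<And>g. antitone_idx t g \<Longrightarrow> \<exists>b. \<forall>\<beta>. length \<beta> = t \<longrightarrow> g \<beta> = g (map (min b) \<beta>)"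
  shows "\<exists>i0. \<forall>i\<ge>i0. \<forall>\<beta>. length \<beta> = t \<longrightarrow> f (i # \<beta>) = f (i0 # \<beta>)"
proof -
  define g where "g \<beta> = (LEAST m. \<exists>i. m = f (i # \<beta>))" for \<beta>
  have g_le: "g \<beta> \<le> f (i # \<beta>)" for i \<beta> unfolding g_def by (rule Least_le) auto
  have g_ex: "\<exists>i. g \<beta> = f (i # \<beta>)" for \<beta> unfolding g_def by (rule LeastI) auto
  have g_stable: "f (j # \<beta>) = g \<beta>" if "length \<beta> = t" "g \<beta> = f (i # \<beta>)" "i \<le> j" for i j \<beta>
    using antitone_idx_slice_mono[OF f that(1,3)] g_le[of \<beta> j] that(2) by simp
  have "antitone_idx t g"
    unfolding antitone_idx_def
  proof (intro allI impI)
    fix \<alpha> \<beta> :: "nat list" assume *: "length \<alpha> = t" "list_all2 (\<le>) \<alpha> \<beta>"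
    obtain i where i: "g \<alpha> = f (i # \<alpha>)" using g_ex by blast
    have "g \<beta> \<le> f (i # \<beta>)" by (rule g_le)
    also have "\<dots> \<le> f (i # \<alpha>)" by (rule antitone_idxD[OF f]) (use * in auto)
    finally show "g \<beta> \<le> g \<alpha>" using i by simp
  qed
  then obtain b where b: "\<And>\<beta>. length \<beta> = t \<Longrightarrow> g \<beta> = g (map (min b) \<beta>)" using bound by blast
  define B where "B = {\<beta>. set \<beta> \<subseteq> {..b} \<and> length \<beta> = t}"
  have fin: "finite B" unfolding B_def by (rule finite_lists_length_eq) simp
  obtain w where w: "\<And>\<beta>. g \<beta> = f (w \<beta> # \<beta>)" using g_ex by metis
  define i0 where "i0 = Max (insert 0 (w ` B))"
  have w_le: "w \<beta> \<le> i0" if "\<beta> \<in> B" for \<beta> using that fin by (auto simp: i0_def)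
  have "f (i # \<beta>) = g \<beta>" if i: "i0 \<le> i" and len: "length \<beta> = t" for i \<beta>
  proof (rule antisym)
    let ?\<beta> = "map (min b) \<beta>"
    have "?\<beta> \<in> B" using len by (auto simp: B_def)
    then have "f (i # ?\<beta>) = g ?\<beta>"
      using w_le[of ?\<beta>] i len w by (intro g_stable[of ?\<beta> "w ?\<beta>"]) auto
    moreover have "f (i # \<beta>) \<le> f (i # ?\<beta>)"
      by (rule antitone_idxD[OF f]) (use len in \<open>auto simp: list_all2_map_min\<close>)
    ultimately show "f (i # \<beta>) \<le> g \<beta>" using b[OF len] by simp
  qed (rule g_le)
  then show ?thesis by (intro exI[of _ i0]) simp
qed

text \<open>
  A form of Dickson's lemma. It replaces the Noetherian property of a polynomial ring in the proof
  that a Hilbert series is rational.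
\<close>

lemma antitone_idx_bounded:
  "antitone_idx t f \<Longrightarrow> \<exists>b. \<forall>\<beta>. length \<beta> = t \<longrightarrow> f \<beta> = f (map (min b) \<beta>)"
proof (induction t arbitrary: f)
  case 0
  then show ?case by simp
next
  case (Suc t)
  obtain i0 where i0: "\<And>i \<beta>. i0 \<le> i \<Longrightarrow> length \<beta> = t \<Longrightarrow> f (i # \<beta>) = f (i0 # \<beta>)"
    using slices_stabilise[OF Suc.prems Suc.IH] by blast
  have "\<exists>b. \<forall>\<beta>. length \<beta> = t \<longrightarrow> f (i # \<beta>) = f (i # map (min b) \<beta>)" for i
    using Suc.IH[OF antitone_idx_slice[OF Suc.prems]] .
  then obtain b where b: "\<And>i \<beta>. length \<beta> = t \<Longrightarrow> f (i # \<beta>) = f (i # map (min (b i)) \<beta>)" by metis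
  define c where "c = Max (insert i0 (b ` {..i0}))"
  have c: "i0 \<le> c" "b i \<le> c" if "i \<le> i0" for i
    unfolding c_def by (rule Max_ge; use that in auto)+
  note c = c(1)[OF order_refl] c(2)
  have *: "f (i # \<beta>) = f (i # map (min c) \<beta>)" if "i \<le> i0" "length \<beta> = t" for i \<beta>
  proof -
    have "map (min (b i)) (map (min c) \<beta>) = map (min (b i)) \<beta>" using c(2)[OF that(1)] by auto
    then have "f (i # \<beta>) = f (i # map (min (b i)) (map (min c) \<beta>))"
      using b[OF that(2), of i] by (simp only:)
    also have "\<dots> = f (i # map (min c) \<beta>)" by (rule b[symmetric]) (simp add: that)
    finally show ?thesis .
  qed
  show ?case
  proof (intro exI[of _ c] allI impI)
    fix \<alpha> :: "nat list" assume "length \<alpha> = Suc t"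
    then obtain i \<beta> where \<alpha>: "\<alpha> = i # \<beta>" "length \<beta> = t" by (auto simp: length_Suc_conv)
    show "f \<alpha> = f (map (min c) \<alpha>)"
    proof (cases "i \<le> i0")
      case True
      then have "min c i = i" using c(1) by simp
      then show ?thesis using *[OF True \<alpha>(2)] \<alpha>(1) by simp
    next
      case False
      have "f (i # \<beta>) = f (i0 # \<beta>)" by (rule i0) (use False \<alpha>(2) in simp_all)
      also have "\<dots> = f (i0 # map (min c) \<beta>)" by (rule *) (use \<alpha>(2) in simp_all)
      also have "\<dots> = f (min c i # map (min c) \<beta>)"
        by (rule i0[symmetric]) (use False c(1) \<alpha>(2) in simp_all)
      finally show ?thesis using \<alpha> by simp
    qed
  qed
qed

text \<open>
  Splits a sum over \<open>t + 1\<close> exponents by the first one. Only finitely many slices differ from the final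
  one, and the constant tail contributes a single further factor \<open>1 / (1 - z)\<close>.
\<close>

lemma pole_le_diagonal:
  assumes "\<And>i. i0 \<le> i \<Longrightarrow> P i = P i0" and "\<And>i. pole_le k (P i)"
  shows "pole_le (Suc k) (Abs_fps (\<lambda>n. \<Sum>i\<le>n. P i $ (n - i)))"
  using assms
proof (induction i0 arbitrary: P)
  case 0
  have "(1 - fps_X) * Abs_fps (\<lambda>n. \<Sum>i\<le>n. P i $ (n - i)) = P 0"
  proof (rule fps_ext)
    fix n
    have P: "P i $ (n - i) = P 0 $ (n - i)" for i n using 0(1)[of i] by simp
    have s: "(\<Sum>i\<le>n. P i $ (n - i)) = (\<Sum>i\<le>n. P 0 $ i)" for n
    proof -
      have "(\<Sum>i\<le>n. P i $ (n - i)) = (\<Sum>i\<le>n. P 0 $ (n - i))" by (intro sum.cong refl P)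
      also have "\<dots> = (\<Sum>i\<le>n. P 0 $ i)"
        using sum.nat_diff_reindex[of "\<lambda>i. P 0 $ i" "Suc n"] by (simp add: lessThan_Suc_atMost)
      finally show ?thesis .
    qed
    show "((1 - fps_X) * Abs_fps (\<lambda>n. \<Sum>i\<le>n. P i $ (n - i))) $ n = P 0 $ n"
      by (cases n) (simp_all add: fps_mult_one_minus_X_nth s)
  qed
  then have "pole_le k ((1 - fps_X) * Abs_fps (\<lambda>n. \<Sum>i\<le>n. P i $ (n - i)))" using 0(2)[of 0] by simp
  then show ?case by (simp only: pole_le_Suc_iff)
next
  case (Suc i0)
  have "pole_le (Suc k) (Abs_fps (\<lambda>n. \<Sum>i\<le>n. P (Suc i) $ (n - i)))"
  proof (rule Suc.IH)
    fix i assume "i0 \<le> i"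
    then show "P (Suc i) = P (Suc i0)" by (intro Suc.prems(1)) simp
  qed (rule Suc.prems(2))
  moreover have "Abs_fps (\<lambda>n. \<Sum>i\<le>n. P i $ (n - i))
      = P 0 + fps_X * Abs_fps (\<lambda>n. \<Sum>i\<le>n. P (Suc i) $ (n - i))"
  proof (rule fps_ext)
    fix n
    show "Abs_fps (\<lambda>n. \<Sum>i\<le>n. P i $ (n - i)) $ n
      = (P 0 + fps_X * Abs_fps (\<lambda>n. \<Sum>i\<le>n. P (Suc i) $ (n - i))) $ n"
      by (cases n) (simp_all add: sum.atMost_Suc_shift del: sum.atMost_Suc)
  qed
  ultimately show ?case using Suc.prems(2)[of 0] pole_le_mono[of k "P 0" "Suc k"]
    by (simp add: pole_le_add pole_le_X)
qed

lemma pole_le_antitone_idx: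
  "antitone_idx t f \<Longrightarrow> pole_le t (Abs_fps (\<lambda>n. \<Sum>\<alpha>\<in>multi_idx t n. int (f \<alpha>)))"
proof (induction t arbitrary: f)
  case 0
  have "Abs_fps (\<lambda>n. \<Sum>\<alpha>\<in>multi_idx 0 n. int (f \<alpha>)) = fps_const (int (f []))"
    by (rule fps_ext) (simp add: multi_idx_0)
  then show ?case by (simp add: pole_le_const)
next
  case (Suc t)
  define P where "P i = Abs_fps (\<lambda>n. \<Sum>\<beta>\<in>multi_idx t n. int (f (i # \<beta>)))" for i
  obtain i0 where i0: "\<And>i \<beta>. i0 \<le> i \<Longrightarrow> length \<beta> = t \<Longrightarrow> f (i # \<beta>) = f (i0 # \<beta>)"
    using slices_stabilise[OF Suc.prems antitone_idx_bounded] by blast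
  have "P i = P i0" if "i0 \<le> i" for i
  proof -
    have "int (f (i # \<beta>)) = int (f (i0 # \<beta>))" if "\<beta> \<in> multi_idx t n" for \<beta> n
      using that i0[OF \<open>i0 \<le> i\<close>, of \<beta>] by (simp add: multi_idx_def)
    then show ?thesis unfolding P_def by (intro arg_cong[of _ _ Abs_fps] ext sum.cong refl)
  qed
  moreover have "pole_le t (P i)" for i
    unfolding P_def by (rule Suc.IH[OF antitone_idx_slice[OF Suc.prems]])
  ultimately have "pole_le (Suc t) (Abs_fps (\<lambda>n. \<Sum>i\<le>n. P i $ (n - i)))"
    by (rule pole_le_diagonal)
  then show ?case by (simp add: sum_multi_idx_Suc P_def)
qed

section \<open>Polynomial growth\<close>

text \<open>
  \<open>n + 1\<close> in place of \<open>n\<close> lets the bound hold at \<open>n = 0\<close> as well.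
\<close>

definition growth_le :: "nat \<Rightarrow> (nat \<Rightarrow> nat) \<Rightarrow> bool" where
  "growth_le d f \<longleftrightarrow> (\<exists>C. \<forall>n. f n \<le> C * (n + 1) ^ d)"

lemma growth_le_add:
  assumes "growth_le d g" "growth_le d h" "\<And>n. f n \<le> g n + h n" shows "growth_le d f"
proof -
  obtain C D where "\<And>n. g n \<le> C * (n + 1) ^ d" "\<And>n. h n \<le> D * (n + 1) ^ d"
    using assms(1,2) unfolding growth_le_def by blast
  then have "f n \<le> (C + D) * (n + 1) ^ d" for n
    using assms(3)[of n] by (metis add_mono distrib_right order_trans)
  then show ?thesis unfolding growth_le_def by blast
qed

lemma growth_le_sum:
  assumes g: "growth_le d g" and f: "\<And>n. f (Suc n) \<le> f n + g (Suc n)"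
  shows "growth_le (Suc d) f"
proof -
  obtain C where C: "\<And>n. g n \<le> C * (n + 1) ^ d" using g unfolding growth_le_def by blast
  have "f n \<le> f 0 + n * (C * (n + 1) ^ d)" for n
  proof (induction n)
    case (Suc n)
    have "f (Suc n) \<le> f 0 + n * (C * (n + 1) ^ d) + C * (Suc n + 1) ^ d"
      using f[of n] Suc C[of "Suc n"] by linarith
    also have "n * (C * (n + 1) ^ d) \<le> n * (C * (Suc n + 1) ^ d)"
      by (intro mult_le_mono2 power_mono) auto
    finally show ?case by simp
  qed simp
  moreover have "f 0 + n * (C * (n + 1) ^ d) \<le> (f 0 + C) * (n + 1) ^ Suc d" for n
  proof -
    have "n * (C * (n + 1) ^ d) \<le> C * (n + 1) ^ Suc d" by simp
    moreover have "f 0 * 1 \<le> f 0 * (n + 1) ^ Suc d" 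
      by (intro mult_le_mono2 one_le_power) simp
    ultimately show ?thesis by (simp only: distrib_right mult_1_right)
  qed
  ultimately show ?thesis unfolding growth_le_def by (meson order_trans)
qed

text \<open>
  Since \<open>g\<close> is monotone, the increments of \<open>f\<close> between \<open>n\<close> and
  \<open>2 n + 1\<close> are each at least \<open>g n - C\<close>, which bounds \<open>(n + 1) g n\<close> by \<open>f (2 n + 1) + (n + 1) C\<close>.
\<close>

lemma growth_le_difference:
  assumes f: "growth_le (Suc d) f" and g: "mono g" and fg: "\<And>n. f n + g (Suc n) \<le> f (Suc n) + C"
  shows "growth_le d g"
proof -
  obtain K where K: "\<And>n. f n \<le> K * (n + 1) ^ Suc d" using f unfolding growth_le_def by blast
  have *: "f n + j * g n \<le> f (n + j) + j * C" for n j
  proof (induction j)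
    case (Suc j)
    have "g n \<le> g (Suc (n + j))" using g by (auto intro: monoD)
    then show ?case using fg[of "n + j"] Suc by simp
  qed simp
  have "g n \<le> (K * 2 ^ Suc d + C) * (n + 1) ^ d" for n
  proof -
    have "(n + 1) * g n \<le> f (n + (n + 1)) + (n + 1) * C" using *[of n "n + 1"] by linarith
    also have "f (n + (n + 1)) \<le> K * (2 * (n + 1)) ^ Suc d" using K[of "n + (n + 1)"] by (simp add: mult_2)
    also have "\<dots> = (n + 1) * (K * 2 ^ Suc d * (n + 1) ^ d)" by (simp only: power_mult_distrib power_Suc mult_ac)
    finally have "(n + 1) * g n \<le> (n + 1) * (K * 2 ^ Suc d * (n + 1) ^ d + C)" by (simp only: distrib_left)
    then have "g n \<le> K * 2 ^ Suc d * (n + 1) ^ d + C" by (simp only: mult_le_cancel1)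
    also have "C \<le> C * (n + 1) ^ d" by simp
    finally show ?thesis by (simp add: distrib_right)
  qed
  then show ?thesis unfolding growth_le_def by blast
qed

section \<open>Asymptotics of coefficients\<close>

lemma fps_binomial_inverse:
  "Abs_fps (\<lambda>n. of_nat ((n + k) choose k)) * (1 - fps_X) ^ Suc k = (1 :: int fps)"
proof (induction k)
  case 0
  show ?case by (rule fps_ext) (simp add: mult.commute[of _ "1 - fps_X"] fps_mult_one_minus_X_nth)
next
  case (Suc k)
  have "(1 - fps_X) * Abs_fps (\<lambda>n. of_nat ((n + Suc k) choose Suc k)) = (Abs_fps (\<lambda>n. of_nat ((n + k) choose k)) :: int fps)"
  proof (rule fps_ext)
    fix n
    show "((1 - fps_X) * Abs_fps (\<lambda>n. of_nat ((n + Suc k) choose Suc k))) $ n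
      = (Abs_fps (\<lambda>n. of_nat ((n + k) choose k)) :: int fps) $ n"
      by (cases n) (simp_all add: fps_mult_one_minus_X_nth)
  qed
  then have "((1 - fps_X) * Abs_fps (\<lambda>n. of_nat ((n + Suc k) choose Suc k))) * (1 - fps_X) ^ Suc k = (1 :: int fps)"
    using Suc.IH by (simp only:)
  then show ?case by (simp only: power_Suc mult_ac)
qed

lemma binomial_asymp: "(\<lambda>n. real ((n + k) choose k) / real n ^ k) \<longlonglongrightarrow> 1 / fact k"
proof (induction k)
  case (Suc k)
  have "(\<lambda>n. (1 + real (Suc k) / real n) / real (Suc k)) \<longlonglongrightarrow> (1 + 0) / real (Suc k)"
    by (intro tendsto_intros lim_const_over_n) auto
  from tendsto_mult[OF Suc.IH this]
  have "(\<lambda>n. real ((n + k) choose k) / real n ^ k * ((1 + real (Suc k) / real n) / real (Suc k)))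
     \<longlonglongrightarrow> 1 / fact (Suc k)" by (simp add: mult.commute)
  moreover have "\<forall>\<^sub>F n in sequentially.
     real ((n + k) choose k) / real n ^ k * ((1 + real (Suc k) / real n) / real (Suc k))
      = real ((n + Suc k) choose Suc k) / real n ^ Suc k"
  proof (rule eventually_sequentiallyI[of 1])
    fix n :: nat assume n: "1 \<le> n"
    have "Suc k * ((n + Suc k) choose Suc k) = (n + Suc k) * ((n + k) choose k)"
      using Suc_times_binomial_eq[of "n + k" k] by (simp add: mult.commute)
    then have "real (Suc k) * real ((n + Suc k) choose Suc k) = real (n + Suc k) * real ((n + k) choose k)"
      by (metis of_nat_mult)
    then have e: "real ((n + Suc k) choose Suc k) = real (n + Suc k) * real ((n + k) choose k) / real (Suc k)"
      by (simp add: field_simps)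
    show "real ((n + k) choose k) / real n ^ k * ((1 + real (Suc k) / real n) / real (Suc k))
      = real ((n + Suc k) choose Suc k) / real n ^ Suc k"
      unfolding e using n by (simp add: divide_simps)
  qed
  ultimately show ?case by (rule Lim_transform_eventually)
qed simp

text \<open>
  \<open>D\<close> is \<open>g\<close> times the series of the numbers \<open>(n + k) choose k\<close>. By induction over the coefficients of \<open>g\<close>,
  each coefficient contributes with the same weight \<open>1 / k!\<close>, since a shift of \<open>n\<close> does not change the
  leading term.
\<close>

lemma coeff_asymp:
  assumes "fps_of_poly g = D * (1 - fps_X) ^ Suc k"
  shows "(\<lambda>n. real_of_int (D $ n) / real n ^ k) \<longlonglongrightarrow> real_of_int (poly g 1) / fact k"
proof -
  define B :: "int fps" where "B = Abs_fps (\<lambda>n. of_nat ((n + k) choose k))"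
  have B: "B * (1 - fps_X) ^ Suc k = 1" unfolding B_def by (rule fps_binomial_inverse)
  have "D = D * (B * (1 - fps_X) ^ Suc k)" unfolding B by simp
  then have D: "D = fps_of_poly g * B" by (simp add: assms mult_ac)
  have "(\<lambda>n. real_of_int ((fps_of_poly p * B) $ n) / real n ^ k) \<longlonglongrightarrow> real_of_int (poly p 1) / fact k" for p
  proof (induction p)
    case (pCons a p)
    let ?G = "fps_of_poly p * B"
    have "(\<lambda>n. real_of_int a * (real ((n + k) choose k) / real n ^ k)) \<longlonglongrightarrow> real_of_int a * (1 / fact k)"
      by (intro tendsto_intros binomial_asymp)
    moreover have "(\<lambda>n. real_of_int (?G $ n) / real n ^ k * (real n / real (Suc n)) ^ k)
        \<longlonglongrightarrow> real_of_int (poly p 1) / fact k * 1 ^ k"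
      by (intro tendsto_intros pCons.IH LIMSEQ_n_over_Suc_n)
    then have "(\<lambda>n. real_of_int (?G $ n) / real n ^ k * (real n / real (Suc n)) ^ k)
        \<longlonglongrightarrow> real_of_int (poly p 1) / fact k" by simp
    then have "(\<lambda>n. real_of_int (?G $ n) / real (Suc n) ^ k) \<longlonglongrightarrow> real_of_int (poly p 1) / fact k"
    proof (rule Lim_transform_eventually)
      show "\<forall>\<^sub>F n in sequentially. real_of_int (?G $ n) / real n ^ k * (real n / real (Suc n)) ^ k
          = real_of_int (?G $ n) / real (Suc n) ^ k"
        by (rule eventually_sequentiallyI[of 1]) (simp add: power_divide)
    qed
    then have "(\<lambda>n. real_of_int (?G $ (n - 1)) / real n ^ k) \<longlonglongrightarrow> real_of_int (poly p 1) / fact k"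
      by (subst filterlim_sequentially_Suc[symmetric]) simp
    ultimately have "(\<lambda>n. real_of_int a * (real ((n + k) choose k) / real n ^ k) + real_of_int (?G $ (n - 1)) / real n ^ k)
       \<longlonglongrightarrow> real_of_int a * (1 / fact k) + real_of_int (poly p 1) / fact k" by (rule tendsto_add)
    moreover have "\<forall>\<^sub>F n in sequentially.
       real_of_int a * (real ((n + k) choose k) / real n ^ k) + real_of_int (?G $ (n - 1)) / real n ^ k
       = real_of_int ((fps_of_poly (pCons a p) * B) $ n) / real n ^ k"
    proof (rule eventually_sequentiallyI[of 1])
      fix n :: nat assume n: "1 \<le> n"
      have "fps_of_poly (pCons a p) * B = fps_const a * B + fps_X * ?G"
        by (simp add: fps_of_poly_pCons algebra_simps)
      then have "(fps_of_poly (pCons a p) * B) $ n = a * int ((n + k) choose k) + ?G $ (n - 1)"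
        using n by (simp add: B_def)
      then show "real_of_int a * (real ((n + k) choose k) / real n ^ k) + real_of_int (?G $ (n - 1)) / real n ^ k
       = real_of_int ((fps_of_poly (pCons a p) * B) $ n) / real n ^ k"
        by (simp add: add_divide_distrib)
    qed
    ultimately have "(\<lambda>n. real_of_int ((fps_of_poly (pCons a p) * B) $ n) / real n ^ k)
       \<longlonglongrightarrow> real_of_int a * (1 / fact k) + real_of_int (poly p 1) / fact k"
      by (rule Lim_transform_eventually)
    then show ?case by (simp add: add_divide_distrib)
  qed simp
  then show ?thesis unfolding D .
qed

text \<open>
  The analytic half of the theorem. The coefficients of \<open>D\<close> are \<open>O(n\<^sup>k)\<close> although the pole could have
  order \<open>k + 2\<close>, so \<open>u(1) = 0\<close>. Writing \<open>u = (z - 1) g\<close> lowers the order to \<open>k + 1\<close>; the leading term is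
  then \<open>- g(1) n\<^sup>k / k!\<close> with \<open>g(1) = u'(1)\<close>, and it is compared with that of \<open>S ((n + k) choose k)\<close>.
\<close>

lemma derivative_bound:
  assumes u: "fps_of_poly u = D * (1 - fps_X) ^ Suc (Suc k)"
    and nonneg: "\<And>n. 0 \<le> D $ n"
    and upper: "\<And>n. real_of_int (D $ n) \<le> S * real ((n + k) choose k)"
  shows "- real_of_int (poly (pderiv u) 1) \<le> S"
proof -
  have "(\<lambda>n. real_of_int (D $ n) / real n ^ Suc k) \<longlonglongrightarrow> real_of_int (poly u 1) / fact (Suc k)"
    by (rule coeff_asymp[OF u])
  moreover have "(\<lambda>n. real_of_int (D $ n) / real n ^ Suc k) \<longlonglongrightarrow> 0"
  proof (rule tendsto_sandwich)
    show "\<forall>\<^sub>F n in sequentially. 0 \<le> real_of_int (D $ n) / real n ^ Suc k"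
      using nonneg by (auto intro!: always_eventually)
    show "\<forall>\<^sub>F n in sequentially. real_of_int (D $ n) / real n ^ Suc k
        \<le> S * (real ((n + k) choose k) / real n ^ k) * (1 / real n)"
    proof (intro always_eventually allI)
      fix n
      show "real_of_int (D $ n) / real n ^ Suc k \<le> S * (real ((n + k) choose k) / real n ^ k) * (1 / real n)"
        using divide_right_mono[OF upper[of n], of "real n ^ Suc k"] by (simp add: mult.commute)
    qed
    have "(\<lambda>n. S * (real ((n + k) choose k) / real n ^ k) * (1 / real n)) \<longlonglongrightarrow> S * (1 / fact k) * 0"
      by (intro tendsto_intros binomial_asymp lim_const_over_n)
    then show "(\<lambda>n. S * (real ((n + k) choose k) / real n ^ k) * (1 / real n)) \<longlonglongrightarrow> 0" by simp
  qed simp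
  ultimately have "real_of_int (poly u 1) / fact (Suc k) = 0" using LIMSEQ_unique by blast
  then have "poly u 1 = 0" by simp
  then obtain g where g: "u = [:- 1, 1:] * g" by (metis poly_eq_0_iff_dvd dvdE)
  have "fps_of_poly (- g) * (1 - fps_X) = fps_of_poly u"
    by (simp add: g fps_of_poly_mult fps_of_poly_pCons fps_of_poly_uminus algebra_simps)
  also have "\<dots> = D * (1 - fps_X) ^ Suc k * (1 - fps_X)" unfolding u by simp
  finally have "(fps_of_poly (- g) - D * (1 - fps_X) ^ Suc k) * (1 - fps_X) = 0" by (simp add: algebra_simps)
  moreover have "(1 - fps_X :: int fps) \<noteq> 0"
  proof
    assume "(1 - fps_X :: int fps) = 0"
    then have "(1 - fps_X :: int fps) $ 0 = 0" by (simp only: fps_zero_nth)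
    then show False by simp
  qed
  ultimately have "fps_of_poly (- g) = D * (1 - fps_X) ^ Suc k" by simp
  then have "(\<lambda>n. real_of_int (D $ n) / real n ^ k) \<longlonglongrightarrow> real_of_int (poly (- g) 1) / fact k"
    by (rule coeff_asymp)
  moreover have "(\<lambda>n. S * (real ((n + k) choose k) / real n ^ k)) \<longlonglongrightarrow> S * (1 / fact k)"
    by (intro tendsto_intros binomial_asymp)
  ultimately have "real_of_int (poly (- g) 1) / fact k \<le> S * (1 / fact k)"
    by (rule LIMSEQ_le) (use upper in \<open>auto simp: divide_right_mono\<close>)
  then have "real_of_int (poly (- g) 1) / fact k \<le> S / fact k" by (simp only: times_divide_eq_right mult_1_right)
  then have "real_of_int (poly (- g) 1) \<le> S"
    using divide_le_cancel[of "real_of_int (poly (- g) 1)" "fact k" S] fact_gt_zero[of k, where 'a=real]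
    by linarith
  moreover have "poly (pderiv u) 1 = poly g 1" by (simp add: g pderiv_diff pderiv_pCons)
  ultimately show ?thesis by simp
qed

end

section \<open>Selecting prime ideals\<close>

lemma noetherian_maximal_ideal_satisfying:
  assumes noeth: "noetherian_ring R" and I: "ideal I R" and bad: "bad I"
  shows "\<exists>P. ideal P R \<and> I \<subseteq> P \<and> bad P \<and> (\<forall>K. ideal K R \<longrightarrow> P \<subset> K \<longrightarrow> \<not> bad K)"
proof -
  define A where "A = {K. ideal K R \<and> I \<subseteq> K \<and> bad K}"
  have "\<exists>P\<in>A. \<forall>K\<in>A. P \<subseteq> K \<longrightarrow> K = P"
  proof (rule subset_Zorn_nonempty)
    show "A \<noteq> {}" using I bad by (auto simp: A_def)
    fix C assume C: "C \<noteq> {}" "subset.chain A C"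
    then have "subset.chain {K. ideal K R} C" by (auto simp: subset.chain_def A_def)
    from noetherian_ring.ideal_chain_is_trivial[OF noeth C(1) this] have "\<Union>C \<in> C" .
    moreover have "C \<subseteq> A" using C(2) by (simp add: subset.chain_def)
    ultimately show "\<Union>C \<in> A" by (rule subsetD[rotated])
  qed
  then obtain P where P: "P \<in> A" "\<forall>K\<in>A. P \<subseteq> K \<longrightarrow> K = P" by (elim bexE)
  show ?thesis
  proof (intro exI[of _ P] conjI allI impI)
    fix K assume K: "ideal K R" "P \<subset> K"
    show "\<not> bad K"
    proof
      assume "bad K"
      moreover have "I \<subseteq> K" using K(2) P(1) unfolding A_def by blast
      ultimately have "K \<in> A" using K(1) by (simp add: A_def)
      then show False using P(2) K(2) by blast
    qed
  qed (use P(1) in \<open>simp_all add: A_def\<close>)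
qed

context cring
begin

lemma colon_ideal:
  assumes I: "ideal I R" and x: "x \<in> carrier R"
  shows "ideal {y \<in> carrier R. x \<otimes> y \<in> I} R"
proof -
  interpret I: ideal I R by (rule I)
  show ?thesis
  proof (rule idealI)
    show "subgroup {y \<in> carrier R. x \<otimes> y \<in> I} (add_monoid R)"
      by (unfold_locales)
         (use x in \<open>auto simp: r_distr r_minus simp flip: a_inv_def\<close>)
    fix a y assume "a \<in> {y \<in> carrier R. x \<otimes> y \<in> I}" and y: "y \<in> carrier R"
    then have a: "a \<in> carrier R" "x \<otimes> a \<in> I" by auto
    have "x \<otimes> (y \<otimes> a) = y \<otimes> (x \<otimes> a)" using a y x by (simp add: m_lcomm)
    then show "y \<otimes> a \<in> {y \<in> carrier R. x \<otimes> y \<in> I}" using a y I.I_l_closed by simp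
    then show "a \<otimes> y \<in> {y \<in> carrier R. x \<otimes> y \<in> I}" using a y by (simp add: m_comm)
  qed (rule ring_axioms)
qed

text \<open>
  For an ideal \<open>K\<close> and an element \<open>x\<close>, the module \<open>R / K\<close> is an extension of \<open>R / (K + x)\<close> by
  \<open>R / (K : x)\<close>. A property that must pass from \<open>K\<close> to one of these two ideals is attained by a
  prime: at a maximal \<open>P\<close> with the property, \<open>a b \<in> P\<close> with \<open>a, b \<notin> P\<close> would make both \<open>P + a\<close> and \<open>P : a\<close>
  strictly larger, so neither could have the property. It is applied to infinite length and to fast
  growth.
\<close>

lemma prime_ideal_with_splitting_property:
  assumes noeth: "noetherian_ring R" and I: "ideal I R" and bad: "bad I" and carrier: "\<not> bad (carrier R)"
    and split: "\<And>K x. ideal K R \<Longrightarrow> x \<in> carrier R \<Longrightarrow> bad K \<Longrightarrow>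
        bad (Idl (insert x K)) \<or> bad {y \<in> carrier R. x \<otimes> y \<in> K}"
  shows "\<exists>P. primeideal P R \<and> I \<subseteq> P \<and> bad P"
proof -
  obtain P where P: "ideal P R" "I \<subseteq> P" "bad P" "\<And>K. ideal K R \<Longrightarrow> P \<subset> K \<Longrightarrow> \<not> bad K"
    using noetherian_maximal_ideal_satisfying[OF noeth I, of bad] bad by blast
  have PR: "P \<subseteq> carrier R" using ideal.Icarr[OF P(1)] by blast
  have "primeideal P R"
  proof (rule primeidealI[OF P(1) is_cring])
    show "carrier R \<noteq> P" using carrier P(3) by blast
    fix a b assume a: "a \<in> carrier R" and b: "b \<in> carrier R" and ab: "a \<otimes> b \<in> P"
    show "a \<in> P \<or> b \<in> P"
    proof (rule ccontr)
      assume n: "\<not> (a \<in> P \<or> b \<in> P)"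
      have s: "insert a P \<subseteq> Idl (insert a P)" "ideal (Idl (insert a P)) R"
        using genideal_self[of "insert a P"] genideal_ideal[of "insert a P"] a PR by simp_all
      then have "P \<subset> Idl (insert a P)" using n by blast
      then have 1: "\<not> bad (Idl (insert a P))" using P(4) s(2) by blast
      have "P \<subseteq> {y \<in> carrier R. a \<otimes> y \<in> P}" using PR a ideal.I_l_closed[OF P(1)] by auto
      then have "P \<subset> {y \<in> carrier R. a \<otimes> y \<in> P}" using n ab b by blast
      then have 2: "\<not> bad {y \<in> carrier R. a \<otimes> y \<in> P}" using P(4)[OF colon_ideal[OF P(1) a]] by blast
      show False using split[OF P(1) a P(3)] 1 2 by blast
    qed
  qed
  then show ?thesis using P by blast
qed

lemma proper_ideal_subset_local:
  assumes noeth: "noetherian_ring R" and loc: "\<And>m'. maximalideal m' R \<Longrightarrow> m' = m"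
    and I: "ideal I R" "I \<noteq> carrier R"
  shows "I \<subseteq> m"
proof -
  obtain P where P: "ideal P R" "I \<subseteq> P" "P \<noteq> carrier R"
      "\<And>K. ideal K R \<Longrightarrow> P \<subset> K \<Longrightarrow> \<not> K \<noteq> carrier R"
    using noetherian_maximal_ideal_satisfying[OF noeth I(1), of "\<lambda>K. K \<noteq> carrier R"] I(2) by blast
  have "maximalideal P R" by (rule maximalidealI) (use P in auto)
  then show ?thesis using loc P(2) by blast
qed

lemma prime_contains_radical:
  assumes P: "primeideal P R" and "q \<subseteq> P" shows "ideal_radical R q \<subseteq> P"
proof
  fix a assume "a \<in> ideal_radical R q"
  then obtain n :: nat where a: "a \<in> carrier R" "a [^] n \<in> P" using assms(2) by (auto simp: ideal_radical_def)
  have "a [^] k \<in> P \<Longrightarrow> a \<in> P" for k :: nat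
  proof (induction k)
    case 0
    then have "\<one> \<in> P" by simp
    then show ?case using ideal.one_imp_carrier[of P R] primeideal.axioms(1)[OF P] a(1) by blast
  next
    case (Suc k)
    then show ?case using primeideal.I_prime[OF P, of "a [^] k" a] a(1) by auto
  qed
  then show "a \<in> P" using a(2) by blast
qed

lemma primeideal_quotient:
  assumes I: "ideal I R" and P: "primeideal P R" and IP: "I \<subseteq> P"
  shows "primeideal ((\<lambda>x. I +> x) ` P) (R Quot I)"
    and "\<And>x. x \<in> carrier R \<Longrightarrow> I +> x \<in> (\<lambda>x. I +> x) ` P \<longleftrightarrow> x \<in> P"
proof -
  interpret I: ideal I R by (rule I)
  interpret P: primeideal P R by (rule P)
  interpret Q: cring "R Quot I" by (rule I.quotient_is_cring[OF is_cring])
  have PR: "P \<subseteq> carrier R" using P.Icarr by blast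
  have cQ: "\<exists>x\<in>carrier R. X = I +> x" if "X \<in> carrier (R Quot I)" for X
    using that by (auto simp: FactRing_def A_RCOSETS_def')
  have mult: "(I +> x) \<otimes>\<^bsub>R Quot I\<^esub> (I +> y) = I +> (x \<otimes> y)" if "x \<in> carrier R" "y \<in> carrier R" for x y
    using I.rcoset_mult_add[OF that] by (simp add: FactRing_def)
  show mem: "I +> x \<in> (\<lambda>x. I +> x) ` P \<longleftrightarrow> x \<in> P" if x: "x \<in> carrier R" for x
  proof
    assume "I +> x \<in> (\<lambda>x. I +> x) ` P"
    then obtain y where y: "y \<in> P" "I +> x = I +> y" by auto
    then have "x \<ominus> y \<in> I" using quotient_eq_iff_same_a_r_cos[OF I x, of y] PR by auto
    then have "x \<ominus> y \<in> P" using IP by blast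
    then have "x \<ominus> y \<oplus> y \<in> P" using y(1) by (rule P.a_closed)
    moreover have "x \<ominus> y \<oplus> y = x" using x y PR by (simp add: a_minus_def a_assoc l_neg subset_iff)
    ultimately show "x \<in> P" by simp
  qed (rule imageI)
  show "primeideal ((\<lambda>x. I +> x) ` P) (R Quot I)"
  proof (rule primeidealI)
    show "ideal ((\<lambda>x. I +> x) ` P) (R Quot I)" by (rule ring_ideal_imp_quot_ideal[OF I P.is_ideal])
    show "cring (R Quot I)" by (rule Q.is_cring)
    have "\<one> \<notin> P" using P.one_imp_carrier P.I_notcarr by blast
    then have "I +> \<one> \<notin> (\<lambda>x. I +> x) ` P" using mem by simp
    moreover have "I +> \<one> \<in> carrier (R Quot I)" by (auto simp: FactRing_def A_RCOSETS_def')
    ultimately show "carrier (R Quot I) \<noteq> (\<lambda>x. I +> x) ` P" by blast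
    fix X Y assume X: "X \<in> carrier (R Quot I)" and Y: "Y \<in> carrier (R Quot I)"
      and XY: "X \<otimes>\<^bsub>R Quot I\<^esub> Y \<in> (\<lambda>x. I +> x) ` P"
    obtain x where x: "x \<in> carrier R" "X = I +> x" using cQ[OF X] by blast
    obtain y where y: "y \<in> carrier R" "Y = I +> y" using cQ[OF Y] by blast
    have "x \<otimes> y \<in> P" using XY mult[OF x(1) y(1)] mem[of "x \<otimes> y"] x y by simp
    then have "x \<in> P \<or> y \<in> P" using P.I_prime x y by blast
    then show "X \<in> (\<lambda>x. I +> x) ` P \<or> Y \<in> (\<lambda>x. I +> x) ` P" using x(2) y(2) by blast
  qed
qed

lemma krull_dim_quotient_ge:
  assumes I: "ideal I R" and P: "\<And>i. i \<le> n \<Longrightarrow> primeideal (P i) R" "\<And>i. i \<le> n \<Longrightarrow> I \<subseteq> P i"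
    and strict: "\<And>i. i < n \<Longrightarrow> P i \<subset> P (Suc i)"
  shows "enat n \<le> krull_dim (R Quot I)"
proof -
  let ?Q = "\<lambda>i. (\<lambda>x. I +> x) ` P i"
  have "?Q i \<subset> ?Q (Suc i)" if i: "i < n" for i
  proof -
    obtain x where x: "x \<in> P (Suc i)" "x \<notin> P i" using strict[OF i] by blast
    have "primeideal (P (Suc i)) R" using P(1) i by simp
    then have "x \<in> carrier R" using x(1) ideal.Icarr primeideal.axioms(1) by metis
    then have "I +> x \<notin> ?Q i" using primeideal_quotient(2)[OF I P(1)[of i] P(2)[of i], of x] x(2) i by simp
    then show ?thesis using x(1) strict[OF i] by blast
  qed
  moreover have "primeideal (?Q i) (R Quot I)" if "i \<le> n" for i
    by (rule primeideal_quotient(1)[OF I P(1)[OF that] P(2)[OF that]])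
  ultimately show ?thesis
    unfolding krull_dim_def
    by (intro Sup_upper CollectI exI[of _ n] conjI refl exI[of _ ?Q] allI impI)
qed

end

context module
begin

section \<open>Finitely generated modules over Noetherian rings\<close>

abbreviation span where "span S \<equiv> submodule_span R M S"

lemma span_insert:
  assumes x: "x \<in> carrier M" and S: "S \<subseteq> carrier M"
  shows "span (insert x S) = (\<lambda>a. a \<odot>\<^sub>M x) ` carrier R <+>\<^sub>M span S"
proof
  let ?C = "(\<lambda>a. a \<odot>\<^sub>M x) ` carrier R"
  note sC = sub_cyclic[OF R.oneideal x] and sS = sub_span[OF S]
  have "x \<in> ?C" using x by (intro image_eqI[of _ _ \<one>]) auto
  then have "x \<in> ?C <+>\<^sub>M span S" using sum_upper1[OF sC sS] by blast
  moreover have "S \<subseteq> ?C <+>\<^sub>M span S" using span_upper[of S] sum_upper2[OF sC sS] by blast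
  ultimately show "span (insert x S) \<subseteq> ?C <+>\<^sub>M span S"
    by (intro span_least sub_sum sC sS) blast
  have sI: "sub (span (insert x S))" using x S by (intro sub_span) blast
  have "x \<in> span (insert x S)" using span_upper by blast
  then have "?C \<subseteq> span (insert x S)" using sub_smult[OF sI] by blast
  moreover have "span S \<subseteq> span (insert x S)"
    using span_upper[of "insert x S"] by (intro span_least sI) blast
  ultimately show "?C <+>\<^sub>M span S \<subseteq> span (insert x S)" by (intro sum_least sI)
qed

text \<open>
  Induction on the number of generators of the ambient module: \<open>E\<close> is generated by generators of
  \<open>E \<inter> span S\<close> and by one element \<open>e b\<close> of \<open>E\<close> for each generator \<open>b\<close> of the ideal of those \<open>a\<close> for which
  \<open>a x\<close> lies in \<open>E + span S\<close>.
\<close>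

lemma submodule_fin_gen:
  assumes noeth: "noetherian_ring R" and S: "finite S" "S \<subseteq> carrier M" and E: "sub E" "E \<subseteq> span S"
  shows "\<exists>T. finite T \<and> T \<subseteq> E \<and> E = span T"
  using S E
proof (induction S arbitrary: E rule: finite_induct)
  case empty
  have "span {} \<subseteq> {\<zero>\<^sub>M}" by (intro span_least sub_zeroM) auto
  then have "E = span {}" using empty(2,3) span_least[OF empty(2), of "{}"] by blast
  then show ?case by (intro exI[of _ "{}"]) auto
next
  case (insert x S)
  then have x: "x \<in> carrier M" and SM: "S \<subseteq> carrier M" and E: "sub E" by auto
  note sS = sub_span[OF SM]
  obtain T' where T': "finite T'" "T' \<subseteq> E \<inter> span S" "E \<inter> span S = span T'"
    using insert.IH[OF SM sub_inter[OF E sS]] by blast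
  let ?W = "E <+>\<^sub>M span S"
  have W: "sub ?W" by (rule sub_sum[OF E sS])
  let ?I = "{a \<in> carrier R. a \<odot>\<^sub>M x \<in> ?W}"
  obtain B where B: "B \<subseteq> carrier R" "finite B" "?I = Idl B"
    using noetherian_ring.finetely_gen[OF noeth scalar_ideal[OF W x]] by blast
  have "\<forall>b\<in>B. \<exists>e\<in>E. \<exists>s\<in>span S. b \<odot>\<^sub>M x = e \<oplus>\<^sub>M s"
  proof
    fix b assume "b \<in> B"
    then have "b \<in> ?I" using R.genideal_self[OF B(1)] unfolding B(3) by blast
    then show "\<exists>e\<in>E. \<exists>s\<in>span S. b \<odot>\<^sub>M x = e \<oplus>\<^sub>M s" unfolding mem_Collect_eq mem_sum by blast
  qed
  then obtain e where e: "\<And>b. b \<in> B \<Longrightarrow> e b \<in> E \<and> (\<exists>s\<in>span S. b \<odot>\<^sub>M x = e b \<oplus>\<^sub>M s)" by metis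
  let ?T = "T' \<union> e ` B"
  have TE: "?T \<subseteq> E" using T'(2) e by blast
  then have TM: "?T \<subseteq> carrier M" using submoduleE(1)[OF E] by blast
  note sT = sub_span[OF TM]
  let ?V = "span ?T <+>\<^sub>M span S"
  have V: "sub ?V" by (rule sub_sum[OF sT sS])
  have "B \<subseteq> {a \<in> carrier R. a \<odot>\<^sub>M x \<in> ?V}"
  proof
    fix b assume b: "b \<in> B"
    have "e b \<in> span ?T" using span_upper[of ?T] b by blast
    then show "b \<in> {a \<in> carrier R. a \<odot>\<^sub>M x \<in> ?V}"
      using e[OF b] B(1) b unfolding mem_Collect_eq mem_sum by blast
  qed
  then have IV: "?I \<subseteq> {a \<in> carrier R. a \<odot>\<^sub>M x \<in> ?V}"
    unfolding B(3) by (rule R.genideal_minimal[OF scalar_ideal[OF V x]])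
  have "E \<subseteq> span ?T"
  proof
    fix w assume w: "w \<in> E"
    then have "w \<in> (\<lambda>a. a \<odot>\<^sub>M x) ` carrier R <+>\<^sub>M span S"
      using insert.prems(3) span_insert[OF x SM] by blast
    then obtain a s where as: "a \<in> carrier R" "s \<in> span S" "w = a \<odot>\<^sub>M x \<oplus>\<^sub>M s"
      unfolding mem_sum by blast
    have sM: "s \<in> carrier M" and axM: "a \<odot>\<^sub>M x \<in> carrier M" using as sub_carrier[OF sS] x by auto
    have "w \<ominus>\<^bsub>M\<^esub> s \<in> ?W"
      using w as(2) sum_upper1[OF E sS] sum_upper2[OF E sS] by (intro sub_minus[OF W]) blast+
    then have "a \<odot>\<^sub>M x \<in> ?W" using as(3) add_minus_cancel2[OF axM sM] by simp
    then have "a \<odot>\<^sub>M x \<in> ?V" using IV as(1) by blast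
    then obtain y s' where ys: "y \<in> span ?T" "s' \<in> span S" "a \<odot>\<^sub>M x = y \<oplus>\<^sub>M s'"
      unfolding mem_sum by blast
    have yE: "y \<in> E" using ys(1) span_least[OF E TE] by blast
    have c: "y \<in> carrier M" "s' \<in> carrier M" using sub_carrier[OF E yE] sub_carrier[OF sS ys(2)] .
    have w': "w = y \<oplus>\<^sub>M (s' \<oplus>\<^sub>M s)" using as(3) ys(3) c sM by (simp add: M.a_assoc)
    have "s' \<oplus>\<^sub>M s \<in> span S" by (rule sub_add[OF sS ys(2) as(2)])
    moreover have "w \<ominus>\<^bsub>M\<^esub> y = s' \<oplus>\<^sub>M s" unfolding w' using c sM by (simp add: add_minus_cancel)
    then have "s' \<oplus>\<^sub>M s \<in> E" using sub_minus[OF E w yE] by simp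
    ultimately have "s' \<oplus>\<^sub>M s \<in> span T'" using T'(3) by blast
    moreover have "span T' \<subseteq> span ?T" using span_upper[of ?T] by (intro span_least sT) blast
    ultimately show "w \<in> span ?T" unfolding w' using sub_add[OF sT ys(1)] by blast
  qed
  moreover have "span ?T \<subseteq> E" by (rule span_least[OF E TE])
  ultimately show ?case using T'(1) B(2) TE by (intro exI[of _ ?T]) auto
qed

text \<open>
  Generators are removed one at a time. Modulo \<open>span (S \<union> N)\<close> the generator \<open>e\<close> equals \<open>b e\<close> for some
  \<open>b \<in> q\<close>, and \<open>1 - b\<close> lies in no proper ideal of a local ring, so \<open>e\<close> is redundant.
\<close>

lemma nakayama:
  assumes noeth: "noetherian_ring R" and max: "maximalideal m R"
    and loc: "\<And>m'. maximalideal m' R \<Longrightarrow> m' = m"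
    and q: "ideal q R" "q \<subseteq> m" and N: "sub N"
    and S: "finite S" "S \<subseteq> carrier M"
    and T: "S \<subseteq> q \<star> (span (S \<union> N)) <+>\<^sub>M N"
  shows "S \<subseteq> N"
  using S T
proof (induction S rule: finite_induct)
  case (insert e S)
  have e: "e \<in> carrier M" and SM: "S \<union> N \<subseteq> carrier M" using insert.prems(1) submoduleE(1)[OF N] by auto
  have qR: "q \<subseteq> carrier R" using ideal.Icarr[OF q(1)] by blast
  note sT = sub_span[OF SM]
  let ?T = "span (S \<union> N)"
  have NT: "N \<subseteq> ?T" and ST: "S \<subseteq> ?T" using span_upper[of "S \<union> N"] by auto
  have insT: "span (insert e S \<union> N) = (\<lambda>a. a \<odot>\<^sub>M e) ` carrier R <+>\<^sub>M ?T"
    using span_insert[OF e SM] by simp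
  \<comment> \<open>\<open>q T + N\<close> lies in \<open>q e + span (S \<union> N)\<close>; the second summand absorbs everything not involving \<open>e\<close>.\<close>
  have qe: "sub ((\<lambda>a. a \<odot>\<^sub>M e) ` q)" by (rule sub_cyclic[OF q(1) e])
  let ?U = "(\<lambda>a. a \<odot>\<^sub>M e) ` q <+>\<^sub>M ?T"
  have U: "sub ?U" by (rule sub_sum[OF qe sT])
  have "q \<star> (span (insert e S \<union> N)) \<subseteq> ?U"
  proof (rule mult_least[OF U])
    fix b y assume b: "b \<in> q" and "y \<in> span (insert e S \<union> N)"
    then obtain a t where at: "a \<in> carrier R" "t \<in> ?T" "y = a \<odot>\<^sub>M e \<oplus>\<^sub>M t"
      unfolding insT mem_sum by blast
    have bR: "b \<in> carrier R" using b qR by blast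
    have tM: "t \<in> carrier M" using sub_carrier[OF sT at(2)] .
    have "b \<odot>\<^sub>M y = (b \<otimes> a) \<odot>\<^sub>M e \<oplus>\<^sub>M b \<odot>\<^sub>M t"
      using at bR e tM by (simp add: smult_r_distr smult_assoc1)
    moreover have "b \<otimes> a \<in> q" using ideal.I_r_closed[OF q(1) b at(1)] .
    moreover have "b \<odot>\<^sub>M t \<in> ?T" using sub_smult[OF sT bR at(2)] .
    ultimately show "b \<odot>\<^sub>M y \<in> ?U" unfolding mem_sum by blast
  qed
  moreover have "N \<subseteq> ?U" using NT sum_upper2[OF qe sT] by blast
  ultimately have U_up: "q \<star> (span (insert e S \<union> N)) <+>\<^sub>M N \<subseteq> ?U"
    by (intro sum_least[OF U])
  then have "e \<in> ?U" using insert.prems(2) by blast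
  then obtain b t where bt: "b \<in> q" "t \<in> ?T" "e = b \<odot>\<^sub>M e \<oplus>\<^sub>M t"
    unfolding mem_sum by blast
  have bR: "b \<in> carrier R" using bt(1) qR by blast
  have tM: "t \<in> carrier M" using sub_carrier[OF sT bt(2)] .
  have beM: "b \<odot>\<^sub>M e \<in> carrier M" using bR e by simp
  have "(\<one> \<ominus> b) \<odot>\<^sub>M e = e \<ominus>\<^bsub>M\<^esub> b \<odot>\<^sub>M e"
    using bR e by (simp add: R.minus_eq M.minus_eq smult_l_distr smult_l_minus)
  also have "\<dots> = (b \<odot>\<^sub>M e \<oplus>\<^sub>M t) \<ominus>\<^bsub>M\<^esub> b \<odot>\<^sub>M e" using bt(3) by metis
  also have "\<dots> = t" by (rule add_minus_cancel[OF beM tM])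
  finally have be: "(\<one> \<ominus> b) \<odot>\<^sub>M e \<in> ?T" using bt(2) by simp
  let ?I = "{a \<in> carrier R. a \<odot>\<^sub>M e \<in> ?T}"
  have I: "ideal ?I R" by (rule scalar_ideal[OF sT e])
  have "?I = carrier R"
  proof (rule ccontr)
    assume "?I \<noteq> carrier R"
    then have "?I \<subseteq> m" using R.proper_ideal_subset_local[OF noeth loc I] by blast
    then have 1: "\<one> \<ominus> b \<in> m" using be bR by auto
    have mi: "ideal m R" using max maximalideal.axioms(1) by blast
    have "(\<one> \<ominus> b) \<oplus> b \<in> m"
      using 1 bt(1) q(2) additive_subgroup.a_closed[OF ideal.axioms(1)[OF mi]] by blast
    moreover have "(\<one> \<ominus> b) \<oplus> b = \<one>" using bR by (simp add: R.minus_eq R.a_assoc R.l_neg)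
    ultimately have "m = carrier R" using ideal.one_imp_carrier[OF mi] by simp
    then show False using maximalideal.I_notcarr[OF max] by simp
  qed
  then have eT: "e \<in> ?T" using R.one_closed smult_one[OF e] by force
  then have "span (insert e S \<union> N) \<subseteq> ?T" using ST NT by (intro span_least sT) blast
  then have "q \<star> (span (insert e S \<union> N)) \<subseteq> q \<star> ?T"
    using qR submoduleE(1)[OF sT] by (intro mult_mono) auto
  then have "S \<subseteq> q \<star> ?T <+>\<^sub>M N"
    using insert.prems(2) sum_mono[of _ _ N N] by blast
  then have "S \<subseteq> N" using insert.IH insert.prems(1) by blast
  then have "?T \<subseteq> N" by (intro span_least[OF N]) blast
  then show ?case using eT \<open>S \<subseteq> N\<close> by blast
qed simp

end

section \<open>Finiteness of lengths\<close>

lemma enat_finite_le: "x \<le> y \<Longrightarrow> y \<noteq> \<infinity> \<Longrightarrow> x \<noteq> (\<infinity>::enat)"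
  by (cases x) auto

context module
begin

text \<open>
  \<open>(R x + N) / N\<close> is a quotient of the field \<open>R / m\<close>. Concretely, the scalars that carry \<open>x\<close> into an
  intermediate submodule form an ideal containing \<open>m\<close>.
\<close>

lemma qlen_cyclic_le_1:
  assumes max: "maximalideal m R" and N: "sub N" and x: "x \<in> carrier M"
    and mx: "\<And>a. a \<in> m \<Longrightarrow> a \<odot>\<^sub>M x \<in> N"
  shows "qlen ((\<lambda>a. a \<odot>\<^sub>M x) ` carrier R <+>\<^sub>M N) N \<le> 1"
proof -
  let ?C = "(\<lambda>a. a \<odot>\<^sub>M x) ` carrier R"
  note sC = sub_cyclic[OF R.oneideal x]
  have mi: "ideal m R" using max maximalideal.axioms(1) by blast
  have mR: "m \<subseteq> carrier R" using ideal.Icarr[OF mi] by blast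
  have top: "K = ?C <+>\<^sub>M N" if K: "sub K" "N \<subset> K" "K \<subseteq> ?C <+>\<^sub>M N" for K
  proof -
    obtain k where k: "k \<in> K" "k \<notin> N" using K(2) by blast
    then have "k \<in> ?C <+>\<^sub>M N" using K(3) by blast
    then obtain a n where an: "a \<in> carrier R" "n \<in> N" "k = a \<odot>\<^sub>M x \<oplus>\<^sub>M n"
      unfolding mem_sum by blast
    have c: "a \<odot>\<^sub>M x \<in> carrier M" "n \<in> carrier M" using an x sub_carrier[OF N] by auto
    have "n \<in> K" using an(2) K(2) by blast
    then have "k \<ominus>\<^bsub>M\<^esub> n \<in> K" using k(1) sub_minus[OF K(1)] by blast
    then have axK: "a \<odot>\<^sub>M x \<in> K" unfolding an(3) using c by (simp add: add_minus_cancel2)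
    have "a \<notin> m"
    proof
      assume "a \<in> m"
      then have "a \<odot>\<^sub>M x \<in> N" by (rule mx)
      then have "k \<in> N" unfolding an(3) using an(2) by (rule sub_add[OF N])
      then show False using k(2) by blast
    qed
    let ?I = "{b \<in> carrier R. b \<odot>\<^sub>M x \<in> K}"
    have I: "ideal ?I R" by (rule scalar_ideal[OF K(1) x])
    have "m \<subseteq> ?I" using mx mR K(2) by blast
    moreover have "a \<in> ?I" using an(1) axK by blast
    ultimately have "?I = carrier R"
      using maximalideal.I_maximal[OF max I] \<open>a \<notin> m\<close> by blast
    then have "?C \<subseteq> K" by blast
    then show ?thesis using K by (intro equalityI sum_least) auto
  qed
  show ?thesis
  proof (rule qlen_leI)
    fix n assume n: "strict_chain n (?C <+>\<^sub>M N) N"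
    have "n \<le> 1"
    proof (rule ccontr)
      assume "\<not> n \<le> 1"
      then have "strict_chain (Suc (Suc 0)) (?C <+>\<^sub>M N) N" using strict_chain_le[OF n] by simp
      then obtain K where K: "strict_chain (Suc 0) K N" "K \<subset> ?C <+>\<^sub>M N"
        by (cases rule: strict_chain.cases) blast
      from K(1) obtain L where L: "strict_chain 0 L N" "L \<subset> K" "sub K"
        by (cases rule: strict_chain.cases) blast
      then have "N \<subset> K" using strict_chain_sub[OF L(1)] by blast
      then show False using top[OF L(3)] K(2) by blast
    qed
    then show "enat n \<le> 1" by (simp add: one_enat_def)
  qed
qed

lemma qlen_span_finite:
  assumes max: "maximalideal m R" and N: "sub N" and S: "finite S" "S \<subseteq> carrier M"
    and mS: "\<And>a x. a \<in> m \<Longrightarrow> x \<in> S \<Longrightarrow> a \<odot>\<^sub>M x \<in> N"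
  shows "qlen (span S <+>\<^sub>M N) N \<noteq> \<infinity>"
  using S mS
proof (induction S rule: finite_induct)
  case empty
  have "span {} \<subseteq> N" by (intro span_least N) auto
  then have "span {} <+>\<^sub>M N = N" using sum_absorb2[OF sub_span N] by simp
  then show ?case by simp
next
  case (insert x S)
  have x: "x \<in> carrier M" and SM: "S \<subseteq> carrier M" using insert.prems by auto
  let ?C = "(\<lambda>a. a \<odot>\<^sub>M x) ` carrier R" and ?W = "span S <+>\<^sub>M N"
  note sC = sub_cyclic[OF R.oneideal x] and sS = sub_span[OF SM]
  have W: "sub ?W" by (rule sub_sum[OF sS N])
  have NW: "N \<subseteq> ?W" by (rule sum_upper2[OF sS N])
  have "span (insert x S) <+>\<^sub>M N = ?C <+>\<^sub>M ?W"
    unfolding span_insert[OF x SM] by (rule sum_assoc[OF sC sS N])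
  then have "qlen (span (insert x S) <+>\<^sub>M N) N = qlen (?C <+>\<^sub>M ?W) ?W + qlen ?W N"
    using qlen_add[OF sub_sum[OF sC W] W N NW sum_upper2[OF sC W]] by simp
  moreover have "qlen ?W N \<noteq> \<infinity>" using insert.IH SM insert.prems(2) by simp
  moreover have "qlen (?C <+>\<^sub>M ?W) ?W \<le> 1"
    using insert.prems(2) NW by (intro qlen_cyclic_le_1[OF max W x]) auto
  then have "qlen (?C <+>\<^sub>M ?W) ?W \<noteq> \<infinity>" by (rule enat_finite_le) (simp add: one_enat_def)
  ultimately show ?case by (simp add: plus_eq_infty_iff_enat del: not_infinity_eq)
qed

text \<open>
  Multiplication by \<open>x\<close> relates \<open>M / (I M + Z)\<close> to \<open>I + x\<close> and \<open>I : x\<close>. Allowing two submodules \<open>Z\<close> and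
  \<open>Z'\<close> with \<open>x Z' \<subseteq> Z\<close> makes the lemma usable with \<open>Z = F\<^sub>n\<^sub>+\<^sub>1\<close> and \<open>Z' = F\<^sub>n\<close> when \<open>x \<in> q\<close>.
\<close>

lemma qlen_split_ideal:
  assumes I: "ideal I R" and x: "x \<in> carrier R" and Z: "sub Z" and Z': "sub Z'" "\<And>z. z \<in> Z' \<Longrightarrow> x \<odot>\<^sub>M z \<in> Z"
  shows "qlen (carrier M) (I \<star> carrier M <+>\<^sub>M Z)
     \<le> qlen (carrier M) ((Idl (insert x I)) \<star> carrier M <+>\<^sub>M Z)
      + qlen (carrier M) ({y \<in> carrier R. x \<otimes> y \<in> I} \<star> carrier M <+>\<^sub>M Z')"
proof -
  let ?c = "carrier M" and ?K = "{y \<in> carrier R. x \<otimes> y \<in> I}"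
  have IR: "I \<subseteq> carrier R" using ideal.Icarr[OF I] by blast
  let ?IM = "I \<star> ?c" and ?S = "(\<lambda>m. x \<odot>\<^sub>M m) ` ?c"
  let ?N = "?IM <+>\<^sub>M Z" and ?Y = "?K \<star> ?c <+>\<^sub>M Z'"
  have sI: "sub ?IM" by (intro sub_mult IR order_refl)
  have sS: "sub ?S" by (rule sub_scal[OF x sub_carrierM])
  have N: "sub ?N" by (rule sub_sum[OF sI Z])
  have sK: "sub (?K \<star> ?c)" by (intro sub_mult) auto
  have Y: "sub ?Y" by (rule sub_sum[OF sK Z'(1)])
  have eq: "(Idl (insert x I)) \<star> ?c <+>\<^sub>M Z = ?S <+>\<^sub>M ?N"
  proof -
    have "(Idl (insert x I)) \<star> ?c = ?S <+>\<^sub>M ?IM"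
      using mult_Idl[OF _ sub_carrierM, of "insert x I"] mult_insert[OF x IR sub_carrierM] x IR by simp
    moreover have "(?S <+>\<^sub>M ?IM) <+>\<^sub>M Z = ?S <+>\<^sub>M ?N"
      by (rule sum_assoc[OF sS sI Z])
    ultimately show ?thesis by simp
  qed
  have "qlen ?c ?N = qlen ?c (?S <+>\<^sub>M ?N) + qlen (?S <+>\<^sub>M ?N) ?N"
    by (intro qlen_add sub_carrierM sub_sum sS N sum_upper2 submoduleE(1))
  also have "qlen (?S <+>\<^sub>M ?N) ?N \<le> qlen ?c ?Y"
  proof (rule qlen_scal_le[OF sub_carrierM Y submoduleE(1)[OF Y] N x])
    have "?Y \<subseteq> colon M ?N x"
    proof (rule sum_least[OF sub_colon[OF N x]])
      show "?K \<star> ?c \<subseteq> colon M ?N x"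
      proof (rule mult_least[OF sub_colon[OF N x]])
        fix b y assume b: "b \<in> ?K" and y: "y \<in> ?c"
        have "x \<odot>\<^sub>M (b \<odot>\<^sub>M y) = (x \<otimes> b) \<odot>\<^sub>M y" using b y x by (simp add: smult_assoc1)
        also have "\<dots> \<in> ?IM" using b y by (intro mult_upper) auto
        finally show "b \<odot>\<^sub>M y \<in> colon M ?N x"
          using sum_upper1[OF sI Z] b y by (auto simp: colon_def)
      qed
      show "Z' \<subseteq> colon M ?N x"
        using Z'(2) sub_carrier[OF Z'(1)] sum_upper2[OF sI Z] by (auto simp: colon_def)
    qed
    then show "x \<odot>\<^sub>M y \<in> ?N" if "y \<in> ?Y" for y using that by (auto simp: colon_def)
  qed
  finally show ?thesis unfolding eq by (simp add: add_left_mono)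
qed

lemma qlen_mult_powers_finite:
  assumes B: "finite B" "B \<subseteq> carrier R" and fin: "qlen (carrier M) (B \<star> carrier M) \<noteq> \<infinity>"
  shows "sub ((ideal_mult R M B ^^ n) (carrier M)) \<and>
    (ideal_mult R M B ^^ Suc n) (carrier M) \<subseteq> (ideal_mult R M B ^^ n) (carrier M) \<and>
    qlen ((ideal_mult R M B ^^ n) (carrier M)) ((ideal_mult R M B ^^ Suc n) (carrier M)) \<noteq> \<infinity> \<and>
    qlen (carrier M) ((ideal_mult R M B ^^ n) (carrier M)) \<noteq> \<infinity>"
proof (induction n)
  case 0
  show ?case using fin sub_carrierM sub_mult[OF B(2) order_refl] submoduleE(1) by simp
next
  case (Suc n)
  let ?G = "\<lambda>n. (ideal_mult R M B ^^ n) (carrier M)"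
  have s: "sub (?G n)" "sub (?G (Suc n))" "sub (?G (Suc (Suc n)))"
    using Suc.IH sub_mult[OF B(2) submoduleE(1)] by auto
  have le: "?G (Suc n) \<subseteq> ?G n" "?G (Suc (Suc n)) \<subseteq> ?G (Suc n)"
    using mult_subset[OF s(1) B(2)] mult_subset[OF s(2) B(2)] by auto
  have "qlen (?G (Suc n)) (?G (Suc (Suc n))) \<le> of_nat (card B) * qlen (?G n) (?G (Suc n))"
    using qlen_mult_le[OF B s(1,2) le(1)] by simp
  moreover have "of_nat (card B) * qlen (?G n) (?G (Suc n)) \<noteq> \<infinity>"
    using Suc.IH by (auto simp: of_nat_eq_enat imult_is_infinity)
  ultimately have f: "qlen (?G (Suc n)) (?G (Suc (Suc n))) \<noteq> \<infinity>" by (rule enat_finite_le)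
  have "qlen (carrier M) (?G (Suc n)) = qlen (carrier M) (?G n) + qlen (?G n) (?G (Suc n))"
    by (rule qlen_add[OF sub_carrierM s(1) s(2) le(1) submoduleE(1)[OF s(1)]])
  then have "qlen (carrier M) (?G (Suc n)) \<noteq> \<infinity>"
    using Suc.IH by (simp add: plus_eq_infty_iff_enat del: not_infinity_eq)
  then show ?case using s(2) le(2) f by blast
qed

end

locale filtered_module = module R M for R (structure) and M (structure) +
  fixes m q :: "'a set" and F :: "nat \<Rightarrow> 'c set"
  assumes local_ring: "noetherian_local_ring R m"
    and primary: "primary_to R m q"
    and fin_gen: "fin_gen_module R M"
    and good: "good_filtration R M q F"
begin

lemma noeth: "noetherian_ring R" and max: "maximalideal m R"
  and loc: "maximalideal m' R \<Longrightarrow> m' = m"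
  using local_ring by (auto simp: noetherian_local_ring_def)

lemma q_ideal: "ideal q R" and q_proper: "q \<noteq> carrier R" and q_radical: "ideal_radical R q = m"
  using primary by (auto simp: primary_to_def primary_ideal_def)

lemma q_carrier: "q \<subseteq> carrier R"
  using ideal.Icarr[OF q_ideal] by blast

lemma q_subset_m: "q \<subseteq> m"
  using R.proper_ideal_subset_local[OF noeth loc q_ideal q_proper] .

lemma F_0: "F 0 = carrier M" and F_sub: "sub (F n)" and F_Suc: "F (Suc n) \<subseteq> F n"
  and F_mult: "q \<star> F n \<subseteq> F (Suc n)"
  using good by (auto simp: good_filtration_def)

lemma F_smult: "a \<in> q \<Longrightarrow> x \<in> F n \<Longrightarrow> a \<odot>\<^sub>M x \<in> F (Suc n)"
  using F_mult mult_upper by blast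

lemma F_antimono: "i \<le> j \<Longrightarrow> F j \<subseteq> F i"
  by (rule lift_Suc_antimono_le[of F]) (rule F_Suc)

lemma F_carrier: "F n \<subseteq> carrier M"
  using submoduleE(1)[OF F_sub] .

text \<open>
  Otherwise some prime \<open>P\<close> containing \<open>q\<close> makes \<open>M / (P M + q M)\<close> of infinite length. Such a prime
  contains the radical \<open>m\<close> of \<open>q\<close>, so this module is finitely generated and killed by \<open>m\<close>, a contradiction.
\<close>

lemma qlen_mod_q_finite: "qlen (carrier M) (q \<star> carrier M) \<noteq> \<infinity>"
proof
  assume inf: "qlen (carrier M) (q \<star> carrier M) = \<infinity>"
  let ?Z = "q \<star> carrier M"
  define bad where "bad I \<longleftrightarrow> qlen (carrier M) (I \<star> carrier M <+>\<^sub>M ?Z) = \<infinity>" for I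
  have Z: "sub ?Z" by (intro sub_mult q_carrier order_refl)
  have "\<exists>P. primeideal P R \<and> q \<subseteq> P \<and> bad P"
  proof (rule R.prime_ideal_with_splitting_property[OF noeth q_ideal])
    show "bad q" using inf sum_absorb1[OF Z Z] by (simp add: bad_def)
    show "\<not> bad (carrier R)"
      using sum_absorb1[OF sub_carrierM Z submoduleE(1)[OF Z]] by (simp add: bad_def mult_carrier)
    fix K x assume K: "ideal K R" and x: "x \<in> carrier R" and "bad K"
    moreover have "x \<odot>\<^sub>M z \<in> ?Z" if "z \<in> ?Z" for z using sub_smult[OF Z x that] .
    ultimately show "bad (Idl (insert x K)) \<or> bad {y \<in> carrier R. x \<otimes> y \<in> K}"
      using qlen_split_ideal[OF K x Z Z] by (simp add: bad_def plus_eq_infty_iff_enat)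
  qed
  then obtain P where P: "primeideal P R" "q \<subseteq> P" "bad P" by blast
  have mP: "m \<subseteq> P" using R.prime_contains_radical[OF P(1,2)] q_radical by simp
  have Pi: "ideal P R" using primeideal.axioms(1)[OF P(1)] .
  have PR: "P \<subseteq> carrier R" using ideal.Icarr[OF Pi] by blast
  have mR: "m \<subseteq> carrier R" using mP PR by blast
  obtain S where S: "finite S" "S \<subseteq> carrier M" "carrier M = span S"
    using fin_gen by (auto simp: fin_gen_module_def)
  let ?N = "P \<star> carrier M <+>\<^sub>M ?Z"
  have sP: "sub (P \<star> carrier M)" by (intro sub_mult PR order_refl)
  have N: "sub ?N" by (rule sub_sum[OF sP Z])
  have "qlen (span S <+>\<^sub>M ?N) ?N \<noteq> \<infinity>"
  proof (rule qlen_span_finite[OF max N S(1,2)])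
    fix a x assume "a \<in> m" "x \<in> S"
    then have "a \<odot>\<^sub>M x \<in> P \<star> carrier M" using mP S(2) by (intro mult_upper) auto
    then show "a \<odot>\<^sub>M x \<in> ?N" using sum_upper1[OF sP Z] by blast
  qed
  moreover have "span S <+>\<^sub>M ?N = carrier M"
    unfolding S(3)[symmetric] by (rule sum_absorb1[OF sub_carrierM N submoduleE(1)[OF N]])
  ultimately show False using P(3) by (simp add: bad_def)
qed

lemma qlen_F_finite: "qlen (carrier M) (F n) \<noteq> \<infinity>"
proof -
  obtain B where B: "B \<subseteq> carrier R" "finite B" "q = Idl B"
    using noetherian_ring.finetely_gen[OF noeth q_ideal] by blast
  have qB: "q \<star> X = B \<star> X" if "sub X" for X
    unfolding B(3) by (rule mult_Idl[OF B(1) that])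
  let ?G = "\<lambda>n. (ideal_mult R M B ^^ n) (carrier M)"
  have fin: "qlen (carrier M) (B \<star> carrier M) \<noteq> \<infinity>"
    using qlen_mod_q_finite qB[OF sub_carrierM] by simp
  note G = qlen_mult_powers_finite[OF B(2,1) fin]
  have "?G n \<subseteq> F n"
  proof (induction n)
    case (Suc n)
    have "?G (Suc n) = q \<star> (?G n)" using G[of n] qB by simp
    also have "\<dots> \<subseteq> q \<star> F n" by (rule mult_mono[OF order_refl Suc q_carrier F_carrier])
    finally show ?case using F_mult by blast
  qed (simp add: F_0)
  then have "qlen (carrier M) (F n) \<le> qlen (carrier M) (?G n)"
    using G[of n] by (intro qlen_antimono sub_carrierM F_sub F_carrier) auto
  then show ?thesis by (rule enat_finite_le) (use G[of n] in blast)
qed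

section \<open>The order of growth is at most the dimension\<close>

text \<open>
  The Hilbert-Samuel function of the filtration induced on \<open>M / N\<close>.
\<close>

definition hilbert_samuel :: "'c set \<Rightarrow> nat \<Rightarrow> nat" where
  "hilbert_samuel N n = the_enat (qlen (carrier M) (F n <+>\<^sub>M N))"

lemma qlen_F_sum_finite: "sub N \<Longrightarrow> qlen (carrier M) (F n <+>\<^sub>M N) \<noteq> \<infinity>"
proof -
  assume N: "sub N"
  have "qlen (carrier M) (F n <+>\<^sub>M N) \<le> qlen (carrier M) (F n)"
    using submoduleE(1)[OF sub_sum[OF F_sub N]]
    by (intro qlen_antimono sub_carrierM F_sub sub_sum N sum_upper1)
  then show ?thesis by (rule enat_finite_le[OF _ qlen_F_finite])
qed

lemma enat_hilbert_samuel: "sub N \<Longrightarrow> enat (hilbert_samuel N n) = qlen (carrier M) (F n <+>\<^sub>M N)"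
  unfolding hilbert_samuel_def using qlen_F_sum_finite[of N n] by auto

text \<open>
  The least member \<open>P\<close> of the chain is a prime containing \<open>I\<close> that still has fast growth. It cannot
  contain \<open>q\<close>, as the growth would then be bounded. For \<open>x\<close> in \<open>q\<close> but not in \<open>P\<close> one has \<open>P : x = P\<close>, so the
  growth function of \<open>P\<close> has increments bounded by that of \<open>P + x\<close>. Thus \<open>P + x\<close> loses at most one degree
  and the induction hypothesis supplies the rest of the chain.
\<close>

lemma growth_imp_prime_chain:
  assumes "ideal I R" "\<not> growth_le d (hilbert_samuel (I \<star> carrier M))"
  shows "\<exists>P. (\<forall>i\<le>Suc d. primeideal (P i) R \<and> I \<subseteq> P i) \<and> (\<forall>i<Suc d. P i \<subset> P (Suc i))"
  using assms
proof (induction d arbitrary: I rule: less_induct)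
  case (less d)
  note I = less.prems(1) and bad = less.prems(2)
  let ?L = "\<lambda>I. hilbert_samuel (I \<star> carrier M)"
  have sIM: "sub (K \<star> carrier M)" if "K \<subseteq> carrier R" for K
    using that by (intro sub_mult order_refl)
  have sIM': "sub (K \<star> carrier M)" if "ideal K R" for K
    using ideal.Icarr[OF that] by (intro sIM) blast
  have split: "?L K (n + k) \<le> ?L (Idl (insert x K)) (n + k) + ?L {y \<in> carrier R. x \<otimes> y \<in> K} n"
    if K: "ideal K R" and x: "x \<in> carrier R" and xF: "\<And>z. z \<in> F n \<Longrightarrow> x \<odot>\<^sub>M z \<in> F (n + k)" for K x n k
  proof -
    have KR: "insert x K \<subseteq> carrier R" using ideal.Icarr[OF K] x by blast
    have i: "ideal (Idl (insert x K)) R" by (rule R.genideal_ideal[OF KR])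
    have c: "K \<star> carrier M <+>\<^sub>M F n = F n <+>\<^sub>M K \<star> carrier M"
      if "ideal K R" for K n by (rule sum_commute[OF sIM'[OF that] F_sub])
    have "enat (?L K (n + k)) \<le> enat (?L (Idl (insert x K)) (n + k)) + enat (?L {y \<in> carrier R. x \<otimes> y \<in> K} n)"
      using qlen_split_ideal[OF K x F_sub F_sub xF]
      unfolding c[OF K] c[OF i] c[OF R.colon_ideal[OF K x]]
        enat_hilbert_samuel[OF sIM'[OF K]] enat_hilbert_samuel[OF sIM'[OF i]]
        enat_hilbert_samuel[OF sIM'[OF R.colon_ideal[OF K x]]] by simp
    then show ?thesis by simp
  qed
  have "\<exists>P. primeideal P R \<and> I \<subseteq> P \<and> \<not> growth_le d (?L P)"
  proof (rule R.prime_ideal_with_splitting_property[OF noeth I])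
    show "\<not> growth_le d (?L I)" by (rule bad)
    have "?L (carrier R) n = 0" for n
      using sum_absorb2[OF F_sub sub_carrierM F_carrier] by (simp add: hilbert_samuel_def mult_carrier zero_enat_def)
    then show "\<not> \<not> growth_le d (?L (carrier R))" by (simp add: growth_le_def)
    fix K x assume K: "ideal K R" and x: "x \<in> carrier R" and "\<not> growth_le d (?L K)"
    then show "\<not> growth_le d (?L (Idl (insert x K))) \<or> \<not> growth_le d (?L {y \<in> carrier R. x \<otimes> y \<in> K})"
      using growth_le_add[of d "?L (Idl (insert x K))" "?L {y \<in> carrier R. x \<otimes> y \<in> K}" "?L K"]
        split[OF K x, of _ 0] sub_smult[OF F_sub x] by auto
  qed
  then obtain P where P: "primeideal P R" "I \<subseteq> P" "\<not> growth_le d (?L P)" by blast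
  have Pi: "ideal P R" using primeideal.axioms(1)[OF P(1)] .
  have PR: "P \<subseteq> carrier R" using ideal.Icarr[OF Pi] by blast
  have "\<not> q \<subseteq> P"
  proof
    assume qP: "q \<subseteq> P"
    have sq: "sub (q \<star> carrier M)" by (rule sIM[OF q_carrier])
    have "enat (?L P n) \<le> qlen (carrier M) (q \<star> carrier M)" for n
    proof -
      have "q \<star> carrier M \<subseteq> P \<star> carrier M"
        by (rule mult_mono[OF qP order_refl PR order_refl])
      also have "\<dots> \<subseteq> F n <+>\<^sub>M P \<star> carrier M" by (rule sum_upper2[OF F_sub sIM[OF PR]])
      finally show ?thesis
        unfolding enat_hilbert_samuel[OF sIM[OF PR]]
        by (intro qlen_antimono sub_carrierM sq sub_sum F_sub sIM[OF PR] submoduleE(1))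
    qed
    then obtain C where C: "\<And>n. ?L P n \<le> C"
      using qlen_mod_q_finite by (cases "qlen (carrier M) (q \<star> carrier M)") auto
    have "?L P n \<le> C * (n + 1) ^ d" for n
    proof -
      have "?L P n \<le> C * 1" using C[of n] by simp
      also have "\<dots> \<le> C * (n + 1) ^ d" by (intro mult_le_mono2 one_le_power) simp
      finally show ?thesis .
    qed
    then show False using P(3) by (auto simp: growth_le_def)
  qed
  then obtain x where x: "x \<in> q" "x \<notin> P" by blast
  have xR: "x \<in> carrier R" using x q_carrier by blast
  let ?I' = "Idl (insert x P)"
  have xP: "insert x P \<subseteq> carrier R" using xR PR by blast
  have I': "ideal ?I' R" "P \<subset> ?I'"
    using R.genideal_ideal[OF xP] R.genideal_self[OF xP] x(2) by blast+
  \<comment> \<open>Multiplication by \<open>x \<in> q\<close> raises the filtration by one step, hence the shift between \<open>n\<close> and \<open>n + 1\<close>.\<close>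
  have rec: "?L P (Suc n) \<le> ?L P n + ?L ?I' (Suc n)" for n
  proof -
    have "{y \<in> carrier R. x \<otimes> y \<in> P} = P"
      using primeideal.I_prime[OF P(1) xR] x(2) PR ideal.I_l_closed[OF Pi] xR by blast
    then show ?thesis using split[OF Pi xR, of n 1] F_smult[OF x(1)] by simp
  qed
  have extend: "\<exists>P. (\<forall>i\<le>Suc d. primeideal (P i) R \<and> I \<subseteq> P i) \<and> (\<forall>i<Suc d. P i \<subset> P (Suc i))"
    if Q: "\<forall>i\<le>d. primeideal (Q i) R \<and> ?I' \<subseteq> Q i" "\<forall>i<d. Q i \<subset> Q (Suc i)" for Q
  proof (intro exI[of _ "\<lambda>i. case i of 0 \<Rightarrow> P | Suc i \<Rightarrow> Q i"] conjI allI impI)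
    fix i assume "i \<le> Suc d"
    then show "primeideal (case i of 0 \<Rightarrow> P | Suc i \<Rightarrow> Q i) R" "I \<subseteq> (case i of 0 \<Rightarrow> P | Suc i \<Rightarrow> Q i)"
      using P Q(1) I'(2) by (cases i; force)+
  next
    fix i assume "i < Suc d"
    then show "(case i of 0 \<Rightarrow> P | Suc i \<Rightarrow> Q i) \<subset> (case Suc i of 0 \<Rightarrow> P | Suc i \<Rightarrow> Q i)"
    proof (cases i)
      case 0
      have "P \<subset> Q 0" using I'(2) Q(1) by (meson less_eq_nat.simps(1) psubset_subset_trans)
      then show ?thesis using 0 by simp
    next
      case (Suc j)
      then show ?thesis using Q(2) \<open>i < Suc d\<close> by simp
    qed
  qed
  show ?case
  proof (cases d)
    case 0
    have mi: "ideal m R" using max maximalideal.axioms(1) by blast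
    have "P \<subseteq> m" using R.proper_ideal_subset_local[OF noeth loc Pi] primeideal.I_notcarr[OF P(1)] by blast
    then have "?I' \<subseteq> m" using x(1) q_subset_m by (intro R.genideal_minimal[OF mi]) blast
    moreover have "primeideal m R" using R.maximalideal_prime[OF max] .
    ultimately show ?thesis by (intro extend[of "\<lambda>_. m"]) (simp_all add: 0)
  next
    case (Suc d')
    have "\<not> growth_le d' (?L ?I')"
    proof
      assume "growth_le d' (?L ?I')"
      from growth_le_sum[where f = "?L P", OF this rec] show False using P(3) Suc by blast
    qed
    from less.IH[OF _ I'(1) this] obtain Q where
      "\<forall>i\<le>d. primeideal (Q i) R \<and> ?I' \<subseteq> Q i" "\<forall>i<d. Q i \<subset> Q (Suc i)" unfolding Suc by blast
    then show ?thesis by (rule extend)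
  qed
qed

lemma annihilator_ideal: "ideal (annihilator R M) R"
proof -
  have "annihilator R M = {a \<in> carrier R. \<forall>x\<in>carrier M. a \<odot>\<^sub>M x \<in> {\<zero>\<^sub>M}}"
    by (auto simp: annihilator_def)
  also have "\<dots> = \<Inter>(insert (carrier R) ((\<lambda>x. {a \<in> carrier R. a \<odot>\<^sub>M x \<in> {\<zero>\<^sub>M}}) ` carrier M))"
    by auto
  finally have e: "annihilator R M = \<dots>" .
  show ?thesis
    unfolding e using scalar_ideal[OF sub_zeroM] R.oneideal by (intro R.i_Intersect) auto
qed

lemma growth_le_dim:
  assumes "\<not> growth_le d (hilbert_samuel {\<zero>\<^sub>M})"
  shows "enat (Suc d) \<le> module_dim R M"
proof -
  let ?I = "annihilator R M"
  have "?I \<star> carrier M \<subseteq> {\<zero>\<^sub>M}"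
    by (rule mult_least[OF sub_zeroM]) (simp add: annihilator_def)
  moreover have "sub (?I \<star> carrier M)"
    by (intro sub_mult order_refl) (auto simp: annihilator_def)
  ultimately have "?I \<star> carrier M = {\<zero>\<^sub>M}" using sub_zero by blast
  then obtain P where P: "\<forall>i\<le>Suc d. primeideal (P i) R \<and> ?I \<subseteq> P i" "\<forall>i<Suc d. P i \<subset> P (Suc i)"
    using growth_imp_prime_chain[OF annihilator_ideal, of d] assms by auto
  show ?thesis
    unfolding module_dim_def
    by (rule R.krull_dim_quotient_ge[OF annihilator_ideal, of "Suc d" P]) (use P in simp_all)
qed

end

section \<open>Superficial elements\<close>

lemma decreasing_eventually_const:
  fixes f :: "nat \<Rightarrow> nat"
  assumes "\<And>n. c \<le> n \<Longrightarrow> f (Suc n) \<le> f n"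
  shows "\<exists>n0\<ge>c. \<forall>n\<ge>n0. f n = f n0"
proof -
  obtain n0 where n0: "c \<le> n0" "\<And>n. c \<le> n \<Longrightarrow> f n0 \<le> f n"
    using ex_has_least_nat[of "\<lambda>n. c \<le> n" c f] by auto
  have "f n \<le> f n0" if "n0 \<le> n" for n
    using that
  proof (induction n rule: dec_induct)
    case (step n)
    then show ?case using assms[of n] n0(1) by simp
  qed simp
  then have "f n = f n0" if "n0 \<le> n" for n
    using n0(2)[of n] n0(1) that by (simp add: antisym)
  then show ?thesis using n0(1) by blast
qed

context filtered_module
begin

lemma hilbert_samuel_mono: "sub N \<Longrightarrow> mono (hilbert_samuel N)"
proof (rule monoI)
  fix i j :: nat assume N: "sub N" and ij: "i \<le> j"
  have "qlen (carrier M) (F i <+>\<^sub>M N) \<le> qlen (carrier M) (F j <+>\<^sub>M N)"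
    using F_antimono[OF ij] submoduleE(1)[OF sub_sum[OF F_sub N]]
    by (intro qlen_antimono sub_carrierM sub_sum F_sub N sum_mono) auto
  then show "hilbert_samuel N i \<le> hilbert_samuel N j"
    by (simp flip: enat_hilbert_samuel[OF N])
qed

text \<open>
  Let \<open>K\<^sub>n\<close> be the preimage of \<open>F\<^sub>n\<^sub>+\<^sub>1 + N\<close> under multiplication by \<open>a\<close>. Multiplication by \<open>a\<close> gives the
  recurrence, with \<open>\<kappa> n\<close> the length of \<open>K\<^sub>n / (F\<^sub>n + N)\<close>. For \<open>n \<ge> c\<close> superficiality says that \<open>F\<^sub>n + N\<close> is
  \<open>K\<^sub>n \<inter> (F\<^sub>c + N)\<close>, so \<open>\<kappa> n\<close> is also the length of \<open>(K\<^sub>n + F\<^sub>c + N) / (F\<^sub>c + N)\<close>, which decreases with \<open>n\<close>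
  and hence becomes constant.
\<close>

lemma superficial_step:
  assumes N: "sub N" and a: "a \<in> q"
    and c: "\<And>n. c \<le> n \<Longrightarrow> colon M (F (Suc n) <+>\<^sub>M N) a \<inter> (F c <+>\<^sub>M N) = F n <+>\<^sub>M N"
  shows "\<exists>\<kappa> n0. (\<forall>n. hilbert_samuel N (Suc n) + \<kappa> n
        = hilbert_samuel ((\<lambda>x. a \<odot>\<^sub>M x) ` carrier M <+>\<^sub>M N) (Suc n) + hilbert_samuel N n)
      \<and> (\<forall>n\<ge>n0. \<kappa> n = (\<kappa> n0 :: nat))"
proof -
  have aR: "a \<in> carrier R" using a q_carrier by blast
  let ?aM = "(\<lambda>x. a \<odot>\<^sub>M x) ` carrier M"
  let ?N' = "?aM <+>\<^sub>M N"
  let ?X = "\<lambda>n. F n <+>\<^sub>M N"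
  let ?K = "\<lambda>n. colon M (?X (Suc n)) a"
  define \<kappa> where "\<kappa> n = the_enat (qlen (?K n) (?X n))" for n
  have aM: "sub ?aM" by (rule sub_scal[OF aR sub_carrierM])
  have N': "sub ?N'" by (rule sub_sum[OF aM N])
  have X: "sub (?X n)" for n by (rule sub_sum[OF F_sub N])
  have K: "sub (?K n)" for n by (rule sub_colon[OF X aR])
  have XK: "?X n \<subseteq> ?K n" for n
  proof (rule sum_least[OF K])
    show "F n \<subseteq> ?K n"
      using F_smult[OF a] F_carrier sum_upper1[OF F_sub N] by (fastforce simp: colon_def)
    show "N \<subseteq> ?K n"
      using sub_smult[OF N aR] sub_carrier[OF N] sum_upper2[OF F_sub N] by (fastforce simp: colon_def)
  qed
  have split: "qlen (carrier M) (?X n) = qlen (carrier M) (?K n) + qlen (?K n) (?X n)" for n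
    by (rule qlen_add[OF sub_carrierM K X XK submoduleE(1)[OF K]])
  have kfin: "enat (\<kappa> n) = qlen (?K n) (?X n)" "qlen (carrier M) (?K n) \<noteq> \<infinity>" for n
    using qlen_F_sum_finite[OF N, of n] unfolding split
    by (auto simp: \<kappa>_def plus_eq_infty_iff_enat simp del: not_infinity_eq)
  have rec: "hilbert_samuel N (Suc n) + \<kappa> n = hilbert_samuel ?N' (Suc n) + hilbert_samuel N n" for n
  proof -
    have e: "?aM <+>\<^sub>M ?X (Suc n) = F (Suc n) <+>\<^sub>M ?N'"
      using sum_assoc[OF aM F_sub N] sum_assoc[OF F_sub aM N] sum_commute[OF aM F_sub] by simp
    have "qlen (carrier M) (?X (Suc n))
        = qlen (carrier M) (?aM <+>\<^sub>M ?X (Suc n)) + qlen (?aM <+>\<^sub>M ?X (Suc n)) (?X (Suc n))"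
      by (intro qlen_add sub_carrierM sub_sum[OF aM X] X sum_upper2[OF aM X] submoduleE(1))
    also have "qlen (?aM <+>\<^sub>M ?X (Suc n)) (?X (Suc n)) = qlen (carrier M) (carrier M \<inter> ?K n)"
      by (rule qlen_scal[OF sub_carrierM X aR])
    also have "carrier M \<inter> ?K n = ?K n" using submoduleE(1)[OF K] by blast
    finally have 1: "enat (hilbert_samuel N (Suc n)) = enat (hilbert_samuel ?N' (Suc n)) + qlen (carrier M) (?K n)"
      unfolding enat_hilbert_samuel[OF N] enat_hilbert_samuel[OF N'] e .
    have 2: "enat (hilbert_samuel N n) = qlen (carrier M) (?K n) + enat (\<kappa> n)"
      unfolding enat_hilbert_samuel[OF N] kfin(1) by (rule split)
    obtain k where "qlen (carrier M) (?K n) = enat k" using kfin(2)[of n] by auto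
    then show ?thesis using 1 2 by simp
  qed
  have "\<kappa> (Suc n) \<le> \<kappa> n" if n: "c \<le> n" for n
  proof -
    have e: "qlen (?K n) (?X n) = qlen (?K n <+>\<^sub>M ?X c) (?X c)" if "c \<le> n" for n
      using qlen_diamond[OF K X, of n c] c[OF that] by simp
    have "?K (Suc n) \<subseteq> ?K n"
      using sum_mono[OF F_Suc order_refl, of "Suc n" N] by (auto simp: colon_def)
    then have "?K (Suc n) <+>\<^sub>M ?X c \<subseteq> ?K n <+>\<^sub>M ?X c" by (rule sum_mono) simp
    then have "enat (\<kappa> (Suc n)) \<le> enat (\<kappa> n)"
      unfolding kfin e[OF n] e[OF le_SucI[OF n]]
      by (rule qlen_mono[OF sub_sum[OF K X] sub_sum[OF K X] X _ sum_upper2[OF K X]])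
    then show ?thesis by simp
  qed
  from decreasing_eventually_const[of c \<kappa>, OF this] show ?thesis using rec by blast
qed

text \<open>
  If the lengths are bounded, \<open>F\<^sub>n + N\<close> is eventually constant, so \<open>F\<^sub>n + N = q F\<^sub>n + N\<close> for large \<open>n\<close> and
  Nakayama's lemma applies.
\<close>

lemma bounded_imp_eventually_contained:
  assumes N: "sub N" and bounded: "growth_le 0 (hilbert_samuel N)"
  shows "\<exists>n0. \<forall>n\<ge>n0. F n \<subseteq> N"
proof -
  obtain C where C: "\<And>n. hilbert_samuel N n \<le> C" using bounded by (auto simp: growth_le_def)
  have "\<exists>n0\<ge>0. \<forall>n\<ge>n0. C - hilbert_samuel N n = C - hilbert_samuel N n0"
    by (rule decreasing_eventually_const) (meson diff_le_mono2 hilbert_samuel_mono[OF N] monoD le_SucI order_refl)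
  then obtain n0 where n0: "\<And>n. n0 \<le> n \<Longrightarrow> C - hilbert_samuel N n = C - hilbert_samuel N n0" by blast
  have const: "hilbert_samuel N n = hilbert_samuel N n0" if "n0 \<le> n" for n
    using n0[OF that] C[of n] C[of n0] by linarith
  obtain n1 where n1: "\<And>n. n1 \<le> n \<Longrightarrow> F (Suc n) = q \<star> F n"
    using good by (auto simp: good_filtration_def)
  obtain S where S: "finite S" "S \<subseteq> carrier M" "carrier M = span S"
    using fin_gen by (auto simp: fin_gen_module_def)
  have "F n \<subseteq> N" if n: "max n0 n1 \<le> n" for n
  proof -
    have X: "sub (F k <+>\<^sub>M N)" for k by (rule sub_sum[OF F_sub N])
    have le: "F (Suc n) <+>\<^sub>M N \<subseteq> F n <+>\<^sub>M N" by (rule sum_mono[OF F_Suc order_refl])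
    have "hilbert_samuel N (Suc n) = hilbert_samuel N n" using const[of n] const[of "Suc n"] n by simp
    then have "qlen (carrier M) (F (Suc n) <+>\<^sub>M N) = qlen (carrier M) (F n <+>\<^sub>M N)"
      by (simp flip: enat_hilbert_samuel[OF N])
    moreover have "qlen (carrier M) (F (Suc n) <+>\<^sub>M N)
       = qlen (carrier M) (F n <+>\<^sub>M N) + qlen (F n <+>\<^sub>M N) (F (Suc n) <+>\<^sub>M N)"
      by (rule qlen_add[OF sub_carrierM X X le submoduleE(1)[OF X]])
    ultimately have "qlen (F n <+>\<^sub>M N) (F (Suc n) <+>\<^sub>M N) = 0"
      using qlen_F_sum_finite[OF N, of n]
      by (cases "qlen (carrier M) (F n <+>\<^sub>M N)"; cases "qlen (F n <+>\<^sub>M N) (F (Suc n) <+>\<^sub>M N)")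
         (auto simp: zero_enat_def)
    then have eq: "F n <+>\<^sub>M N = F (Suc n) <+>\<^sub>M N" using qlen_eq_0_iff[OF X X le] by blast
    have "F n \<subseteq> span S" using F_carrier S(3) by simp
    from submodule_fin_gen[OF noeth S(1,2) F_sub this]
    obtain T where T: "finite T" "T \<subseteq> F n" "F n = span T" by (elim exE conjE)
    have TM: "T \<subseteq> carrier M" using T(2) F_carrier by blast
    have TNM: "T \<union> N \<subseteq> carrier M" using TM submoduleE(1)[OF N] by blast
    have "T \<subseteq> F n <+>\<^sub>M N" using T(2) sum_upper1[OF F_sub N] by blast
    also have "\<dots> = q \<star> F n <+>\<^sub>M N" using eq n1[of n] n by simp
    also have "\<dots> \<subseteq> q \<star> (span (T \<union> N)) <+>\<^sub>M N"
    proof (intro sum_mono mult_mono order_refl q_carrier submoduleE(1)[OF sub_span[OF TNM]])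
      show "F n \<subseteq> span (T \<union> N)"
        unfolding T(3) using span_upper[of "T \<union> N"] by (intro span_least sub_span TNM) blast
    qed
    finally have TT: "T \<subseteq> q \<star> (span (T \<union> N)) <+>\<^sub>M N" .
    have "T \<subseteq> N" by (rule nakayama[OF noeth max loc q_ideal q_subset_m N T(1) TM TT])
    then show ?thesis unfolding T(3) by (rule span_least[OF N])
  qed
  then show ?thesis by blast
qed

end

locale superficial_reduction = filtered_module +
  fixes as :: "'a list"
  assumes max_superficial: "maximal_superficial_sequence R M q F as"
begin

abbreviation J where "J \<equiv> Idl\<^bsub>R\<^esub> (set as)"

text \<open>
  The submodule \<open>(a\<^sub>1, \<dots>, a\<^sub>i) M\<close>, with which the induced filtrations of a superficial sequence are
  formed.
\<close>

definition initial_submodule :: "nat \<Rightarrow> 'c set" where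
  "initial_submodule i = (set (take i as)) \<star> carrier M"

lemma as_subset_q: "set as \<subseteq> q"
proof
  fix a assume "a \<in> set as"
  then obtain i where "i < length as" "a = as ! i" by (auto simp: in_set_conv_nth)
  then show "a \<in> q"
    using max_superficial
    by (auto simp: maximal_superficial_sequence_def superficial_sequence_def superficial_def Let_def)
qed

lemma as_carrier: "set as \<subseteq> carrier R"
  using as_subset_q q_carrier by blast

lemma take_carrier: "set (take i as) \<subseteq> carrier R"
  using as_carrier set_take_subset by fast

lemma gen_mult_take: "gen_mult R M (take i as) = initial_submodule i"
  unfolding initial_submodule_def by (rule mult_Idl[OF take_carrier sub_carrierM])

lemma sub_initial_submodule: "sub (initial_submodule i)"
  unfolding initial_submodule_def by (intro sub_mult take_carrier order_refl)

lemma initial_submodule_0: "initial_submodule 0 = {\<zero>\<^sub>M}"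
  by (simp add: initial_submodule_def mult_empty)

lemma initial_submodule_Suc:
  assumes "i < length as"
  shows "initial_submodule (Suc i) = (\<lambda>x. as ! i \<odot>\<^sub>M x) ` carrier M <+>\<^sub>M initial_submodule i"
proof -
  have "set (take (Suc i) as) = insert (as ! i) (set (take i as))"
    using assms by (simp add: take_Suc_conv_app_nth)
  moreover have "as ! i \<in> carrier R" using as_carrier assms by auto
  ultimately show ?thesis
    unfolding initial_submodule_def using mult_insert[OF _ take_carrier sub_carrierM] by simp
qed

lemma as_nonempty: "0 < length as"
  using max_superficial by (simp add: maximal_superficial_sequence_def)

lemma eventually_contained: "\<exists>n0. \<forall>n\<ge>n0. F n \<subseteq> initial_submodule (length as)"
proof -
  have "nilpotent_filtration (quot_module M (gen_mult R M as)) (quot_filtration M F (gen_mult R M as))"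
    using max_superficial by (simp add: maximal_superficial_sequence_def Let_def)
  then show ?thesis
    using gen_mult_take[of "length as"] nilpotent_quot_iff[OF sub_initial_submodule F_sub] by simp
qed

lemma not_eventually_contained: "\<not> (\<exists>n0. \<forall>n\<ge>n0. F n \<subseteq> initial_submodule (length as - 1))"
proof -
  have "\<not> nilpotent_filtration (quot_module M (gen_mult R M (butlast as))) (quot_filtration M F (gen_mult R M (butlast as)))"
    using max_superficial by (simp add: maximal_superficial_sequence_def Let_def)
  then show ?thesis
    using gen_mult_take[of "length as - 1"] nilpotent_quot_iff[OF sub_initial_submodule F_sub]
    by (simp add: butlast_conv_take)
qed

lemma hilbert_samuel_recurrence:
  assumes i: "i < length as"
  shows "\<exists>\<kappa> n0. (\<forall>n. hilbert_samuel (initial_submodule i) (Suc n) + \<kappa> n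
        = hilbert_samuel (initial_submodule (Suc i)) (Suc n) + hilbert_samuel (initial_submodule i) n)
      \<and> (\<forall>n\<ge>n0. \<kappa> n = (\<kappa> n0 :: nat))"
proof -
  have "superficial (quot_module M (gen_mult R M (take i as))) q (quot_filtration M F (gen_mult R M (take i as))) (as ! i)"
    using max_superficial i by (simp add: maximal_superficial_sequence_def superficial_sequence_def Let_def)
  then obtain c where a: "as ! i \<in> q" and c: "\<And>n. c \<le> n \<Longrightarrow>
      colon M (F (Suc n) <+>\<^sub>M initial_submodule i) (as ! i) \<inter> (F c <+>\<^sub>M initial_submodule i) = F n <+>\<^sub>M initial_submodule i"
    unfolding gen_mult_take superficial_quot_iff[OF sub_initial_submodule F_sub q_carrier] by blast
  show ?thesis
    unfolding initial_submodule_Suc[OF i] by (rule superficial_step[OF sub_initial_submodule a c])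
qed

text \<open>
  Downward induction along the sequence. The argument is shifted to \<open>n + 1\<close>, as the difference of the
  series at \<open>n\<close> is then the length of \<open>F\<^sub>n / F\<^sub>n\<^sub>+\<^sub>1\<close>.
\<close>

lemma hilbert_samuel_pole:
  "j \<le> length as \<Longrightarrow> pole_le (Suc j) (Abs_fps (\<lambda>n. int (hilbert_samuel (initial_submodule (length as - j)) (Suc n))))"
proof (induction j)
  case 0
  obtain n0 where n0: "\<And>n. n0 \<le> n \<Longrightarrow> F n \<subseteq> initial_submodule (length as)" using eventually_contained by blast
  have "hilbert_samuel (initial_submodule (length as)) (Suc n) = hilbert_samuel (initial_submodule (length as)) (Suc n0)"
    if "n0 \<le> n" for n
  proof -
    have "F (Suc k) <+>\<^sub>M initial_submodule (length as) = initial_submodule (length as)" if "n0 \<le> k" for k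
      by (rule sum_absorb2[OF F_sub sub_initial_submodule n0]) (use that in simp)
    then show ?thesis using that by (simp add: hilbert_samuel_def)
  qed
  then have "pole_le 1 (Abs_fps (\<lambda>n. int (hilbert_samuel (initial_submodule (length as)) (Suc n))))"
    by (intro pole_le_eventually_const[of n0] arg_cong[of _ _ int])
  then show ?case by simp
next
  case (Suc j)
  let ?i = "length as - Suc j"
  have i: "?i < length as" "Suc ?i = length as - j" using Suc.prems by auto
  obtain \<kappa> :: "nat \<Rightarrow> nat" and n0 where \<kappa>: "\<And>n. hilbert_samuel (initial_submodule ?i) (Suc n) + \<kappa> n
        = hilbert_samuel (initial_submodule (Suc ?i)) (Suc n) + hilbert_samuel (initial_submodule ?i) n"
      and const: "\<And>n. n0 \<le> n \<Longrightarrow> \<kappa> n = \<kappa> n0"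
    using hilbert_samuel_recurrence[OF i(1)] by blast
  show ?case
  proof (rule pole_le_recurrence)
    show "pole_le (Suc j) (Abs_fps (\<lambda>n. int (hilbert_samuel (initial_submodule (Suc ?i)) (Suc n))))"
      unfolding i(2) using Suc by simp
    show "int (hilbert_samuel (initial_submodule ?i) (Suc (Suc n))) - int (hilbert_samuel (initial_submodule ?i) (Suc n))
       = int (hilbert_samuel (initial_submodule (Suc ?i)) (Suc (Suc n))) - int (\<kappa> (Suc n))" for n
      using \<kappa>[of "Suc n"] by linarith
    show "int (\<kappa> (Suc n)) = int (\<kappa> (Suc n0))" if "n0 \<le> n" for n
      using const[of "Suc n"] const[of "Suc n0"] that by simp
  qed
qed

text \<open>
  Each step back along the sequence adds at least one degree of growth; the start is the failure of
  nilpotency before the last element.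
\<close>

lemma hilbert_samuel_growth:
  "j < length as \<Longrightarrow> \<not> growth_le j (hilbert_samuel (initial_submodule (length as - Suc j)))"
proof (induction j)
  case 0
  show ?case
  proof
    assume "growth_le 0 (hilbert_samuel (initial_submodule (length as - Suc 0)))"
    from bounded_imp_eventually_contained[OF sub_initial_submodule this]
    show False using not_eventually_contained unfolding One_nat_def by (rule notE[rotated])
  qed
next
  case (Suc j)
  let ?i = "length as - Suc (Suc j)"
  have i: "?i < length as" "Suc ?i = length as - Suc j" using Suc.prems by auto
  obtain \<kappa> :: "nat \<Rightarrow> nat" and n0 where \<kappa>: "\<And>n. hilbert_samuel (initial_submodule ?i) (Suc n) + \<kappa> n
        = hilbert_samuel (initial_submodule (Suc ?i)) (Suc n) + hilbert_samuel (initial_submodule ?i) n"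
      and const: "\<And>n. n0 \<le> n \<Longrightarrow> \<kappa> n = \<kappa> n0"
    using hilbert_samuel_recurrence[OF i(1)] by blast
  \<comment> \<open>A bound for an eventually constant sequence: it takes no values beyond index \<open>n0\<close> that are new.\<close>
  define C where "C = (\<Sum>k\<le>n0. \<kappa> k)"
  have C: "\<kappa> n \<le> C" for n
  proof -
    have "\<kappa> n = \<kappa> (min n n0)"
    proof (cases "n0 \<le> n")
      case True
      then show ?thesis using const[OF True] by (simp add: min_absorb2)
    qed (simp add: min_absorb1)
    also have "\<dots> \<le> C" unfolding C_def by (rule member_le_sum) auto
    finally show ?thesis .
  qed
  show ?case
  proof
    assume g: "growth_le (Suc j) (hilbert_samuel (initial_submodule ?i))"
    have "growth_le j (hilbert_samuel (initial_submodule (Suc ?i)))"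
    proof (rule growth_le_difference[OF g hilbert_samuel_mono[OF sub_initial_submodule]])
      show "hilbert_samuel (initial_submodule ?i) n + hilbert_samuel (initial_submodule (Suc ?i)) (Suc n)
          \<le> hilbert_samuel (initial_submodule ?i) (Suc n) + C" for n
        using \<kappa>[of n] C[of n] by linarith
    qed
    then show False using Suc i(2) by simp
  qed
qed

lemma length_le_dim: "enat (length as) \<le> module_dim R M"
  using growth_le_dim[of "length as - 1"] hilbert_samuel_growth[of "length as - 1"] as_nonempty
  by (simp add: initial_submodule_0)

lemma pole_hilbert_samuel: "pole_le (Suc (length as)) (Abs_fps (\<lambda>n. int (hilbert_samuel {\<zero>\<^sub>M} (Suc n))))"
  using hilbert_samuel_pole[of "length as"] by (simp add: initial_submodule_0)

lemma qlen_mod_J_finite: "qlen (carrier M) (set as \<star> carrier M) \<noteq> \<infinity>"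
proof -
  obtain n where n: "F n \<subseteq> initial_submodule (length as)" using eventually_contained by blast
  have e: "initial_submodule (length as) = set as \<star> carrier M" by (simp add: initial_submodule_def)
  have "qlen (carrier M) (initial_submodule (length as)) \<le> qlen (carrier M) (F n)"
    by (rule qlen_antimono[OF sub_carrierM F_sub sub_initial_submodule n submoduleE(1)[OF sub_initial_submodule]])
  then show ?thesis unfolding e by (rule enat_finite_le[OF _ qlen_F_finite])
qed

end

section \<open>Monomials\<close>

text \<open>
  Any total order on the monomials of a given degree that is compatible with multiplication would do.
\<close>

fun lex_less :: "nat list \<Rightarrow> nat list \<Rightarrow> bool" where
  "lex_less (a # \<alpha>) (b # \<beta>) \<longleftrightarrow> a < b \<or> (a = b \<and> lex_less \<alpha> \<beta>)"
| "lex_less _ _ \<longleftrightarrow> False"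

lemma lex_less_irrefl: "\<not> lex_less \<alpha> \<alpha>"
  by (induction \<alpha>) auto

lemma lex_less_trans: "lex_less \<alpha> \<beta> \<Longrightarrow> lex_less \<beta> \<gamma> \<Longrightarrow> lex_less \<alpha> \<gamma>"
proof (induction \<alpha> \<beta> arbitrary: \<gamma> rule: lex_less.induct)
  case (1 a \<alpha> b \<beta>)
  then show ?case by (cases \<gamma>) auto
qed auto

lemma lex_less_total: "length \<alpha> = length \<beta> \<Longrightarrow> \<alpha> = \<beta> \<or> lex_less \<alpha> \<beta> \<or> lex_less \<beta> \<alpha>"
  by (induction \<alpha> \<beta> rule: list_induct2) auto

lemma lex_less_translate:
  "length \<gamma> = length \<alpha> \<Longrightarrow> lex_less \<alpha> \<beta> \<Longrightarrow> lex_less (map2 (+) \<alpha> \<gamma>) (map2 (+) \<beta> \<gamma>)"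
proof (induction \<alpha> \<beta> arbitrary: \<gamma> rule: lex_less.induct)
  case (1 a \<alpha> b \<beta>)
  then show ?case by (cases \<gamma>) auto
qed auto

lemma lex_minimum:
  assumes "finite U" "U \<noteq> {}" "\<And>\<alpha>. \<alpha> \<in> U \<Longrightarrow> length \<alpha> = t"
  shows "\<exists>\<alpha>\<in>U. \<forall>\<beta>\<in>U. \<beta> \<noteq> \<alpha> \<longrightarrow> lex_less \<alpha> \<beta>"
  using assms
proof (induction U rule: finite_ne_induct)
  case (insert \<gamma> U)
  then obtain \<alpha> where \<alpha>: "\<alpha> \<in> U" "\<forall>\<beta>\<in>U. \<beta> \<noteq> \<alpha> \<longrightarrow> lex_less \<alpha> \<beta>" by auto
  have ne: "\<gamma> \<noteq> \<alpha>" using \<alpha>(1) insert.hyps by blast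
  have "length \<gamma> = length \<alpha>" using insert.prems \<alpha>(1) by simp
  then consider "lex_less \<gamma> \<alpha>" | "lex_less \<alpha> \<gamma>" using lex_less_total ne by blast
  then show ?case
  proof cases
    case 1
    have "lex_less \<gamma> \<beta>" if "\<beta> \<in> U" for \<beta>
    proof (cases "\<beta> = \<alpha>")
      case False
      then have "lex_less \<alpha> \<beta>" using \<alpha>(2) that by simp
      then show ?thesis by (rule lex_less_trans[OF 1])
    qed (simp add: 1)
    then show ?thesis by (intro bexI[of _ \<gamma>]) auto
  next
    case 2
    then show ?thesis using \<alpha> by (intro bexI[of _ \<alpha>]) auto
  qed
qed simp

lemma sum_list_map2_add:
  "length \<alpha> = length \<gamma> \<Longrightarrow> sum_list (map2 (+) \<alpha> \<gamma>) = sum_list \<alpha> + sum_list (\<gamma> :: nat list)"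
  by (induction \<alpha> \<gamma> rule: list_induct2) auto

lemma list_all2_le_imp_map2_add:
  "list_all2 (\<le>) \<alpha> \<beta> \<Longrightarrow> \<exists>\<gamma>. length \<gamma> = length \<alpha> \<and> \<beta> = map2 (+) \<alpha> (\<gamma> :: nat list)"
proof (induction rule: list_all2_induct)
  case (Cons a \<alpha> b \<beta>)
  then obtain \<gamma> where "length \<gamma> = length \<alpha>" "\<beta> = map2 (+) \<alpha> \<gamma>" by blast
  then show ?case using Cons.hyps(1) by (intro exI[of _ "(b - a) # \<gamma>"]) simp
qed simp

context cring
begin

fun monomial :: "'a list \<Rightarrow> nat list \<Rightarrow> 'a" where
  "monomial (a # as) (k # \<alpha>) = a [^] k \<otimes> monomial as \<alpha>"
| "monomial _ _ = \<one>"

lemma monomial_closed: "set as \<subseteq> carrier R \<Longrightarrow> monomial as \<alpha> \<in> carrier R"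
  by (induction as \<alpha> rule: monomial.induct) auto

lemma monomial_add:
  "set as \<subseteq> carrier R \<Longrightarrow> length \<alpha> = length as \<Longrightarrow> length \<gamma> = length as \<Longrightarrow>
   monomial as (map2 (+) \<alpha> \<gamma>) = monomial as \<alpha> \<otimes> monomial as \<gamma>"
proof (induction as arbitrary: \<alpha> \<gamma>)
  case (Cons a as)
  obtain k \<alpha>' l \<gamma>' where e: "\<alpha> = k # \<alpha>'" "\<gamma> = l # \<gamma>'" "length \<alpha>' = length as" "length \<gamma>' = length as"
    using Cons.prems(2,3) by (auto simp: length_Suc_conv)
  have a: "a \<in> carrier R" and as: "set as \<subseteq> carrier R" using Cons.prems(1) by auto
  have "monomial as (map2 (+) \<alpha>' \<gamma>') = monomial as \<alpha>' \<otimes> monomial as \<gamma>'" by (rule Cons.IH[OF as e(3,4)])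
  then show ?case
    using a monomial_closed[OF as, of \<alpha>'] monomial_closed[OF as, of \<gamma>']
    by (simp add: e nat_pow_mult[symmetric] m_ac)
qed simp

lemma monomial_increment:
  "set as \<subseteq> carrier R \<Longrightarrow> length \<alpha> = length as \<Longrightarrow> i < length as \<Longrightarrow>
   monomial as (\<alpha>[i := Suc (\<alpha> ! i)]) = as ! i \<otimes> monomial as \<alpha>"
proof (induction as arbitrary: \<alpha> i)
  case (Cons a as)
  obtain k \<alpha>' where e: "\<alpha> = k # \<alpha>'" "length \<alpha>' = length as"
    using Cons.prems(2) by (auto simp: length_Suc_conv)
  have a: "a \<in> carrier R" and as: "set as \<subseteq> carrier R" using Cons.prems(1) by auto
  note c = monomial_closed[OF as, of \<alpha>']
  show ?case
  proof (cases i)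
    case 0
    then show ?thesis using a c by (simp add: e m_ac)
  next
    case (Suc j)
    have j: "j < length as" using Suc Cons.prems(3) by simp
    have "as ! j \<in> carrier R" using as j by auto
    then show ?thesis using Cons.IH[OF as e(2) j] a c by (simp add: Suc e m_lcomm)
  qed
qed simp

end

lemma multi_idx_increment:
  "\<alpha> \<in> multi_idx t n \<Longrightarrow> i < t \<Longrightarrow> \<alpha>[i := Suc (\<alpha> ! i)] \<in> multi_idx t (Suc n)"
proof -
  have "i < length \<alpha> \<Longrightarrow> sum_list (\<alpha>[i := Suc (\<alpha> ! i)]) = Suc (sum_list \<alpha>)"
    by (induction \<alpha> arbitrary: i) (auto split: nat.split simp: nth_Cons')
  then show "\<alpha> \<in> multi_idx t n \<Longrightarrow> i < t \<Longrightarrow> \<alpha>[i := Suc (\<alpha> ! i)] \<in> multi_idx t (Suc n)"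
    by (auto simp: multi_idx_def)
qed

lemma multi_idx_decrement:
  assumes "\<beta> \<in> multi_idx t (Suc n)"
  shows "\<exists>i<t. \<exists>\<alpha>\<in>multi_idx t n. \<beta> = \<alpha>[i := Suc (\<alpha> ! i)]"
proof -
  have len: "length \<beta> = t" and sum: "sum_list \<beta> = Suc n" using assms by (auto simp: multi_idx_def)
  obtain i where i: "i < t" "\<beta> ! i \<noteq> 0"
  proof -
    have "\<exists>x\<in>set \<beta>. x \<noteq> 0" using sum by (metis sum_list_eq_0_iff nat.distinct(1))
    then show ?thesis using that len by (auto simp: in_set_conv_nth)
  qed
  let ?\<alpha> = "\<beta>[i := \<beta> ! i - 1]"
  have e: "\<beta> = ?\<alpha>[i := Suc (?\<alpha> ! i)]" using i len by (simp add: list_update_same_conv)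
  have "sum_list ?\<alpha> = n"
  proof -
    have "?\<alpha> \<in> multi_idx t (sum_list ?\<alpha>)" using len by (simp add: multi_idx_def)
    from multi_idx_increment[OF this i(1)] have "sum_list \<beta> = Suc (sum_list ?\<alpha>)"
      unfolding e[symmetric] by (simp add: multi_idx_def)
    then show ?thesis using sum by simp
  qed
  then have "?\<alpha> \<in> multi_idx t n" using len by (simp add: multi_idx_def)
  then show ?thesis using e i(1) by blast
qed

lemma card_multi_idx_le:
  assumes "t \<le> Suc k" "i \<le> n" "0 < t"
  shows "card (multi_idx t i) \<le> (n + k) choose k"
proof -
  have "card (multi_idx t i) = (i + t - 1) choose i"
    unfolding multi_idx_def by (rule card_length_sum_list)
  also have "\<dots> \<le> (i + k) choose i" using assms by (intro binomial_right_mono) simp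
  also have "\<dots> = (i + k) choose k" using binomial_symmetric[of i "i + k"] by simp
  also have "\<dots> \<le> (n + k) choose k" using assms(2) by (intro binomial_right_mono) simp
  finally show ?thesis .
qed

context module
begin

lemma mult_mult:
  assumes B: "B \<subseteq> carrier R" and C: "C \<subseteq> carrier R" and X: "sub X"
  shows "B \<star> (C \<star> X) = {b \<otimes> c | b c. b \<in> B \<and> c \<in> C} \<star> X"
    (is "?L = ?R")
proof
  have XM: "X \<subseteq> carrier M" by (rule submoduleE(1)[OF X])
  have BC: "{b \<otimes> c | b c. b \<in> B \<and> c \<in> C} \<subseteq> carrier R" using B C by auto
  have R: "sub ?R" by (rule sub_mult[OF BC XM])
  have CX: "sub (C \<star> X)" by (rule sub_mult[OF C XM])
  have L: "sub ?L" by (rule sub_mult[OF B submoduleE(1)[OF CX]])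
  show "?L \<subseteq> ?R"
  proof (rule mult_least[OF R])
    fix b y assume b: "b \<in> B" and y: "y \<in> C \<star> X"
    have bR: "b \<in> carrier R" using b B by blast
    have "C \<star> X \<subseteq> colon M ?R b"
    proof (rule mult_least[OF sub_colon[OF R bR]])
      fix c x assume c: "c \<in> C" and x: "x \<in> X"
      have cR: "c \<in> carrier R" and xM: "x \<in> carrier M" using c C x XM by blast+
      have "(b \<otimes> c) \<odot>\<^sub>M x \<in> ?R" using b c x by (intro mult_upper) blast+
      then show "c \<odot>\<^sub>M x \<in> colon M ?R b" using bR cR xM by (simp add: colon_def smult_assoc1)
    qed
    then show "b \<odot>\<^sub>M y \<in> ?R" using y by (auto simp: colon_def)
  qed
  show "?R \<subseteq> ?L"
  proof (rule mult_least[OF L])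
    fix d x assume "d \<in> {b \<otimes> c | b c. b \<in> B \<and> c \<in> C}" and x: "x \<in> X"
    then obtain b c where d: "d = b \<otimes> c" "b \<in> B" "c \<in> C" by blast
    have "b \<in> carrier R" "c \<in> carrier R" "x \<in> carrier M" using d B C x XM by blast+
    then have "d \<odot>\<^sub>M x = b \<odot>\<^sub>M (c \<odot>\<^sub>M x)" using d(1) by (simp add: smult_assoc1)
    then show "d \<odot>\<^sub>M x \<in> ?L" using d x by (simp add: mult_upper)
  qed
qed

lemma mult_one: "sub X \<Longrightarrow> {\<one>} \<star> X = X"
proof
  assume X: "sub X"
  show "{\<one>} \<star> X \<subseteq> X" by (rule mult_subset[OF X]) simp
  show "X \<subseteq> {\<one>} \<star> X"
  proof
    fix x assume x: "x \<in> X"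
    have "\<one> \<odot>\<^sub>M x \<in> {\<one>} \<star> X" using x by (intro mult_upper) simp_all
    then show "x \<in> {\<one>} \<star> X" using sub_carrier[OF X x] by simp
  qed
qed

definition monomials :: "'a list \<Rightarrow> nat \<Rightarrow> 'a set" where
  "monomials as n = R.monomial as ` multi_idx (length as) n"

lemma monomials_carrier: "set as \<subseteq> carrier R \<Longrightarrow> monomials as n \<subseteq> carrier R"
  using R.monomial_closed by (auto simp: monomials_def)

lemma finite_monomials: "finite (monomials as n)"
  by (simp add: monomials_def)

lemma card_monomials: "card (monomials as n) \<le> card (multi_idx (length as) n)"
  unfolding monomials_def by (rule card_image_le) simp

lemma monomials_0: "monomials as 0 \<star> X = X" if "sub X" "set as \<subseteq> carrier R"
proof -
  have "multi_idx t 0 = {replicate t 0}" for t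
    by (auto simp: multi_idx_def intro!: replicate_eqI)
  moreover have "R.monomial as (replicate (length as) 0) = \<one>"
    using that(2) by (induction as) auto
  ultimately have "monomials as 0 = {\<one>}" by (simp add: monomials_def)
  then show ?thesis using mult_one[OF that(1)] by simp
qed

lemma monomials_Suc:
  assumes as: "set as \<subseteq> carrier R" and X: "sub X"
  shows "set as \<star> (monomials as n \<star> X) = monomials as (Suc n) \<star> X"
    and "monomials as n \<star> (set as \<star> X) = monomials as (Suc n) \<star> X"
proof -
  let ?t = "length as"
  have "{b \<otimes> c | b c. b \<in> set as \<and> c \<in> monomials as n} = monomials as (Suc n)"
  proof (intro equalityI subsetI)
    fix d assume "d \<in> {b \<otimes> c | b c. b \<in> set as \<and> c \<in> monomials as n}"
    then obtain i \<alpha> where i: "i < ?t" and \<alpha>: "\<alpha> \<in> multi_idx ?t n" and d: "d = as ! i \<otimes> R.monomial as \<alpha>"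
      by (auto simp: monomials_def in_set_conv_nth)
    have "d = R.monomial as (\<alpha>[i := Suc (\<alpha> ! i)])"
      unfolding d using R.monomial_increment[OF as _ i, of \<alpha>] \<alpha> by (simp add: multi_idx_def)
    then show "d \<in> monomials as (Suc n)" unfolding monomials_def using multi_idx_increment[OF \<alpha> i] by blast
  next
    fix d assume "d \<in> monomials as (Suc n)"
    then obtain \<beta> where "\<beta> \<in> multi_idx ?t (Suc n)" and d: "d = R.monomial as \<beta>" by (auto simp: monomials_def)
    from multi_idx_decrement[OF this(1)] obtain i \<alpha> where
      i: "i < ?t" and \<alpha>: "\<alpha> \<in> multi_idx ?t n" and \<beta>: "\<beta> = \<alpha>[i := Suc (\<alpha> ! i)]" by blast
    have "d = as ! i \<otimes> R.monomial as \<alpha>"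
      unfolding d \<beta> using R.monomial_increment[OF as _ i, of \<alpha>] \<alpha> by (simp add: multi_idx_def)
    moreover have "as ! i \<in> set as" using i by simp
    moreover have "R.monomial as \<alpha> \<in> monomials as n" using \<alpha> by (simp add: monomials_def)
    ultimately show "d \<in> {b \<otimes> c | b c. b \<in> set as \<and> c \<in> monomials as n}" by blast
  qed
  then show 1: "set as \<star> (monomials as n \<star> X) = monomials as (Suc n) \<star> X"
    using mult_mult[OF as monomials_carrier[OF as] X] by simp
  have "{b \<otimes> c | b c. b \<in> monomials as n \<and> c \<in> set as} = {b \<otimes> c | b c. b \<in> set as \<and> c \<in> monomials as n}"
    (is "?A = ?B")
  proof (intro equalityI subsetI)
    have comm: "b \<otimes> c = c \<otimes> b" if "b \<in> monomials as n" "c \<in> set as" for b c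
      using that monomials_carrier[OF as] as by (intro R.m_comm) blast+
    show "d \<in> ?B" if "d \<in> ?A" for d using that comm by blast
    show "d \<in> ?A" if d: "d \<in> ?B" for d
    proof -
      obtain b c where "d = b \<otimes> c" "b \<in> set as" "c \<in> monomials as n" using d by blast
      then have "d = c \<otimes> b" using comm[of c b] by simp
      then show ?thesis using \<open>b \<in> set as\<close> \<open>c \<in> monomials as n\<close> by blast
    qed
  qed
  then show "monomials as n \<star> (set as \<star> X) = monomials as (Suc n) \<star> X"
    using mult_mult[OF monomials_carrier[OF as] as X] mult_mult[OF as monomials_carrier[OF as] X] 1 by simp
qed

lemma mult_ideal_prod:
  assumes I: "ideal I R" and K: "ideal K R" and X: "sub X"
  shows "(ideal_prod R I K) \<star> X = I \<star> (K \<star> X)"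
proof -
  have IR: "I \<subseteq> carrier R" and KR: "K \<subseteq> carrier R" using ideal.Icarr[OF I] ideal.Icarr[OF K] by blast+
  have "I <#> K = {b \<otimes> c | b c. b \<in> I \<and> c \<in> K}" by (auto simp: set_mult_def)
  moreover have "I <#> K \<subseteq> carrier R" using IR KR by (auto simp: set_mult_def)
  ultimately show ?thesis
    using R.ideal_prod_eq_genideal[OF I K] mult_Idl[OF _ X] mult_mult[OF IR KR X] by simp
qed

text \<open>
  The induction is for all submodules \<open>X\<close> in place of \<open>M\<close>, because the powers are unfolded as
  \<open>J\<^sup>n\<^sup>+\<^sup>1 = J\<^sup>n J\<close> with the new factor next to the module.
\<close>

lemma adic_filtration_monomials:
  assumes as: "set as \<subseteq> carrier R"
  shows "adic_filtration R M (Idl (set as)) n = monomials as n \<star> carrier M"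
proof -
  let ?J = "Idl (set as)"
  have J: "ideal ?J R" by (rule R.genideal_ideal[OF as])
  have pow: "ideal (?J [^]\<^bsub>ideals_set R\<^esub> n) R" for n :: nat
  proof (induction n)
    case 0
    have "?J [^]\<^bsub>ideals_set R\<^esub> (0::nat) = carrier R" by (simp add: nat_pow_def ideals_set_def)
    then show ?case by (simp add: R.oneideal)
  next
    case (Suc n)
    have "?J [^]\<^bsub>ideals_set R\<^esub> Suc n = ideal_prod R (?J [^]\<^bsub>ideals_set R\<^esub> n) ?J"
      by (simp add: nat_pow_def ideals_set_def)
    then show ?case by (simp add: R.ideal_prod_is_ideal[OF Suc J])
  qed
  have "(?J [^]\<^bsub>ideals_set R\<^esub> n) \<star> X = monomials as n \<star> X" if "sub X" for X
    using that
  proof (induction n arbitrary: X)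
    case 0
    have "?J [^]\<^bsub>ideals_set R\<^esub> (0::nat) = Idl {\<one>}"
      by (simp add: nat_pow_def ideals_set_def R.genideal_one)
    then show ?case using mult_Idl[OF _ 0, of "{\<one>}"] mult_one[OF 0] monomials_0[OF 0 as] by simp
  next
    case (Suc n)
    have sX: "sub (set as \<star> X)" by (rule sub_mult[OF as submoduleE(1)[OF Suc.prems]])
    have "?J [^]\<^bsub>ideals_set R\<^esub> Suc n = ideal_prod R (?J [^]\<^bsub>ideals_set R\<^esub> n) ?J"
      by (simp add: nat_pow_def ideals_set_def)
    then show ?case
      using mult_ideal_prod[OF pow J Suc.prems, of n] mult_Idl[OF as Suc.prems] Suc.IH[OF sX]
        monomials_Suc(2)[OF as Suc.prems] by simp
  qed
  from this[OF sub_carrierM] show ?thesis unfolding adic_filtration_def .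
qed

section \<open>The Hilbert series of an adic filtration\<close>

text \<open>
  The exponents of the monomials that count as negligible next to the monomial with exponent \<open>\<alpha>\<close>:
  those of the same degree that come after \<open>\<alpha>\<close>, and all of the next degree. The latter generate
  \<open>J\<^sup>n\<^sup>+\<^sup>1 M\<close>.
\<close>

definition leading_indices :: "nat list \<Rightarrow> nat list set" where
  "leading_indices \<alpha> = {\<beta>. length \<beta> = length \<alpha> \<and>
     ((sum_list \<beta> = sum_list \<alpha> \<and> lex_less \<alpha> \<beta>) \<or> sum_list \<beta> = Suc (sum_list \<alpha>))}"

text \<open>
  The analogue of the ideal of leading coefficients: \<open>x\<close> belongs to it if \<open>a\<^sup>\<alpha> x\<close> can be rewritten with
  the later monomials modulo \<open>J\<^sup>n\<^sup>+\<^sup>1 M\<close>.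
\<close>

definition leading_submodule :: "'a list \<Rightarrow> nat list \<Rightarrow> 'c set" where
  "leading_submodule as \<alpha> =
     colon M ((R.monomial as ` leading_indices \<alpha>) \<star> carrier M) (R.monomial as \<alpha>)"

lemma leading_indices_translate:
  assumes "\<beta> \<in> leading_indices \<alpha>" "length \<gamma> = length \<alpha>"
  shows "map2 (+) \<beta> \<gamma> \<in> leading_indices (map2 (+) \<alpha> \<gamma>)"
  using assms lex_less_translate[OF assms(2), of \<beta>]
  by (auto simp: leading_indices_def sum_list_map2_add)

lemma monomial_image_carrier: "set as \<subseteq> carrier R \<Longrightarrow> R.monomial as ` U \<subseteq> carrier R"
  using R.monomial_closed by blast

lemma sub_leading_mult: "set as \<subseteq> carrier R \<Longrightarrow> sub ((R.monomial as ` U) \<star> carrier M)"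
  by (intro sub_mult monomial_image_carrier order_refl)

lemma sub_leading_submodule: "set as \<subseteq> carrier R \<Longrightarrow> sub (leading_submodule as \<alpha>)"
  unfolding leading_submodule_def by (intro sub_colon sub_leading_mult R.monomial_closed)

text \<open>
  Multiply a rewriting of \<open>a\<^sup>\<alpha> x\<close> by the monomial with exponent \<open>\<beta> - \<alpha>\<close>; the order is invariant under
  translation.
\<close>

lemma leading_submodule_mono:
  assumes as: "set as \<subseteq> carrier R" and len: "length \<alpha> = length as" and le: "list_all2 (\<le>) \<alpha> \<beta>"
  shows "leading_submodule as \<alpha> \<subseteq> leading_submodule as \<beta>"
proof
  obtain \<gamma> where \<gamma>: "length \<gamma> = length \<alpha>" "\<beta> = map2 (+) \<alpha> \<gamma>"
    using list_all2_le_imp_map2_add[OF le] by blast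
  have \<gamma>as: "length \<gamma> = length as" using \<gamma>(1) len by simp
  let ?N = "\<lambda>\<alpha>. (R.monomial as ` leading_indices \<alpha>) \<star> carrier M"
  note mc = R.monomial_closed[OF as]
  fix x assume "x \<in> leading_submodule as \<alpha>"
  then have x: "x \<in> carrier M" "R.monomial as \<alpha> \<odot>\<^sub>M x \<in> ?N \<alpha>"
    by (auto simp: leading_submodule_def colon_def)
  have "?N \<alpha> \<subseteq> colon M (?N \<beta>) (R.monomial as \<gamma>)"
  proof (rule mult_least[OF sub_colon[OF sub_leading_mult[OF as] mc]])
    fix b y assume "b \<in> R.monomial as ` leading_indices \<alpha>" and y: "y \<in> carrier M"
    then obtain \<delta> where \<delta>: "\<delta> \<in> leading_indices \<alpha>" "b = R.monomial as \<delta>" by blast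
    have lend: "length \<delta> = length as" using \<delta>(1) len by (simp add: leading_indices_def)
    have "R.monomial as (map2 (+) \<delta> \<gamma>) \<odot>\<^sub>M y \<in> ?N \<beta>"
      using leading_indices_translate[OF \<delta>(1) \<gamma>(1)] y unfolding \<gamma>(2) by (intro mult_upper) blast+
    then have "R.monomial as \<gamma> \<odot>\<^sub>M (b \<odot>\<^sub>M y) \<in> ?N \<beta>"
      unfolding R.monomial_add[OF as lend \<gamma>as] \<delta>(2)
      using mc y R.m_comm[of "R.monomial as \<delta>" "R.monomial as \<gamma>"] by (simp add: smult_assoc1)
    then show "b \<odot>\<^sub>M y \<in> colon M (?N \<beta>) (R.monomial as \<gamma>)"
      using mc y by (simp add: colon_def \<delta>(2))
  qed
  then have "R.monomial as \<gamma> \<odot>\<^sub>M (R.monomial as \<alpha> \<odot>\<^sub>M x) \<in> ?N \<beta>"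
    using x(2) by (auto simp: colon_def)
  moreover have "R.monomial as \<beta> \<odot>\<^sub>M x = R.monomial as \<gamma> \<odot>\<^sub>M (R.monomial as \<alpha> \<odot>\<^sub>M x)"
    unfolding \<gamma>(2) R.monomial_add[OF as len \<gamma>as]
    using mc x(1) R.m_comm[of "R.monomial as \<alpha>" "R.monomial as \<gamma>"] by (simp add: smult_assoc1)
  ultimately show "x \<in> leading_submodule as \<beta>" using x(1) by (simp add: leading_submodule_def colon_def)
qed

text \<open>
  This bounds the lengths of all pieces \<open>M / K\<^sub>\<alpha>\<close> by the one of \<open>M / J M\<close>.
\<close>

lemma mult_subset_leading_submodule:
  assumes as: "set as \<subseteq> carrier R" and len: "length \<alpha> = length as"
  shows "set as \<star> carrier M \<subseteq> leading_submodule as \<alpha>"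
proof (rule mult_least[OF sub_leading_submodule[OF as]])
  fix a x assume "a \<in> set as" and x: "x \<in> carrier M"
  then obtain i where i: "i < length as" "a = as ! i" by (auto simp: in_set_conv_nth)
  let ?\<beta> = "\<alpha>[i := Suc (\<alpha> ! i)]"
  note mc = R.monomial_closed[OF as]
  have aR: "a \<in> carrier R" using as \<open>a \<in> set as\<close> by blast
  have "?\<beta> \<in> leading_indices \<alpha>"
    using multi_idx_increment[of \<alpha> "length as" "sum_list \<alpha>" i] i(1) len
    by (simp add: leading_indices_def multi_idx_def)
  then have "R.monomial as ?\<beta> \<odot>\<^sub>M x \<in> (R.monomial as ` leading_indices \<alpha>) \<star> carrier M"
    using x by (intro mult_upper) blast+
  moreover have "R.monomial as \<alpha> \<odot>\<^sub>M (a \<odot>\<^sub>M x) = R.monomial as ?\<beta> \<odot>\<^sub>M x"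
    unfolding R.monomial_increment[OF as len i(1)] i(2)[symmetric]
    using mc aR x R.m_comm[of a "R.monomial as \<alpha>"] by (simp add: smult_assoc1)
  ultimately show "a \<odot>\<^sub>M x \<in> leading_submodule as \<alpha>"
    using aR x by (simp add: leading_submodule_def colon_def)
qed

text \<open>
  The sets \<open>U\<close> that are closed upwards in the order index the steps of a filtration of \<open>J\<^sup>n M\<close> above
  \<open>J\<^sup>n\<^sup>+\<^sup>1 M\<close>. Removing the least element \<open>\<alpha>\<close> of \<open>U\<close> removes one factor, which multiplication by \<open>a\<^sup>\<alpha>\<close>
  identifies with \<open>M / K\<^sub>\<alpha>\<close>.
\<close>

lemma qlen_leading_sum:
  assumes as: "set as \<subseteq> carrier R"
    and U: "U \<subseteq> multi_idx (length as) n"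
    and up: "\<And>\<alpha> \<beta>. \<alpha> \<in> U \<Longrightarrow> \<beta> \<in> multi_idx (length as) n \<Longrightarrow> lex_less \<alpha> \<beta> \<Longrightarrow> \<beta> \<in> U"
  shows "qlen ((R.monomial as ` (U \<union> multi_idx (length as) (Suc n))) \<star> carrier M)
      (monomials as (Suc n) \<star> carrier M)
    = (\<Sum>\<alpha>\<in>U. qlen (carrier M) (leading_submodule as \<alpha>))"
proof -
  have "finite U" by (rule finite_subset[OF U finite_multi_idx])
  then show ?thesis using U up
  proof (induction "card U" arbitrary: U)
    case 0
    then show ?case by (simp add: monomials_def)
  next
    case (Suc c)
    let ?t = "length as"
    let ?W = "\<lambda>V. (R.monomial as ` (V \<union> multi_idx ?t (Suc n))) \<star> carrier M"
    have "U \<noteq> {}" using Suc.hyps(2) by auto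
    then obtain \<alpha> where \<alpha>: "\<alpha> \<in> U" "\<forall>\<beta>\<in>U. \<beta> \<noteq> \<alpha> \<longrightarrow> lex_less \<alpha> \<beta>"
      using lex_minimum[OF Suc.prems(1), of ?t] Suc.prems(2) by (auto simp: multi_idx_def)
    have len: "length \<alpha> = ?t" "sum_list \<alpha> = n" using \<alpha>(1) Suc.prems(2) by (auto simp: multi_idx_def)
    let ?V = "U - {\<alpha>}"
    have V: "?V = {\<beta> \<in> multi_idx ?t n. lex_less \<alpha> \<beta>}"
      using \<alpha> Suc.prems(2,3) lex_less_irrefl by blast
    \<comment> \<open>As \<open>U\<close> is closed upwards, what remains of it is exactly what comes after \<open>\<alpha>\<close>.\<close>
    have lead: "?V \<union> multi_idx ?t (Suc n) = leading_indices \<alpha>"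
      unfolding V using len by (auto simp: leading_indices_def multi_idx_def)
    have IH: "qlen (?W ?V) (monomials as (Suc n) \<star> carrier M)
        = (\<Sum>\<alpha>\<in>?V. qlen (carrier M) (leading_submodule as \<alpha>))"
    proof (rule Suc.hyps(1))
      show "c = card ?V" using Suc.hyps(2) Suc.prems(1) \<alpha>(1) by simp
      show "finite ?V" "?V \<subseteq> multi_idx ?t n" using Suc.prems(1,2) by auto
      show "\<gamma> \<in> ?V" if "\<beta> \<in> ?V" "\<gamma> \<in> multi_idx ?t n" "lex_less \<beta> \<gamma>" for \<beta> \<gamma>
        using that lex_less_trans unfolding V by blast
    qed
    let ?S = "(\<lambda>x. R.monomial as \<alpha> \<odot>\<^sub>M x) ` carrier M"
    note mc = R.monomial_closed[OF as]
    have W: "sub (?W V)" for V by (rule sub_leading_mult[OF as])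
    have S: "sub ?S" by (rule sub_scal[OF mc sub_carrierM])
    have "R.monomial as ` (U \<union> multi_idx ?t (Suc n))
        = insert (R.monomial as \<alpha>) (R.monomial as ` (?V \<union> multi_idx ?t (Suc n)))"
      using \<alpha>(1) by blast
    then have WU: "?W U = ?S <+>\<^sub>M ?W ?V"
      using mult_insert[OF mc monomial_image_carrier[OF as] sub_carrierM] by simp
    have Z: "sub (monomials as (Suc n) \<star> carrier M)"
      "monomials as (Suc n) \<star> carrier M \<subseteq> ?W ?V"
      unfolding monomials_def
      by (rule sub_leading_mult[OF as])
         (intro mult_mono image_mono monomial_image_carrier[OF as] order_refl Un_upper2)
    have "qlen (?W U) (monomials as (Suc n) \<star> carrier M)
        = qlen (?W U) (?W ?V) + qlen (?W ?V) (monomials as (Suc n) \<star> carrier M)"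
    proof (rule qlen_add[OF W W Z])
      show "?W ?V \<subseteq> ?W U" unfolding WU by (rule sum_upper2[OF S W])
    qed
    also have "qlen (?W U) (?W ?V) = qlen (carrier M) (carrier M \<inter> colon M (?W ?V) (R.monomial as \<alpha>))"
      unfolding WU by (rule qlen_scal[OF sub_carrierM W mc])
    also have "carrier M \<inter> colon M (?W ?V) (R.monomial as \<alpha>) = leading_submodule as \<alpha>"
      unfolding leading_submodule_def lead by (auto simp: colon_def)
    finally show ?case
      unfolding IH using sum.remove[OF Suc.prems(1) \<alpha>(1), of "\<lambda>\<alpha>. qlen (carrier M) (leading_submodule as \<alpha>)"] by simp
  qed
qed

lemma adic_hilbert_series_pole:
  assumes as: "set as \<subseteq> carrier R" and fin: "qlen (carrier M) (set as \<star> carrier M) \<noteq> \<infinity>"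
  shows "pole_le (length as) (Abs_fps (\<lambda>n. int (the_enat
     (qlen (monomials as n \<star> carrier M) (monomials as (Suc n) \<star> carrier M)))))"
proof -
  let ?t = "length as"
  define f where "f \<alpha> = the_enat (qlen (carrier M) (leading_submodule as \<alpha>))" for \<alpha>
  have sas: "sub (set as \<star> carrier M)" by (rule sub_mult[OF as order_refl])
  have f: "enat (f \<alpha>) = qlen (carrier M) (leading_submodule as \<alpha>)" if "length \<alpha> = ?t" for \<alpha>
  proof -
    have "qlen (carrier M) (leading_submodule as \<alpha>) \<le> qlen (carrier M) (set as \<star> carrier M)"
      by (rule qlen_antimono[OF sub_carrierM sas sub_leading_submodule[OF as]
            mult_subset_leading_submodule[OF as that] submoduleE(1)[OF sub_leading_submodule[OF as]]])
    then have "qlen (carrier M) (leading_submodule as \<alpha>) \<noteq> \<infinity>" using fin by (rule enat_finite_le)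
    then show ?thesis unfolding f_def by auto
  qed
  have "antitone_idx ?t f"
    unfolding antitone_idx_def
  proof (intro allI impI)
    fix \<alpha> \<beta> :: "nat list" assume len: "length \<alpha> = ?t" and le: "list_all2 (\<le>) \<alpha> \<beta>"
    have lenb: "length \<beta> = ?t" using list_all2_lengthD[OF le] len by simp
    have "enat (f \<beta>) \<le> enat (f \<alpha>)"
      unfolding f[OF len] f[OF lenb]
      by (rule qlen_antimono[OF sub_carrierM sub_leading_submodule[OF as] sub_leading_submodule[OF as]
            leading_submodule_mono[OF as len le] submoduleE(1)[OF sub_leading_submodule[OF as]]])
    then show "f \<beta> \<le> f \<alpha>" by simp
  qed
  then have pole: "pole_le ?t (Abs_fps (\<lambda>n. \<Sum>\<alpha>\<in>multi_idx ?t n. int (f \<alpha>)))" by (rule pole_le_antitone_idx)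
  have "int (the_enat (qlen (monomials as n \<star> carrier M) (monomials as (Suc n) \<star> carrier M)))
      = (\<Sum>\<alpha>\<in>multi_idx ?t n. int (f \<alpha>))" for n
  proof -
    let ?Z = "monomials as (Suc n) \<star> carrier M"
    have "(R.monomial as ` (multi_idx ?t n \<union> multi_idx ?t (Suc n))) \<star> carrier M
        = monomials as n \<star> carrier M"
    proof
      have s: "sub (monomials as k \<star> carrier M)" for k
        by (intro sub_mult monomials_carrier as order_refl)
      have "?Z = set as \<star> (monomials as n \<star> carrier M)"
        by (rule monomials_Suc(1)[OF as sub_carrierM, symmetric])
      then have Z: "?Z \<subseteq> monomials as n \<star> carrier M" using mult_subset[OF s as] by simp
      show "(R.monomial as ` (multi_idx ?t n \<union> multi_idx ?t (Suc n))) \<star> carrier M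
        \<subseteq> monomials as n \<star> carrier M"
      proof (rule mult_least[OF s])
        fix b x assume b: "b \<in> R.monomial as ` (multi_idx ?t n \<union> multi_idx ?t (Suc n))" and x: "x \<in> carrier M"
        then have "b \<in> monomials as n \<or> b \<in> monomials as (Suc n)" by (auto simp: monomials_def)
        then show "b \<odot>\<^sub>M x \<in> monomials as n \<star> carrier M"
          using mult_upper[OF _ x] Z by blast
      qed
      show "monomials as n \<star> carrier M
        \<subseteq> (R.monomial as ` (multi_idx ?t n \<union> multi_idx ?t (Suc n))) \<star> carrier M"
        unfolding monomials_def by (intro mult_mono monomial_image_carrier as order_refl) blast
    qed
    then have "qlen (monomials as n \<star> carrier M) ?Z
        = (\<Sum>\<alpha>\<in>multi_idx ?t n. qlen (carrier M) (leading_submodule as \<alpha>))"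
      using qlen_leading_sum[OF as order_refl, of n] by simp
    also have "\<dots> = (\<Sum>\<alpha>\<in>multi_idx ?t n. enat (f \<alpha>))"
      using f by (intro sum.cong refl) (simp add: multi_idx_def)
    also have "\<dots> = enat (\<Sum>\<alpha>\<in>multi_idx ?t n. f \<alpha>)" by (simp add: of_nat_sum flip: of_nat_eq_enat)
    finally show ?thesis by simp
  qed
  then show ?thesis using pole by simp
qed

end

section \<open>Comparing the two filtrations\<close>

text \<open>
  A definite description has a value only if a polynomial with the property exists; this is where the
  bound on the pole enters.
\<close>

lemma h_poly_eq:
  assumes "pole_le (the_enat (module_dim R M)) (hilbert_series R M F)"
  shows "fps_of_poly (h_poly R M F) = hilbert_series R M F * (1 - fps_X) ^ the_enat (module_dim R M)"
proof -
  obtain p where p: "fps_of_poly p = hilbert_series R M F * (1 - fps_X) ^ the_enat (module_dim R M)"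
    using assms by (auto simp: pole_le_def)
  show ?thesis
    unfolding h_poly_def
  proof (rule theI[of _ p])
    show "h = p" if "fps_of_poly h = hilbert_series R M F * (1 - fps_X) ^ the_enat (module_dim R M)" for h
      using that p by (metis fps_of_poly_eq_iff)
  qed (rule p)
qed

context superficial_reduction
begin

abbreviation powers where "powers n X \<equiv> monomials as n \<star> X"

lemma sub_powers: "sub X \<Longrightarrow> sub (powers n X)"
  by (intro sub_mult monomials_carrier as_carrier submoduleE(1))

lemma J_mult: "sub X \<Longrightarrow> J \<star> X = set as \<star> X"
  by (rule mult_Idl[OF as_carrier])

lemma J_mult_F: "set as \<star> F n \<subseteq> F (Suc n)"
  by (rule mult_least[OF F_sub]) (use F_smult as_subset_q in blast)

lemma adic_eq: "adic_filtration R M J n = powers n (carrier M)"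
  by (rule adic_filtration_monomials[OF as_carrier])

lemma powers_Suc_subset: "powers (Suc n) (carrier M) \<subseteq> powers n (carrier M)"
  unfolding monomials_Suc(1)[OF as_carrier sub_carrierM, symmetric]
  by (rule mult_subset[OF sub_powers[OF sub_carrierM] as_carrier])

lemma powers_subset_F: "powers n (carrier M) \<subseteq> F n"
proof (induction n)
  case 0
  show ?case using monomials_0[OF sub_carrierM as_carrier] F_0 by simp
next
  case (Suc n)
  have "powers (Suc n) (carrier M) = set as \<star> (powers n (carrier M))"
    by (rule monomials_Suc(1)[OF as_carrier sub_carrierM, symmetric])
  also have "\<dots> \<subseteq> set as \<star> F n" by (rule mult_mono[OF order_refl Suc as_carrier F_carrier])
  finally show ?case using J_mult_F by blast
qed

lemma qlen_powers_finite: "qlen (carrier M) (powers n (carrier M)) \<noteq> \<infinity>"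
proof -
  have "(ideal_mult R M (set as) ^^ n) (carrier M) = powers n (carrier M)" for n
  proof (induction n)
    case 0
    then show ?case using monomials_0[OF sub_carrierM as_carrier] by simp
  next
    case (Suc n)
    then show ?case using monomials_Suc(1)[OF as_carrier sub_carrierM, of n] by simp
  qed
  then show ?thesis
    using qlen_mult_powers_finite[OF finite_set as_carrier qlen_mod_J_finite, of n] by simp
qed

text \<open>
  The \<open>j\<close>-th summand on the right-hand side of the theorem.
\<close>

definition defect :: "nat \<Rightarrow> enat" where
  "defect j = qlen (F (Suc j)) (set as \<star> (F j))"

text \<open>
  The chain \<open>X\<^sub>i = J\<^sup>i F\<^sub>n\<^sub>+\<^sub>1\<^sub>-\<^sub>i\<close> runs from \<open>F\<^sub>n\<^sub>+\<^sub>1\<close> down to \<open>J\<^sup>n\<^sup>+\<^sup>1 M\<close>. Its \<open>i\<close>-th factor needs one copy of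
  \<open>F\<^sub>n\<^sub>-\<^sub>i\<^sub>+\<^sub>1 / J F\<^sub>n\<^sub>-\<^sub>i\<close> per monomial of degree \<open>i\<close>, and the number of monomials is bounded uniformly in
  \<open>i \<le> n\<close>.
\<close>

lemma qlen_F_powers_le:
  assumes k: "length as \<le> Suc k"
  shows "qlen (F (Suc n)) (powers (Suc n) (carrier M)) \<le> of_nat ((n + k) choose k) * (\<Sum>j\<le>n. defect j)"
proof -
  let ?X = "\<lambda>i. powers i (F (Suc n - i))"
  have X: "sub (?X i)" for i by (rule sub_powers[OF F_sub])
  have X_Suc: "?X (Suc i) = powers i (set as \<star> (F (n - i)))" for i
    using monomials_Suc(2)[OF as_carrier F_sub] by simp
  have sJ: "sub (set as \<star> F i)" for i by (rule sub_mult[OF as_carrier F_carrier])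
  have step: "?X (Suc i) \<subseteq> ?X i \<and> qlen (?X i) (?X (Suc i)) \<le> of_nat ((n + k) choose k) * defect (n - i)"
    if i: "i \<le> n" for i
  proof -
    have e: "Suc n - i = Suc (n - i)" using i by simp
    have le: "set as \<star> (F (n - i)) \<subseteq> F (Suc n - i)" unfolding e by (rule J_mult_F)
    have "qlen (?X i) (?X (Suc i)) \<le> of_nat (card (monomials as i)) * defect (n - i)"
      unfolding X_Suc defect_def e[symmetric]
      by (rule qlen_mult_le[OF finite_monomials monomials_carrier[OF as_carrier] F_sub sJ le])
    also have "\<dots> \<le> of_nat ((n + k) choose k) * defect (n - i)"
      using card_monomials[of as i] card_multi_idx_le[OF k i as_nonempty]
      by (intro mult_right_mono) (simp_all add: of_nat_eq_enat)
    finally show ?thesis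
      unfolding X_Suc using mult_mono[OF order_refl le monomials_carrier[OF as_carrier] F_carrier] by blast
  qed
  have "i \<le> Suc n \<Longrightarrow> ?X i \<subseteq> ?X 0 \<and> qlen (?X 0) (?X i) \<le> (\<Sum>l<i. of_nat ((n + k) choose k) * defect (n - l))" for i
  proof (induction i)
    case (Suc i)
    have i: "i \<le> n" using Suc.prems by simp
    have IH: "?X i \<subseteq> ?X 0" "qlen (?X 0) (?X i) \<le> (\<Sum>l<i. of_nat ((n + k) choose k) * defect (n - l))"
      using Suc.IH i by simp_all
    have "qlen (?X 0) (?X (Suc i)) = qlen (?X 0) (?X i) + qlen (?X i) (?X (Suc i))"
      by (rule qlen_add[OF X X X conjunct1[OF step[OF i]] IH(1)])
    also have "\<dots> \<le> (\<Sum>l<i. of_nat ((n + k) choose k) * defect (n - l)) + of_nat ((n + k) choose k) * defect (n - i)"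
      by (rule add_mono[OF IH(2) conjunct2[OF step[OF i]]])
    finally show ?case using IH(1) step[OF i] by (simp only: sum.lessThan_Suc) blast
  qed simp
  from this[of "Suc n"] have "qlen (?X 0) (?X (Suc n)) \<le> (\<Sum>l<Suc n. of_nat ((n + k) choose k) * defect (n - l))"
    by blast
  moreover have "?X 0 = F (Suc n)" using monomials_0[OF F_sub as_carrier] by simp
  moreover have "?X (Suc n) = powers (Suc n) (carrier M)" by (simp add: F_0)
  ultimately have "qlen (F (Suc n)) (powers (Suc n) (carrier M))
      \<le> (\<Sum>l<Suc n. of_nat ((n + k) choose k) * defect (n - l))" by metis
  also have "\<dots> = of_nat ((n + k) choose k) * (\<Sum>l<Suc n. defect (n - l))" by (simp only: sum_distrib_left)
  also have "(\<Sum>l<Suc n. defect (n - l)) = (\<Sum>j\<le>n. defect j)"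
    using sum.nat_diff_reindex[of defect "Suc n"] by (simp add: lessThan_Suc_atMost)
  finally show ?thesis .
qed

lemma enat_diff_int:
  "enat a = x \<Longrightarrow> enat b = y \<Longrightarrow> x = y + z \<Longrightarrow> int (the_enat z) = int a - int b"
  by (cases z) auto

lemma enat_hilbert_samuel_zero: "enat (hilbert_samuel {\<zero>\<^sub>M} n) = qlen (carrier M) (F n)"
proof -
  have "F n <+>\<^sub>M {\<zero>\<^sub>M} = F n"
    using sub_zero[OF F_sub] by (intro sum_absorb1 F_sub sub_zeroM) auto
  then show ?thesis using enat_hilbert_samuel[OF sub_zeroM, of n] by simp
qed

lemma hilbert_series_F:
  "hilbert_series R M F = (1 - fps_X) * Abs_fps (\<lambda>n. int (hilbert_samuel {\<zero>\<^sub>M} (Suc n)))"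
proof (rule fps_ext)
  fix n
  note L = enat_hilbert_samuel_zero
  have "hilbert_samuel {\<zero>\<^sub>M} 0 = 0" using L[of 0] by (simp add: F_0 zero_enat_def)
  moreover have "int (the_enat (length_quot R M (F n) (F (Suc n))))
      = int (hilbert_samuel {\<zero>\<^sub>M} (Suc n)) - int (hilbert_samuel {\<zero>\<^sub>M} n)"
    unfolding length_quot_eq_qlen[OF F_sub F_sub F_Suc]
    by (rule enat_diff_int[OF L L qlen_add[OF sub_carrierM F_sub F_sub F_Suc F_carrier]])
  ultimately show "fps_nth (hilbert_series R M F) n
     = fps_nth ((1 - fps_X) * Abs_fps (\<lambda>n. int (hilbert_samuel {\<zero>\<^sub>M} (Suc n)))) n"
    by (cases n) (simp_all add: hilbert_series_def fps_mult_one_minus_X_nth)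
qed

definition adic_samuel :: "nat \<Rightarrow> nat" where
  "adic_samuel n = the_enat (qlen (carrier M) (powers n (carrier M)))"

lemma enat_adic_samuel: "enat (adic_samuel n) = qlen (carrier M) (powers n (carrier M))"
  unfolding adic_samuel_def using qlen_powers_finite[of n] by auto

lemma hilbert_series_adic:
  "hilbert_series R M (adic_filtration R M J) = Abs_fps (\<lambda>n. int (the_enat
     (qlen (powers n (carrier M)) (powers (Suc n) (carrier M)))))"
  by (simp add: hilbert_series_def adic_eq[abs_def]
      length_quot_eq_qlen[OF sub_powers[OF sub_carrierM] sub_powers[OF sub_carrierM] powers_Suc_subset])

lemma hilbert_series_adic_conv_samuel:
  "hilbert_series R M (adic_filtration R M J) = (1 - fps_X) * Abs_fps (\<lambda>n. int (adic_samuel (Suc n)))"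
proof (rule fps_ext)
  fix n
  note s = sub_powers[OF sub_carrierM]
  have "adic_samuel 0 = 0"
    using enat_adic_samuel[of 0] monomials_0[OF sub_carrierM as_carrier] by (simp add: zero_enat_def)
  moreover have "int (the_enat (qlen (powers n (carrier M)) (powers (Suc n) (carrier M))))
      = int (adic_samuel (Suc n)) - int (adic_samuel n)"
    by (rule enat_diff_int[OF enat_adic_samuel enat_adic_samuel
          qlen_add[OF sub_carrierM s s powers_Suc_subset submoduleE(1)[OF s]]])
  ultimately show "fps_nth (hilbert_series R M (adic_filtration R M J)) n
     = fps_nth ((1 - fps_X) * Abs_fps (\<lambda>n. int (adic_samuel (Suc n)))) n"
    unfolding hilbert_series_adic by (cases n) (simp_all add: fps_mult_one_minus_X_nth)
qed

text \<open>
  \<open>D\<close> is the generating function of the lengths of \<open>F\<^sub>n\<^sub>+\<^sub>1 / J\<^sup>n\<^sup>+\<^sup>1 M\<close>, and \<open>u\<close> is the difference of the two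
  \<open>h\<close>-polynomials, so that the difference of the first coefficients is \<open>- u'(1)\<close>.
\<close>

lemma hilbert_coeff_difference_le:
  assumes r: "module_dim R M = enat r"
  shows "ereal (hilbert_coeff R M F 1 - hilbert_coeff R M (adic_filtration R M J) 1)
    \<le> (\<Sum>j. ereal_of_enat (defect j))"
proof (cases "(\<Sum>j. ereal_of_enat (defect j))")
  case (real S)
  let ?N = "adic_filtration R M J"
  have tr: "length as \<le> r" using length_le_dim r by simp
  then obtain k where k: "r = Suc k" using as_nonempty by (cases r) auto
  define D where "D = Abs_fps (\<lambda>n. int (adic_samuel (Suc n)) - int (hilbert_samuel {\<zero>\<^sub>M} (Suc n)))"
  have D: "hilbert_series R M ?N - hilbert_series R M F = (1 - fps_X) * D"
  proof -
    have "D = Abs_fps (\<lambda>n. int (adic_samuel (Suc n))) - Abs_fps (\<lambda>n. int (hilbert_samuel {\<zero>\<^sub>M} (Suc n)))"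
      unfolding D_def by (rule fps_ext) simp
    then show ?thesis unfolding hilbert_series_F hilbert_series_adic_conv_samuel by (simp add: right_diff_distrib)
  qed
  have pF: "pole_le r (hilbert_series R M F)"
    unfolding hilbert_series_F pole_le_Suc_iff 
    by (rule pole_le_mono[OF pole_hilbert_samuel]) (simp add: tr)
  have pN: "pole_le r (hilbert_series R M ?N)"
    unfolding hilbert_series_adic
    using adic_hilbert_series_pole[OF as_carrier qlen_mod_J_finite] tr by (rule pole_le_mono)
  have hF: "fps_of_poly (h_poly R M F) = hilbert_series R M F * (1 - fps_X) ^ r"
    using h_poly_eq[of R M F] pF r by simp
  have hN: "fps_of_poly (h_poly R M ?N) = hilbert_series R M ?N * (1 - fps_X) ^ r"
    using h_poly_eq[of R M ?N] pN r by simp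
  let ?u = "h_poly R M ?N - h_poly R M F"
  have "fps_of_poly ?u = (hilbert_series R M ?N - hilbert_series R M F) * (1 - fps_X) ^ r"
    by (simp only: fps_of_poly_diff hF hN left_diff_distrib)
  then have u: "fps_of_poly ?u = D * (1 - fps_X) ^ Suc (Suc k)"
    unfolding D k by (simp add: mult_ac)
  have Dn: "fps_nth D n = int (the_enat (qlen (F (Suc n)) (powers (Suc n) (carrier M))))" for n
    unfolding D_def
    using enat_diff_int[OF enat_adic_samuel enat_hilbert_samuel_zero
        qlen_add[OF sub_carrierM F_sub sub_powers[OF sub_carrierM] powers_subset_F F_carrier]]
    by simp
  have "- real_of_int (poly (pderiv ?u) 1) \<le> S"
  proof (rule derivative_bound[OF u])
    show "0 \<le> fps_nth D n" for n unfolding Dn by simp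
    show "real_of_int (fps_nth D n) \<le> S * real ((n + k) choose k)" for n
    proof -
      have "ereal_of_enat (\<Sum>j\<le>n. defect j) = (\<Sum>j\<le>n. ereal_of_enat (defect j))"
        by (induction n) (simp_all add: ereal_of_enat_add)
      also have "\<dots> \<le> (\<Sum>j. ereal_of_enat (defect j))"
        by (rule sum_le_suminf) (auto intro: summable_ereal_pos)
      finally have "ereal_of_enat (\<Sum>j\<le>n. defect j) \<le> ereal S" using real by simp
      then obtain s where s: "(\<Sum>j\<le>n. defect j) = enat s" "real s \<le> S"
        by (cases "\<Sum>j\<le>n. defect j") auto
      have "qlen (F (Suc n)) (powers (Suc n) (carrier M)) \<le> of_nat ((n + k) choose k) * enat s"
        using qlen_F_powers_le[of k n] tr k s(1) by simp
      then have "the_enat (qlen (F (Suc n)) (powers (Suc n) (carrier M))) \<le> ((n + k) choose k) * s"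
        by (cases "qlen (F (Suc n)) (powers (Suc n) (carrier M))") (auto simp: of_nat_eq_enat)
      then have "real_of_int (fps_nth D n) \<le> real (((n + k) choose k) * s)"
        unfolding Dn of_int_of_nat_eq by (rule of_nat_mono)
      also have "\<dots> \<le> S * real ((n + k) choose k)" using s(2) by (simp add: mult.commute mult_left_mono)
      finally show ?thesis .
    qed
  qed
  moreover have "hilbert_coeff R M F 1 - hilbert_coeff R M ?N 1 = - real_of_int (poly (pderiv ?u) 1)"
    by (simp add: hilbert_coeff_def pderiv_diff)
  ultimately show ?thesis unfolding real by simp
next
  case MInf
  have "0 \<le> (\<Sum>j. ereal_of_enat (defect j))" by (rule suminf_0_le) (auto intro: summable_ereal_pos)
  then show ?thesis using MInf by simp
qed simp

end

theorem proposition2p3p2: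
  fixes A :: "('a, 'c) ring_scheme" and M :: "('a, 'b, 'd) module_scheme"
    and \<mm> q J :: "'a set" and F :: "nat \<Rightarrow> 'b set" and as :: "'a list" and r :: nat
  assumes "noetherian_local_ring A \<mm>"
    and "primary_to A \<mm> q"
    and "module A M" and "fin_gen_module A M" and "carrier M \<noteq> {\<zero>\<^bsub>M\<^esub>}"
    and "good_filtration A M q F"
    and "module_dim A M = enat r" and "1 \<le> r"
    and "maximal_superficial_sequence A M q F as"
    and "J = Idl\<^bsub>A\<^esub> (set as)"
  shows "ereal (hilbert_coeff A M F 1 - hilbert_coeff A M (adic_filtration A M J) 1)
         \<le> (\<Sum>j. ereal_of_enat (length_quot A M (F (Suc j)) (ideal_mult A M J (F j))))"
proof -
  interpret superficial_reduction A M \<mm> q F as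
    using assms(1-4,6,9)
    by (intro superficial_reduction.intro superficial_reduction_axioms.intro
        filtered_module.intro filtered_module_axioms.intro)
  have "length_quot A M (F (Suc j)) (ideal_mult A M J (F j)) = defect j" for j
    unfolding assms(10) J_mult[OF F_sub] defect_def
    by (rule length_quot_eq_qlen[OF F_sub sub_mult[OF as_carrier F_carrier] J_mult_F])
  then show ?thesis using hilbert_coeff_difference_le[OF assms(7)] unfolding assms(10) by simp
qed

end
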